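(* Let $G_0\in\{\mathrm{PSL}(2,5),\mathrm{PSL}(2,7)\}$ and let $G$ be a finite group such that the posets $\mathrm{Iso}(G)$ and $\mathrm{Iso}(G_0)$ of classes of isomorphic subgroups are isomorphic (as partially ordered sets). Then $G\cong G_0$.
   Context: For a group $G$, the poset of classes of isomorphic subgroups of $G$ is $\mathrm{Iso}(G)=\{[H]\mid H\leq G\}$, where $[H]=\{K\leq G\mid K\cong H\}$ (isomorphism as abstract groups). It is partially ordered by: $[H_1]\leq[H_2]$ if and only if $K_1\subseteq K_2$ for some $K_1\in[H_1]$ and $K_2\in[H_2]$. A poset isomorphism is a bijection that preserves and reflects the order. *)

theory Defs
  imports "HOL-Algebra.Algebra" "HOL-Number_Theory.Residues"
begin

definition iso_class :: "('a, 'm) monoid_scheme \<Rightarrow> 'a set \<Rightarrow> 'a set set" where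
  "iso_class G H = {K. subgroup K G \<and> G\<lparr>carrier := K\<rparr> \<cong> G\<lparr>carrier := H\<rparr>}"

definition iso_poset :: "('a, 'm) monoid_scheme \<Rightarrow> 'a set set gorder" where
  "iso_poset G =
    \<lparr>carrier = {iso_class G H | H. subgroup H G},
     eq = (=),
     le = (\<lambda>C D. \<exists>K\<^sub>1\<in>C. \<exists>K\<^sub>2\<in>D. K\<^sub>1 \<subseteq> K\<^sub>2)\<rparr>"

definition poset_isomorphic :: "('a, 'c) gorder_scheme \<Rightarrow> ('b, 'd) gorder_scheme \<Rightarrow> bool" where
  "poset_isomorphic A B \<longleftrightarrow>
    (\<exists>f. bij_betw f (carrier A) (carrier B) \<and>
      (\<forall>x\<in>carrier A. \<forall>y\<in>carrier A. x \<sqsubseteq>\<^bsub>A\<^esub> y \<longleftrightarrow> f x \<sqsubseteq>\<^bsub>B\<^esub> f y))"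

definition group_center :: "('a, 'm) monoid_scheme \<Rightarrow> 'a set" where
  "group_center G = {z \<in> carrier G. \<forall>x\<in>carrier G. z \<otimes>\<^bsub>G\<^esub> x = x \<otimes>\<^bsub>G\<^esub> z}"

text \<open>A 2-by-2 matrix with rows (a, b) and (c, d) is encoded as the tuple (a, b, c, d).\<close>

definition SL2 :: "('a, 'm) ring_scheme \<Rightarrow> ('a \<times> 'a \<times> 'a \<times> 'a) monoid" where
  "SL2 R =
    \<lparr>carrier = {(a, b, c, d) | a b c d.
       a \<in> carrier R \<and> b \<in> carrier R \<and> c \<in> carrier R \<and> d \<in> carrier R \<and>
       (a \<otimes>\<^bsub>R\<^esub> d) \<ominus>\<^bsub>R\<^esub> (b \<otimes>\<^bsub>R\<^esub> c) = \<one>\<^bsub>R\<^esub>},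
     monoid.mult = (\<lambda>(a, b, c, d) (a', b', c', d').
       ((a \<otimes>\<^bsub>R\<^esub> a') \<oplus>\<^bsub>R\<^esub> (b \<otimes>\<^bsub>R\<^esub> c'), (a \<otimes>\<^bsub>R\<^esub> b') \<oplus>\<^bsub>R\<^esub> (b \<otimes>\<^bsub>R\<^esub> d'),
        (c \<otimes>\<^bsub>R\<^esub> a') \<oplus>\<^bsub>R\<^esub> (d \<otimes>\<^bsub>R\<^esub> c'), (c \<otimes>\<^bsub>R\<^esub> b') \<oplus>\<^bsub>R\<^esub> (d \<otimes>\<^bsub>R\<^esub> d'))),
     one = (\<one>\<^bsub>R\<^esub>, \<zero>\<^bsub>R\<^esub>, \<zero>\<^bsub>R\<^esub>, \<one>\<^bsub>R\<^esub>)\<rparr>"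

definition PSL2 :: "('a, 'm) ring_scheme \<Rightarrow> ('a \<times> 'a \<times> 'a \<times> 'a) set monoid" where
  "PSL2 R = SL2 R Mod group_center (SL2 R)"

end

(* An isomorphism of the posets Iso(G) and Iso(G_0) matches the primes of the two orders, because the
   atoms are the classes of groups of prime order, and it preserves orders of subgroups up to this
   matching, because a group of order p^n is the top of a chain of length n of p-groups.  So G has order
   p^2 q r (for PSL(2,5)) or p^3 q r (for PSL(2,7)) for distinct primes, and it inherits the existence
   and non-existence of subgroups of certain orders.  A subgroup T of order p^2 q without a subgroup of
   order p q forces q to divide p + 1; Sylow counting then gives (p, q, r) = (2, 3, 5) or (2, 3, 7).
   Finally, G acts on its r + 1 Sylow r-subgroups like PSL(2,r) on the projective line, and suitable
   generators are forced to act as z + 1, k z and -1/z.  The same analysis applies to G_0 itself, so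
   both groups are isomorphic to the same explicit permutation group. *)

theory Submission
  imports Defs
begin

section \<open>Conjugation, normalizers and Sylow theory\<close>

text \<open>The obstacle is that \<open>iso_poset\<close> forgets all orders: even the primes
  dividing the order of G must be recovered. So everything before the arithmetic works with unknown
  primes p, q, r, and the locales \<open>case60\<close> and \<open>case168\<close> list only facts
  that survive a poset isomorphism: orders of subgroups as products of primes, existence of
  subgroups, and inclusions up to isomorphism. In both groups T is an alternating group of degree 4.
  Having no subgroup of order p q makes a group of order q act irreducibly on a plane over the field
  with p elements, and this is where q dvd p + 1 comes from. The Sylow r-subgroups number p q = 6
  and p^3 = 8, which is r + 1 in both cases: one of them is taken as infinity and permutes the
  others as translations. For the matrix groups, subgroups of order divisible by r are under control
  because two Sylow r-subgroups already generate the group.\<close>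

text \<open>The short name prime denotes primality in a monoid once HOL-Algebra is loaded.\<close>

abbreviation nprime :: "nat \<Rightarrow> bool" where "nprime \<equiv> Factorial_Ring.prime"

section \<open>Group actions, orbits and fixed points\<close>

context group
begin

text \<open>The action is a plain function, given on a subgroup T of a fixed ambient group. So the
  same \<open>cj\<close> can act for G, for a Sylow subgroup or for a normalizer, without changing
  the group or restricting functions as \<open>group_action\<close> requires.\<close>

definition acts :: "'a set \<Rightarrow> 'c set \<Rightarrow> ('a \<Rightarrow> 'c \<Rightarrow> 'c) \<Rightarrow> bool" where
  "acts T E a \<longleftrightarrow> subgroup T G \<and> (\<forall>g\<in>T. \<forall>x\<in>E. a g x \<in> E) \<and> (\<forall>x\<in>E. a \<one> x = x)
     \<and> (\<forall>g\<in>T. \<forall>h\<in>T. \<forall>x\<in>E. a (g \<otimes> h) x = a g (a h x))"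

lemma acts_group_action:
  assumes "acts T E a"
  shows "group_action (G\<lparr>carrier := T\<rparr>) E (\<lambda>g. restrict (a g) E)"
proof -
  have T: "subgroup T G" using assms by (auto simp: acts_def)
  interpret T: group "G\<lparr>carrier := T\<rparr>" using T by (rule subgroup_imp_group)
  have inT: "inv g \<in> T" "g \<in> carrier G" if "g \<in> T" for g
    using T that by (auto simp: subgroup.m_inv_closed subgroup.mem_carrier)
  have bij: "restrict (a g) E \<in> Bij E" if "g \<in> T" for g
  proof -
    have 1: "a (inv g) (a g x) = x" "a g (a (inv g) x) = x" if "x \<in> E" for x
      using assms inT[OF \<open>g \<in> T\<close>] that \<open>g \<in> T\<close> unfolding acts_def
      by (metis l_inv, metis r_inv)
    have "bij_betw (a g) E E"
      by (rule bij_betw_byWitness[where f' = "a (inv g)"])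
        (use 1 assms inT that in \<open>auto simp: acts_def\<close>)
    then have "bij_betw (restrict (a g) E) E E" by (simp add: bij_betw_restrict_eq)
    then show ?thesis by (auto simp: Bij_def)
  qed
  show ?thesis
    unfolding group_action_def group_hom_def group_hom_axioms_def
  proof (intro conjI T.group_axioms group_BijGroup homI)
    fix g h assume "g \<in> carrier (G\<lparr>carrier := T\<rparr>)" "h \<in> carrier (G\<lparr>carrier := T\<rparr>)"
    then show "restrict (a (g \<otimes>\<^bsub>G\<lparr>carrier := T\<rparr>\<^esub> h)) E = restrict (a g) E \<otimes>\<^bsub>BijGroup E\<^esub> restrict (a h) E"
      using assms bij by (auto simp: BijGroup_def acts_def compose_def fun_eq_iff)
  qed (use bij in \<open>auto simp: BijGroup_def\<close>)
qed

lemma orbit_stabilizer: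
  assumes "acts T E a" "x \<in> E"
  shows "card ((\<lambda>g. a g x) ` T) * card {g\<in>T. a g x = x} = card T"
proof -
  interpret group_action "G\<lparr>carrier := T\<rparr>" E "\<lambda>g. restrict (a g) E"
    using assms(1) by (rule acts_group_action)
  have "orbit (G\<lparr>carrier := T\<rparr>) (\<lambda>g. restrict (a g) E) x = (\<lambda>g. a g x) ` T"
    "stabilizer (G\<lparr>carrier := T\<rparr>) (\<lambda>g. restrict (a g) E) x = {g\<in>T. a g x = x}"
    using assms(2) by (auto simp: orbit_def stabilizer_def)
  then show ?thesis using orbit_stabilizer_theorem[OF assms(2)] by (simp add: order_def)
qed

lemma orbit_eq:
  assumes "acts T E a" "x \<in> E" "g \<in> T"
  shows "(\<lambda>h. a h (a g x)) ` T = (\<lambda>h. a h x) ` T"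
proof -
  have T: "subgroup T G" using assms by (auto simp: acts_def)
  have *: "a h (a g x) = a (h \<otimes> g) x" if "h \<in> T" for h
    using assms that by (auto simp: acts_def)
  have "a h x = a (h \<otimes> inv g \<otimes> g) x" if "h \<in> T" for h
    using subgroup.mem_carrier[OF T] assms(3) that by (simp add: m_assoc)
  then have "a h x \<in> (\<lambda>h. a h (a g x)) ` T" if "h \<in> T" for h
    using * that assms(3) T by (metis image_eqI subgroup.m_closed subgroup.m_inv_closed)
  then show ?thesis using * T assms(3) by (auto simp: subgroup.m_closed)
qed

text \<open>Orbits partition E, and their lengths divide p ^ n by \<open>orbit_stabilizer\<close>.
  An orbit of length 1 is a fixed point, so all orbits outside \<open>?F\<close> have length
  divisible by p.\<close>

lemma fixed_points_cong:
  assumes "acts K E a" "card K = p ^ n" "nprime p" "finite E"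
  shows "[card E = card {x\<in>E. \<forall>g\<in>K. a g x = x}] (mod p)"
proof -
  let ?F = "{x\<in>E. \<forall>g\<in>K. a g x = x}"
  let ?C = "(\<lambda>x. (\<lambda>g. a g x) ` K) ` (E - ?F)"
  have K: "subgroup K G" using assms by (auto simp: acts_def)
  have self: "x \<in> (\<lambda>g. a g x) ` K" if "x \<in> E" for x
    using assms(1) that subgroup.one_closed[OF K] by (force simp: acts_def)
  have un: "\<Union>?C = E - ?F"
  proof (intro equalityI subsetI)
    fix y assume "y \<in> \<Union>?C"
    then obtain x g where x: "x \<in> E - ?F" "g \<in> K" "y = a g x" by auto
    have "y \<in> E" using assms(1) x by (auto simp: acts_def)
    moreover have "y \<notin> ?F"
    proof
      assume "y \<in> ?F"
      then have "(\<lambda>h. a h x) ` K = (\<lambda>h. y) ` K"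
        using orbit_eq[OF assms(1), of x g] x by (auto cong: image_cong)
      then have "(\<lambda>h. a h x) ` K = {y}" using x by auto
      moreover have "x \<in> (\<lambda>h. a h x) ` K" using self x by blast
      ultimately show False using x \<open>y \<in> ?F\<close> by auto
    qed
    ultimately show "y \<in> E - ?F" by blast
  next
    fix x assume "x \<in> E - ?F"
    then show "x \<in> \<Union>?C" using self by blast
  qed
  have "p dvd card (\<Union>?C)"
  proof (rule dvd_partition)
    show "finite (\<Union>?C)" using un assms(4) by simp
    show "\<forall>c\<in>?C. p dvd card c"
    proof
      fix c assume "c \<in> ?C"
      then obtain x where x: "x \<in> E - ?F" "c = (\<lambda>g. a g x) ` K" by blast
      have "card c dvd p ^ n"
        using orbit_stabilizer[OF assms(1), of x] x(1) unfolding x(2) assms(2)[symmetric] by (auto intro: dvdI[OF sym])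
      then obtain k where k: "card c = p ^ k"
        using assms(3) divides_primepow_nat by blast
      have "k \<noteq> 0"
      proof
        assume "k = 0"
        then obtain y where "c = {y}" using k card_1_singletonE by auto
        moreover have "x \<in> c" using self x by auto
        ultimately have "c = {x}" by auto
        then show False using x by auto
      qed
      then show "p dvd card c" using k by simp
    qed
    show "\<forall>c1\<in>?C. \<forall>c2\<in>?C. c1 \<noteq> c2 \<longrightarrow> c1 \<inter> c2 = {}"
    proof (intro ballI impI)
      fix c1 c2 assume "c1 \<in> ?C" "c2 \<in> ?C" "c1 \<noteq> c2"
      then obtain x y where xy: "x \<in> E" "y \<in> E" "c1 = (\<lambda>g. a g x) ` K" "c2 = (\<lambda>g. a g y) ` K" by blast
      have "c1 = c2" if "a g x = a h y" "g \<in> K" "h \<in> K" for g h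
        using orbit_eq[OF assms(1) xy(1) that(2)] orbit_eq[OF assms(1) xy(2) that(3)]
        unfolding xy(3,4) that(1) by simp
      then show "c1 \<inter> c2 = {}" using xy \<open>c1 \<noteq> c2\<close> by blast
    qed
  qed
  moreover have "card E = card ?F + card (E - ?F)"
    using card_Un_disjoint[of ?F "E - ?F"] assms(4) by (simp add: Un_absorb1 Collect_restrict)
  ultimately show ?thesis using un by (auto simp: cong_def elim!: dvdE)
qed

section \<open>Conjugation and normalizers\<close>

definition cj :: "'a \<Rightarrow> 'a set \<Rightarrow> 'a set" where
  "cj g H = (\<lambda>h. g \<otimes> h \<otimes> inv g) ` H"

definition nrm :: "'a set \<Rightarrow> 'a set" where
  "nrm H = {g \<in> carrier G. cj g H = H}"

lemma cj_mem: "h \<in> H \<Longrightarrow> g \<otimes> h \<otimes> inv g \<in> cj g H"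
  by (auto simp: cj_def)

lemma cj_one: "H \<subseteq> carrier G \<Longrightarrow> cj \<one> H = H"
  by (simp add: cj_def subset_iff cong: image_cong)

lemma cj_carrier: "H \<subseteq> carrier G \<Longrightarrow> g \<in> carrier G \<Longrightarrow> cj g H \<subseteq> carrier G"
  by (auto simp: cj_def)

lemma conj_mult_dist: "g \<in> carrier G \<Longrightarrow> h \<in> carrier G \<Longrightarrow> k \<in> carrier G
   \<Longrightarrow> g \<otimes> h \<otimes> k \<otimes> inv (g \<otimes> h) = g \<otimes> (h \<otimes> k \<otimes> inv h) \<otimes> inv g"
  by (simp add: inv_mult_group m_assoc)

lemma cj_mult: "H \<subseteq> carrier G \<Longrightarrow> g \<in> carrier G \<Longrightarrow> h \<in> carrier G \<Longrightarrow> cj (g \<otimes> h) H = cj g (cj h H)"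
  unfolding cj_def image_image by (rule image_cong) (auto simp: conj_mult_dist)

lemma cj_inv_cancel: "H \<subseteq> carrier G \<Longrightarrow> g \<in> carrier G \<Longrightarrow> cj (inv g) (cj g H) = H"
  "H \<subseteq> carrier G \<Longrightarrow> g \<in> carrier G \<Longrightarrow> cj g (cj (inv g) H) = H"
  by (simp_all add: cj_mult[symmetric] cj_one)

lemma conj_inj: "g \<in> carrier G \<Longrightarrow> inj_on (\<lambda>h. g \<otimes> h \<otimes> inv g) (carrier G)"
  by (auto intro!: inj_onI)

lemma card_cj: "H \<subseteq> carrier G \<Longrightarrow> g \<in> carrier G \<Longrightarrow> card (cj g H) = card H"
  unfolding cj_def by (rule card_image, rule inj_on_subset[OF conj_inj])

lemma conj_hom: "g \<in> carrier G \<Longrightarrow> x \<in> carrier G \<Longrightarrow> y \<in> carrier G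
   \<Longrightarrow> g \<otimes> (x \<otimes> y) \<otimes> inv g = (g \<otimes> x \<otimes> inv g) \<otimes> (g \<otimes> y \<otimes> inv g)"
  by (simp add: m_assoc) (simp add: m_assoc[symmetric])

lemma conj_pow:
  assumes "t \<in> carrier G" "z \<in> carrier G" shows "(t \<otimes> z \<otimes> inv t) [^] (n::nat) = t \<otimes> z [^] n \<otimes> inv t"
  using assms by (induction n) (auto simp: conj_hom)

lemma subgroup_nat_pow_closed: "subgroup H G \<Longrightarrow> x \<in> H \<Longrightarrow> x [^] (n::nat) \<in> H"
  by (induction n) (auto simp: subgroup.one_closed subgroup.m_closed)

lemma pow_eq_iff:
  assumes "x \<in> carrier G" shows "x [^] (i::nat) = x [^] (j::nat) \<longleftrightarrow> [i = j] (mod ord x)"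
proof -
  have "x [^] i = x [^] j \<longleftrightarrow> x [^] int i = x [^] int j" by (simp add: int_pow_int)
  also have "\<dots> \<longleftrightarrow> int (ord x) dvd int j - int i" using int_pow_eq[OF assms, of "int i" "int j"] by (simp add: algebra_simps)
  also have "\<dots> \<longleftrightarrow> [i = j] (mod ord x)" by (metis cong_iff_dvd_diff cong_int_iff cong_sym)
  finally show ?thesis .
qed

lemma conj_inv: "g \<in> carrier G \<Longrightarrow> x \<in> carrier G \<Longrightarrow> inv (g \<otimes> x \<otimes> inv g) = g \<otimes> inv x \<otimes> inv g"
  by (simp add: inv_mult_group m_assoc)

lemma subgroup_cj:
  assumes "subgroup H G" "g \<in> carrier G"
  shows "subgroup (cj g H) G"
proof (rule subgroupI)
  have H: "H \<subseteq> carrier G" using assms(1) subgroup.subset by blast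
  show "cj g H \<subseteq> carrier G" using H assms(2) by (rule cj_carrier)
  show "cj g H \<noteq> {}" using subgroup.one_closed[OF assms(1)] by (auto simp: cj_def)
  fix x assume "x \<in> cj g H"
  then obtain h where h: "h \<in> H" "x = g \<otimes> h \<otimes> inv g" by (auto simp: cj_def)
  then show "inv x \<in> cj g H"
    using conj_inv[of g h] assms H by (auto simp: cj_mem subgroup.m_inv_closed)
  fix y assume "y \<in> cj g H"
  then obtain k where k: "k \<in> H" "y = g \<otimes> k \<otimes> inv g" by (auto simp: cj_def)
  have "x \<otimes> y = g \<otimes> (h \<otimes> k) \<otimes> inv g" using h k H assms(2) conj_hom[of g h k] by (simp add: subset_iff)
  then show "x \<otimes> y \<in> cj g H" using h k assms(1) by (auto simp: cj_mem subgroup.m_closed)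
qed

lemma nrm_carrier: "nrm H \<subseteq> carrier G" by (auto simp: nrm_def)

lemma nrm_mem: "g \<in> nrm H \<Longrightarrow> h \<in> H \<Longrightarrow> g \<otimes> h \<otimes> inv g \<in> H"
  using cj_mem[of h H g] by (simp add: nrm_def)

lemma subgroup_nrm:
  assumes "H \<subseteq> carrier G" shows "subgroup (nrm H) G"
proof (rule subgroupI)
  show "nrm H \<noteq> {}" using cj_one[OF assms] by (auto simp: nrm_def)
  show "inv g \<in> nrm H" if "g \<in> nrm H" for g
    using cj_inv_cancel(1)[OF assms, of g] that by (auto simp: nrm_def)
  show "g \<otimes> h \<in> nrm H" if "g \<in> nrm H" "h \<in> nrm H" for g h
    using cj_mult[OF assms, of g h] that by (auto simp: nrm_def)
qed (rule nrm_carrier)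

lemma self_subset_nrm:
  assumes "subgroup H G" shows "H \<subseteq> nrm H"
proof
  fix g assume g: "g \<in> H"
  interpret subgroup H G by fact
  have "h \<in> cj g H" if "h \<in> H" for h
  proof -
    have "h = g \<otimes> (inv g \<otimes> h \<otimes> g) \<otimes> inv g"
      using g that by (simp add: m_assoc[symmetric]) (simp add: m_assoc)
    then show ?thesis using g that cj_mem[of "inv g \<otimes> h \<otimes> g" H g] by simp
  qed
  then show "g \<in> nrm H" using g by (auto simp: nrm_def cj_def)
qed

lemma acts_cj:
  assumes "subgroup T G" "\<And>H. H \<in> E \<Longrightarrow> H \<subseteq> carrier G" "\<And>g H. g \<in> T \<Longrightarrow> H \<in> E \<Longrightarrow> cj g H \<in> E"
  shows "acts T E cj"
  using assms subgroup.mem_carrier[OF assms(1)] by (auto simp: acts_def cj_one cj_mult)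

lemma acts_conjugates:
  assumes "subgroup T G" "H \<subseteq> carrier G"
  shows "acts T ((\<lambda>g. cj g H) ` T) cj"
proof (rule acts_cj[OF assms(1)])
  fix g K assume g: "g \<in> T" and "K \<in> (\<lambda>g. cj g H) ` T"
  then obtain h where h: "h \<in> T" "K = cj h H" by blast
  then have "cj g K = cj (g \<otimes> h) H"
    using cj_mult[OF assms(2)] subgroup.mem_carrier[OF assms(1)] g by auto
  then show "cj g K \<in> (\<lambda>g. cj g H) ` T" using g h assms(1) by (auto simp: subgroup.m_closed)
qed (use subgroup.mem_carrier[OF assms(1)] cj_carrier[OF assms(2)] in auto)

lemma card_conjugates:
  assumes "subgroup T G" "H \<subseteq> carrier G"
  shows "card ((\<lambda>g. cj g H) ` T) * card (T \<inter> nrm H) = card T"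
proof -
  have T: "T \<subseteq> carrier G" using assms subgroup.subset by blast
  have H: "H \<in> (\<lambda>g. cj g H) ` T"
    using cj_one[OF assms(2)] subgroup.one_closed[OF assms(1)] by (metis imageI)
  have "{g \<in> T. cj g H = H} = T \<inter> nrm H" using T by (auto simp: nrm_def)
  then show ?thesis using orbit_stabilizer[OF acts_conjugates[OF assms] H] by simp
qed

end

section \<open>Finite groups: orders, products of subgroups and Sylow theory\<close>

locale fin_group = group +
  assumes fin: "finite (carrier G)"
begin

lemma finite_sub: "subgroup H G \<Longrightarrow> finite H"
  by (rule finite_subset[OF subgroup.subset fin])

lemma card_sub_pos: "subgroup H G \<Longrightarrow> card H > 0"
  using finite_sub[of H] subgroup.one_closed[of H G] by (auto simp: card_gt_0_iff)

text \<open>Conjugation preserves cardinality, so finiteness turns the inclusion of the conjugate in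
  H into equality.\<close>

lemma in_nrmI:
  assumes "H \<subseteq> carrier G" "g \<in> carrier G" "\<And>h. h \<in> H \<Longrightarrow> g \<otimes> h \<otimes> inv g \<in> H"
  shows "g \<in> nrm H"
proof -
  have "cj g H \<subseteq> H" using assms by (auto simp: cj_def)
  then have "cj g H = H"
    using card_cj[OF assms(1,2)] fin assms(1) by (metis card_subset_eq finite_subset)
  then show ?thesis using assms by (simp add: nrm_def)
qed

lemma sub_fin_group: "subgroup T G \<Longrightarrow> fin_group (G\<lparr>carrier := T\<rparr>)"
  using subgroup_imp_group finite_sub by (simp add: fin_group_def fin_group_axioms_def)

lemma card_dvd:
  assumes "subgroup H G" "subgroup K G" "H \<subseteq> K" shows "card H dvd card K"
proof -
  interpret K: fin_group "G\<lparr>carrier := K\<rparr>" using assms(2) by (rule sub_fin_group)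
  have "subgroup H (G\<lparr>carrier := K\<rparr>)" using assms by (simp add: subgroup_incl)
  from K.lagrange[OF this] show ?thesis by (simp add: order_def) (metis dvd_triv_right)
qed

lemma card_dvd_order: "subgroup H G \<Longrightarrow> card H dvd order G"
  using card_dvd[OF _ subgroup_self] by (simp add: order_def subgroup.subset)

lemma sylow_exists:
  assumes "subgroup T G" "nprime p" "p ^ n dvd card T"
  obtains P where "subgroup P G" "P \<subseteq> T" "card P = p ^ n"
proof -
  interpret T: fin_group "G\<lparr>carrier := T\<rparr>" using assms(1) by (rule sub_fin_group)
  obtain m where "card T = p ^ n * m" using assms(3) by blast
  then obtain P where P: "subgroup P (G\<lparr>carrier := T\<rparr>)" "card P = p ^ n"
    using sylow_thm[OF assms(2) T.group_axioms _ T.fin, of n m] by (auto simp: order_def)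
  then have "subgroup P G" "P \<subseteq> T"
    using incl_subgroup[OF assms(1)] subgroup.subset by fastforce+
  then show thesis using that P by blast
qed

lemma cauchy_sub:
  assumes "subgroup T G" "nprime p" "p dvd card T"
  obtains P where "subgroup P G" "P \<subseteq> T" "card P = p"
  using sylow_exists[OF assms(1,2), of 1] assms(3) by auto

text \<open>All fibres of the multiplication map on H x K have the size of
  \<open>H \<inter> K\<close>: the pairs over h k are (h u, u^-1 k) with u in
  \<open>H \<inter> K\<close>.\<close>

lemma card_prod:
  assumes "subgroup H G" "subgroup K G"
  shows "card (H <#> K) * card (H \<inter> K) = card H * card K"
proof -
  have HK: "H \<subseteq> carrier G" "K \<subseteq> carrier G" using assms subgroup.subset by auto
  have I: "subgroup (H \<inter> K) G" using assms subgroups_Inter_pair by blast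
  let ?f = "\<lambda>(h, k). h \<otimes> k"
  have img: "?f ` (H \<times> K) = H <#> K" by (auto simp: set_mult_def)
  have fib: "card {z \<in> H \<times> K. ?f z = x} = card (H \<inter> K)" if x: "x \<in> H <#> K" for x
  proof -
    obtain h k where hk: "h \<in> H" "k \<in> K" "x = h \<otimes> k" using x by (auto simp: set_mult_def)
    have c: "h \<in> carrier G" "k \<in> carrier G" using hk HK by auto
    have "bij_betw (\<lambda>u. (h \<otimes> u, inv u \<otimes> k)) (H \<inter> K) {z \<in> H \<times> K. ?f z = x}"
    proof (rule bij_betw_byWitness[where f' = "\<lambda>(h', k'). inv h \<otimes> h'"])
      show "\<forall>u\<in>H \<inter> K. (\<lambda>(h', k'). inv h \<otimes> h') (h \<otimes> u, inv u \<otimes> k) = u"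
        using c HK by (auto simp: m_assoc[symmetric])
      have *: "inv (inv h \<otimes> h') \<otimes> k = k' \<and> inv h \<otimes> h' = k \<otimes> inv k'"
        if "h' \<in> carrier G" "k' \<in> carrier G" "h' \<otimes> k' = h \<otimes> k" for h' k'
      proof -
        have "k' = inv h' \<otimes> (h \<otimes> k)" using that c by (metis inv_solve_left m_closed)
        moreover have "h' = h \<otimes> k \<otimes> inv k'" using that c by (metis inv_solve_right m_closed)
        ultimately show ?thesis using that(1,2) c
          by (metis inv_closed inv_mult_group inv_inv m_assoc m_closed l_inv l_one)
      qed
      show "\<forall>z\<in>{z \<in> H \<times> K. ?f z = x}.
         (\<lambda>u. (h \<otimes> u, inv u \<otimes> k)) ((\<lambda>(h', k'). inv h \<otimes> h') z) = z"
        using * HK hk c by (auto simp: m_assoc[symmetric] subset_iff)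
      show "(\<lambda>u. (h \<otimes> u, inv u \<otimes> k)) ` (H \<inter> K) \<subseteq> {z \<in> H \<times> K. ?f z = x}"
      proof (rule image_subsetI)
        fix u assume "u \<in> H \<inter> K"
        then have u: "u \<in> H" "u \<in> K" by auto
        have 1: "h \<otimes> u \<in> H" "inv u \<otimes> k \<in> K"
          using u hk assms by (auto simp: subgroup.m_closed subgroup.m_inv_closed)
        have "u \<in> carrier G" using u HK by blast
        then have "h \<otimes> u \<otimes> (inv u \<otimes> k) = x" 
          unfolding hk(3) using c by (simp add: m_assoc) (simp add: m_assoc[symmetric])
        then show "(h \<otimes> u, inv u \<otimes> k) \<in> {z \<in> H \<times> K. ?f z = x}" using 1 by simp
      qed
      show "(\<lambda>(h', k'). inv h \<otimes> h') ` {z \<in> H \<times> K. ?f z = x} \<subseteq> H \<inter> K"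
      proof (rule image_subsetI)
        fix z assume "z \<in> {z \<in> H \<times> K. ?f z = x}"
        then obtain h' k' where z: "z = (h', k')" "h' \<in> H" "k' \<in> K" "h' \<otimes> k' = x" by auto
        have 1: "inv h \<otimes> h' \<in> H" using z hk assms by (auto simp: subgroup.m_closed subgroup.m_inv_closed)
        have "inv h \<otimes> h' = k \<otimes> inv k'" using *[of h' k'] z hk(3) HK by (simp add: subset_iff)
        moreover have "k \<otimes> inv k' \<in> K" using z hk assms by (auto simp: subgroup.m_closed subgroup.m_inv_closed)
        ultimately show "(\<lambda>(h', k'). inv h \<otimes> h') z \<in> H \<inter> K" using 1 z by simp
      qed
    qed
    from bij_betw_same_card[OF this] show ?thesis by simp
  qed
  have fins: "finite (H \<times> K)" using assms by (simp add: finite_sub)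
  have "card (H \<times> K) = (\<Sum>x\<in>?f ` (H \<times> K). card {z \<in> H \<times> K. ?f z = x})"
    using sum_fun_comp[OF fins, of "?f ` (H \<times> K)" ?f "\<lambda>_. 1::nat"] fins by simp
  also have "\<dots> = card (H <#> K) * card (H \<inter> K)" using fib by (simp add: img)
  finally show ?thesis by (simp add: card_cartesian_product)
qed

lemma subgroup_prod:
  assumes "subgroup H G" "subgroup K G" "K \<subseteq> nrm H"
  shows "subgroup (H <#> K) G"
proof (rule subgroupI)
  interpret H: subgroup H G by fact
  interpret K: subgroup K G by fact
  show "H <#> K \<subseteq> carrier G" by (auto simp: set_mult_def)
  show "H <#> K \<noteq> {}" using H.one_closed K.one_closed unfolding set_mult_def by blast
  fix x assume "x \<in> H <#> K"
  then obtain h k where x: "h \<in> H" "k \<in> K" "x = h \<otimes> k" by (auto simp: set_mult_def)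
  have n: "k \<otimes> h \<otimes> inv k \<in> H" if "h \<in> H" "k \<in> K" for h k using that assms(3) nrm_mem by blast
  have "inv x = (inv k \<otimes> inv h \<otimes> inv (inv k)) \<otimes> inv k" using x by (simp add: inv_mult_group m_assoc)
  then show "inv x \<in> H <#> K" using n[of "inv h" "inv k"] x unfolding set_mult_def by blast
  fix y assume "y \<in> H <#> K"
  then obtain h' k' where y: "h' \<in> H" "k' \<in> K" "y = h' \<otimes> k'" by (auto simp: set_mult_def)
  have "x \<otimes> y = (h \<otimes> (k \<otimes> h' \<otimes> inv k)) \<otimes> (k \<otimes> k')"
    using x y by (simp add: m_assoc) (metis H.mem_carrier K.mem_carrier inv_closed l_inv l_one m_assoc m_closed)
  then show "x \<otimes> y \<in> H <#> K" using n[of h' k] x y unfolding set_mult_def by blast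
qed

lemma prod_subset: "subgroup T G \<Longrightarrow> H \<subseteq> T \<Longrightarrow> K \<subseteq> T \<Longrightarrow> H <#> K \<subseteq> T"
  by (force simp: set_mult_def intro: subgroup.m_closed)

lemma subset_prod:
  assumes "subgroup H G" "subgroup K G" shows "H \<subseteq> H <#> K" "K \<subseteq> H <#> K"
proof -
  interpret H: subgroup H G by fact
  interpret K: subgroup K G by fact
  have "h \<otimes> \<one> \<in> H <#> K" if "h \<in> H" for h unfolding set_mult_def using K.one_closed that by blast
  then show "H \<subseteq> H <#> K" by auto
  have "\<one> \<otimes> k \<in> H <#> K" if "k \<in> K" for k unfolding set_mult_def using H.one_closed that by blast
  then show "K \<subseteq> H <#> K" by auto
qed

lemma coprime_inter:
  assumes "subgroup H G" "subgroup K G" "coprime (card H) (card K)"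
  shows "H \<inter> K = {\<one>}"
proof -
  have I: "subgroup (H \<inter> K) G" using assms subgroups_Inter_pair by blast
  have "card (H \<inter> K) dvd card H" "card (H \<inter> K) dvd card K" using I assms card_dvd by auto
  then have "card (H \<inter> K) = 1" using assms(3) by (metis coprime_common_divisor_nat nat_dvd_1_iff_1)
  then obtain z where "H \<inter> K = {z}" by (rule card_1_singletonE)
  then show ?thesis using subgroup.one_closed[OF I] by simp
qed

lemma coprime_prod:
  assumes "subgroup T G" "subgroup H G" "subgroup K G" "H \<subseteq> T" "K \<subseteq> T" "K \<subseteq> nrm H"
    and "coprime (card H) (card K)"
  shows "subgroup (H <#> K) G" "H <#> K \<subseteq> T" "card (H <#> K) = card H * card K"
  using card_prod[OF assms(2,3)] unfolding coprime_inter[OF assms(2,3,7)]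
  by (simp_all add: subgroup_prod[OF assms(2,3,6)] prod_subset[OF assms(1,4,5)])

text \<open>Since K normalizes P, the product PK is a subgroup. Its order is a power of p dividing
  that of T, and maximality of p ^ n gives PK = P.\<close>

lemma sylow_contains:
  assumes "subgroup T G" "subgroup P G" "P \<subseteq> T" "card P = p ^ n" "nprime p" "\<not> p ^ Suc n dvd card T"
    and "subgroup K G" "K \<subseteq> T" "card K = p ^ k" "K \<subseteq> nrm P"
  shows "K \<subseteq> P"
proof -
  have s: "subgroup (P <#> K) G" "P <#> K \<subseteq> T"
    using subgroup_prod prod_subset assms by auto
  have d: "card (P <#> K) dvd card T" using card_dvd s assms by blast
  have "card (P <#> K) dvd p ^ (n + k)"
    using card_prod[OF assms(2,7)] assms by (metis dvd_triv_left power_add)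
  then obtain j where j: "card (P <#> K) = p ^ j" using assms(5) divides_primepow_nat by blast
  have "p ^ n dvd p ^ j" using card_dvd[OF assms(2) s(1) subset_prod(1)[OF assms(2,7)]] j assms by simp
  have "j \<le> n" using d j assms(6) by (metis dvd_trans le_imp_power_dvd not_less_eq_eq)
  then have "card (P <#> K) = card P"
    using j assms \<open>p ^ n dvd p ^ j\<close> by (metis dvd_antisym le_imp_power_dvd)
  then have "P = P <#> K" using subset_prod(1)[OF assms(2,7)] s finite_sub by (metis card_subset_eq)
  then show ?thesis using subset_prod(2)[OF assms(2,7)] by simp
qed

text \<open>The p-group K acts by conjugation on the T-conjugates of P, and by
  \<open>sylow_contains\<close> it fixes a conjugate exactly when it lies inside. Taking K = P
  yields the Sylow counting statement, a general K the conjugacy statement.\<close>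

lemma sylow_conj_aux:
  assumes "subgroup T G" "subgroup P G" "P \<subseteq> T" "card P = p ^ n" "nprime p" "\<not> p ^ Suc n dvd card T"
    and "subgroup K G" "K \<subseteq> T" "card K = p ^ k"
  shows "[card ((\<lambda>g. cj g P) ` T) = card {H \<in> (\<lambda>g. cj g P) ` T. K \<subseteq> H}] (mod p)"
proof -
  let ?E = "(\<lambda>g. cj g P) ` T"
  have P: "P \<subseteq> carrier G" and T: "T \<subseteq> carrier G" using assms(1,2) by (simp_all add: subgroup.subset)
  have "acts K ?E cj" using acts_conjugates[OF assms(1) P] assms(7,8) by (auto simp: acts_def subset_iff)
  moreover have "finite ?E" using assms finite_sub by blast
  ultimately have "[card ?E = card {H \<in> ?E. \<forall>g\<in>K. cj g H = H}] (mod p)"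
    using assms fixed_points_cong by blast
  moreover have "(\<forall>g\<in>K. cj g H = H) \<longleftrightarrow> K \<subseteq> H" if HE: "H \<in> ?E" for H
  proof -
    obtain g where g: "g \<in> T" "H = cj g P" using HE by blast
    have H: "subgroup H G" "card H = p ^ n" using g T P assms subgroup_cj card_cj by auto
    have HT: "H \<subseteq> T" using g assms by (auto simp: cj_def subset_iff subgroup.m_closed subgroup.m_inv_closed)
    show ?thesis
    proof
      assume "\<forall>g\<in>K. cj g H = H"
      then have "K \<subseteq> nrm H" using assms(7) subgroup.mem_carrier by (fastforce simp: nrm_def)
      then show "K \<subseteq> H" using sylow_contains[OF assms(1) H(1) HT H(2) assms(5,6,7,8,9)] by blast
    next
      assume "K \<subseteq> H"
      then show "\<forall>g\<in>K. cj g H = H" using self_subset_nrm[OF H(1)] by (auto simp: nrm_def)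
    qed
  qed
  ultimately show ?thesis by (simp cong: conj_cong)
qed

lemma sylow_count:
  assumes "subgroup T G" "subgroup P G" "P \<subseteq> T" "card P = p ^ n" "nprime p" "\<not> p ^ Suc n dvd card T"
  shows "[card ((\<lambda>g. cj g P) ` T) = 1] (mod p)"
proof -
  have P: "P \<subseteq> carrier G" and T: "T \<subseteq> carrier G" using assms(1,2) by (simp_all add: subgroup.subset)
  have "{H \<in> (\<lambda>g. cj g P) ` T. P \<subseteq> H} = {P}"
  proof -
    have "H = P" if "H \<in> (\<lambda>g. cj g P) ` T" "P \<subseteq> H" for H
    proof -
      have "card H = card P" using that T P card_cj by auto
      moreover have "finite H" using that P assms finite_sub by (auto simp: cj_def)
      ultimately show ?thesis using that(2) card_subset_eq by metis
    qed
    moreover have "P \<in> (\<lambda>g. cj g P) ` T" using cj_one[OF P] subgroup.one_closed[OF assms(1)] by (metis imageI)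
    ultimately show ?thesis by auto
  qed
  then show ?thesis using sylow_conj_aux[OF assms assms(2,3,4)] by simp
qed

lemma sylow_conj:
  assumes "subgroup T G" "subgroup P G" "P \<subseteq> T" "card P = p ^ n" "nprime p" "\<not> p ^ Suc n dvd card T"
    and "subgroup K G" "K \<subseteq> T" "card K = p ^ k"
  obtains g where "g \<in> T" "K \<subseteq> cj g P"
proof -
  have "[card {H \<in> (\<lambda>g. cj g P) ` T. K \<subseteq> H} = 1] (mod p)"
    using sylow_conj_aux[OF assms] sylow_count[OF assms(1-6)] cong_sym cong_trans by blast
  moreover have "\<not> [0 = 1] (mod p)" using assms(5) by (metis cong_0_1_nat not_prime_1)
  ultimately have "{H \<in> (\<lambda>g. cj g P) ` T. K \<subseteq> H} \<noteq> {}" by (metis card.empty)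
  then show thesis using that by blast
qed

end

section \<open>Groups of order p^2 q without subgroups of order p q\<close>

context fin_group
begin

lemma pow_card_eq_one:
  assumes "subgroup P G" "x \<in> P" shows "x [^] card P = \<one>"
proof -
  interpret P: fin_group "G\<lparr>carrier := P\<rparr>" using assms(1) by (rule sub_fin_group)
  have "x [^]\<^bsub>G\<lparr>carrier := P\<rparr>\<^esub> order (G\<lparr>carrier := P\<rparr>) = \<one>\<^bsub>G\<lparr>carrier := P\<rparr>\<^esub>"
    using P.pow_order_eq_1 assms(2) by simp
  then show ?thesis by (simp add: order_def nat_pow_consistent[symmetric])
qed

lemma gen_subgroup: "x \<in> carrier G \<Longrightarrow> subgroup (generate G {x}) G"
  by (simp add: generate_is_subgroup)

lemma gen_self: "x \<in> generate G {x}"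
  by (simp add: generate.incl)

lemma gen_subset: "subgroup P G \<Longrightarrow> x \<in> P \<Longrightarrow> generate G {x} \<subseteq> P"
  by (simp add: generate_subgroup_incl)

lemma gen_elems:
  assumes "x \<in> carrier G" "y \<in> generate G {x}"
  obtains k :: nat where "y = x [^] k"
  using assms generate_pow_on_finite_carrier[OF fin assms(1)] by auto

lemma ord_prime:
  assumes "x \<in> carrier G" "x \<noteq> \<one>" "x [^] p = \<one>" "nprime p"
  shows "ord x = p"
  using assms pow_eq_id[of x p] ord_eq_1[of x] prime_nat_iff[of p] by auto

lemma card_gen_prime:
  assumes "x \<in> carrier G" "x \<noteq> \<one>" "x [^] p = \<one>" "nprime p"
  shows "card (generate G {x}) = p"
  using generate_pow_card[OF assms(1)] ord_prime[OF assms] by simp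

lemma prime_gen:
  assumes "subgroup P G" "card P = p" "nprime p" "x \<in> P" "x \<noteq> \<one>"
  shows "P = generate G {x}"
proof -
  have "x \<in> carrier G" using assms subgroup.mem_carrier by metis
  then have "card (generate G {x}) = p"
    using assms pow_card_eq_one[OF assms(1,4)] by (intro card_gen_prime) auto
  then show ?thesis using gen_subset[OF assms(1,4)] assms finite_sub by (metis card_subset_eq)
qed

lemma prime_inter:
  assumes "subgroup P G" "card P = p" "subgroup Q G" "card Q = p" "nprime p" "P \<noteq> Q"
  shows "P \<inter> Q = {\<one>}"
proof -
  have "x = \<one>" if x: "x \<in> P" "x \<in> Q" for x
    using prime_gen[OF assms(1,2,5) x(1)] prime_gen[OF assms(3,4,5) x(2)] assms(6) by blast
  then show ?thesis using subgroup.one_closed assms(1,3) by blast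
qed

lemma nontrivial_elem:
  assumes "subgroup P G" "card P > 1" obtains x where "x \<in> P" "x \<noteq> \<one>"
proof -
  have "P \<noteq> {\<one>}" using assms(2) by auto
  then show thesis using that subgroup.one_closed[OF assms(1)] by blast
qed

text \<open>By hypothesis x lies in the subgroup g^-1 <x> g, hence so does all of <x>; conjugating
  back by g gives the inclusion that \<open>in_nrmI\<close> asks for.\<close>

lemma gen_normI:
  assumes "g \<in> carrier G" "x \<in> carrier G" "g \<otimes> x \<otimes> inv g \<in> generate G {x}"
  shows "g \<in> nrm (generate G {x})"
proof -
  let ?H = "generate G {x}"
  have H: "subgroup ?H G" using gen_subgroup assms by blast
  have S: "subgroup (cj (inv g) ?H) G" using subgroup_cj[OF H] assms by simp
  have "inv g \<otimes> (g \<otimes> x \<otimes> inv g) \<otimes> inv (inv g) = x" using assms by (simp add: m_assoc) (simp add: m_assoc[symmetric])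
  then have "x \<in> cj (inv g) ?H" using cj_mem[OF assms(3), of "inv g"] by simp
  then have sub: "?H \<subseteq> cj (inv g) ?H" using gen_subset[OF S] by blast
  show ?thesis
  proof (rule in_nrmI)
    fix h assume "h \<in> ?H"
    then obtain k where k: "k \<in> ?H" "h = inv g \<otimes> k \<otimes> inv (inv g)" using sub by (auto simp: cj_def)
    then have "k \<in> carrier G" using H subgroup.mem_carrier by metis
    then show "g \<otimes> h \<otimes> inv g \<in> ?H" using k assms by (simp add: m_assoc) (simp add: m_assoc[symmetric])
  qed (use assms H subgroup.subset in auto)
qed

lemma nrm_dvd:
  assumes "subgroup T G" "H \<subseteq> carrier G" shows "subgroup (T \<inter> nrm H) G" "card (T \<inter> nrm H) dvd card T"
  using subgroups_Inter_pair[OF assms(1) subgroup_nrm[OF assms(2)]] card_dvd[OF _ assms(1)] by auto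

text \<open>The product of H with an s-subgroup normalizing it. This is how a normalizer that is too
  large produces a subgroup of an excluded order.\<close>

lemma coprime_normalized_prod:
  assumes "subgroup T G" "subgroup H G" "H \<subseteq> T" "nprime s" "s ^ n dvd card (T \<inter> nrm H)" "coprime (card H) s"
  obtains L where "subgroup L G" "L \<subseteq> T" "card L = card H * s ^ n"
proof -
  have H: "H \<subseteq> carrier G" using assms subgroup.subset by blast
  obtain K where K: "subgroup K G" "K \<subseteq> T \<inter> nrm H" "card K = s ^ n"
    using sylow_exists[OF nrm_dvd(1)[OF assms(1) H] assms(4,5)] by blast
  show thesis
    by (rule that, use coprime_prod[OF assms(1,2) K(1) assms(3)] K assms(6) in auto)
qed

end

text \<open>The model is the alternating group of degree 4, with p = 2 and q = 3: the part of order
  p^2 is normal, and a subgroup of order q acts on it without invariant subgroup of order p.\<close>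

locale p2q_subgroup = fin_group +
  fixes T p q
  assumes T: "subgroup T G" and card_T: "card T = p\<^sup>2 * q" and p: "nprime p" and q: "nprime q" and pq: "p \<noteq> q"
    and no_pq: "\<And>K. subgroup K G \<Longrightarrow> K \<subseteq> T \<Longrightarrow> card K \<noteq> p * q"
begin

lemma cop: "coprime p q" using p q pq by (simp add: primes_coprime)

lemma no_p_normalizes_q:
  assumes "subgroup Q G" "Q \<subseteq> T" "card Q = q" shows "\<not> p dvd card (T \<inter> nrm Q)"
proof
  assume "p dvd card (T \<inter> nrm Q)"
  then obtain L where "subgroup L G" "L \<subseteq> T" "card L = q * p"
    using coprime_normalized_prod[OF T assms(1,2) p, of 1] assms(3) cop by (auto simp: coprime_commute)
  then show False using no_pq[of L] by (simp add: mult.commute)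
qed

lemma no_q_normalizes_p:
  assumes "subgroup Z G" "Z \<subseteq> T" "card Z = p" shows "\<not> q dvd card (T \<inter> nrm Z)"
proof
  assume "q dvd card (T \<inter> nrm Z)"
  then obtain L where "subgroup L G" "L \<subseteq> T" "card L = p * q"
    using coprime_normalized_prod[OF T assms(1,2) q, of 1] assms(3) cop by auto
  then show False using no_pq by blast
qed

text \<open>By \<open>no_p_normalizes_q\<close> the order of the normalizer in T is prime to p,
  hence a divisor of q.\<close>

lemma q_selfnorm:
  assumes "subgroup Q G" "Q \<subseteq> T" "card Q = q" shows "T \<inter> nrm Q = Q"
proof -
  have Qc: "Q \<subseteq> carrier G" using assms subgroup.subset by blast
  note N = nrm_dvd[OF T Qc]
  have "coprime (card (T \<inter> nrm Q)) (p\<^sup>2)"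
    using no_p_normalizes_q[OF assms] p by (simp add: coprime_commute prime_imp_coprime)
  then have d: "card (T \<inter> nrm Q) dvd q" using N(2) card_T by (simp add: coprime_dvd_mult_right_iff)
  have "card (T \<inter> nrm Q) \<le> card Q" using dvd_imp_le[OF d] q assms(3) by (simp add: prime_gt_0_nat)
  moreover have "Q \<subseteq> T \<inter> nrm Q" using assms self_subset_nrm by blast
  ultimately show ?thesis using finite_sub[OF N(1)] by (metis card_seteq)
qed

text \<open>The p^2 conjugates of a self-normalizing subgroup of order q cover p^2 (q - 1) elements of
  order q, so every subgroup of order p^2 is the complement of these elements.\<close>

lemma p_part_unique:
  assumes "subgroup A G" "A \<subseteq> T" "card A = p\<^sup>2" "subgroup B G" "B \<subseteq> T" "card B = p\<^sup>2"
  shows "A = B"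
proof -
  obtain Q where Q: "subgroup Q G" "Q \<subseteq> T" "card Q = q" using cauchy_sub[OF T q] card_T by auto
  have Qc: "Q \<subseteq> carrier G" and Tc: "T \<subseteq> carrier G" using Q T subgroup.subset by auto
  let ?C = "(\<lambda>g. cj g Q) ` T"
  have "card ?C * q = p\<^sup>2 * q" using card_conjugates[OF T Qc] q_selfnorm[OF Q] Q card_T by simp
  then have cC: "card ?C = p\<^sup>2" using q by (simp add: prime_gt_0_nat)
  have C: "subgroup K G \<and> card K = q \<and> K \<subseteq> T" if K: "K \<in> ?C" for K
  proof -
    obtain g where g: "g \<in> T" "K = cj g Q" using K by blast
    then show ?thesis using Q Qc Tc subgroup_cj[OF Q(1), of g] card_cj[OF Qc, of g] T
      by (auto simp: cj_def subset_iff subgroup.m_closed subgroup.m_inv_closed)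
  qed
  let ?V = "\<Union>K\<in>?C. K - {\<one>}"
  have "card ?V = (\<Sum>K\<in>?C. card (K - {\<one>}))"
  proof (rule card_UN_disjoint)
    show "finite ?C" using finite_sub[OF T] by simp
    show "\<forall>K\<in>?C. finite (K - {\<one>})" using C finite_sub by blast
    show "\<forall>K\<in>?C. \<forall>L\<in>?C. K \<noteq> L \<longrightarrow> (K - {\<one>}) \<inter> (L - {\<one>}) = {}"
      using C prime_inter[OF _ _ _ _ q] by blast
  qed
  also have "\<dots> = (\<Sum>K\<in>?C. q - 1)"
  proof (rule sum.cong)
    fix K assume "K \<in> ?C"
    then have "subgroup K G" "card K = q" using C by auto
    then show "card (K - {\<one>}) = q - 1" using subgroup.one_closed[of K G] by (simp add: card_Diff_singleton)
  qed simp
  finally have cV: "card ?V = p\<^sup>2 * (q - 1)" using cC by simp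
  have VT: "?V \<subseteq> T" using C by blast
  have "card (T - ?V) = p\<^sup>2 * q - p\<^sup>2 * (q - 1)"
    unfolding card_Diff_subset[OF finite_subset[OF VT finite_sub[OF T]] VT] cV card_T ..
  also have "\<dots> = p\<^sup>2" using q by (simp add: diff_mult_distrib2[symmetric] prime_gt_0_nat Suc_leI)
  finally have cTV: "card (T - ?V) = p\<^sup>2" .
  have "D = T - ?V" if D: "subgroup D G" "D \<subseteq> T" "card D = p\<^sup>2" for D
  proof -
    have "D \<inter> K = {\<one>}" if "K \<in> ?C" for K
      using C[OF that] D cop by (intro coprime_inter) auto
    then have "D \<subseteq> T - ?V" using D(2) by blast
    then show ?thesis using D(3) cTV finite_sub[OF T] by (metis card_subset_eq finite_Diff)
  qed
  then show ?thesis using assms by metis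
qed

lemma cj_in_T:
  assumes "subgroup A G" "A \<subseteq> T" "g \<in> T"
  shows "subgroup (cj g A) G" "cj g A \<subseteq> T" "card (cj g A) = card A"
proof -
  have g: "g \<in> carrier G" and A: "A \<subseteq> carrier G"
    using assms subgroup.mem_carrier[OF T] subgroup.subset[OF assms(1)] by auto
  show "subgroup (cj g A) G" "card (cj g A) = card A" using subgroup_cj card_cj g A assms(1) by auto
  show "cj g A \<subseteq> T" using assms T by (auto simp: cj_def subset_iff subgroup.m_closed subgroup.m_inv_closed)
qed

lemma p_part_normal:
  assumes "subgroup A G" "A \<subseteq> T" "card A = p\<^sup>2" shows "T \<subseteq> nrm A"
proof
  fix g assume g: "g \<in> T"
  have "cj g A = A" using p_part_unique[OF cj_in_T(1,2)[OF assms(1,2) g] _ assms] cj_in_T(3)[OF assms(1,2) g] assms by simp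
  then show "g \<in> nrm A" using g subgroup.mem_carrier[OF T] by (simp add: nrm_def)
qed

lemma no_normal_p:
  assumes "subgroup Z G" "Z \<subseteq> T" "card Z = p" shows "\<not> T \<subseteq> nrm Z"
  using no_q_normalizes_p[OF assms] card_T by (auto simp: Int_absorb2)

text \<open>The order of Z is 1, p or p^2, and p is excluded by \<open>no_normal_p\<close>. Thus A
  is a minimal normal subgroup of T, and any nontrivial subgroup defined invariantly from A is A
  itself; this is applied to the center and to the elements of exponent p.\<close>

lemma normal_in_p_part:
  assumes "subgroup A G" "A \<subseteq> T" "card A = p\<^sup>2" "subgroup Z G" "Z \<subseteq> A" "T \<subseteq> nrm Z" "Z \<noteq> {\<one>}"
  shows "Z = A"
proof -
  have "card Z dvd p\<^sup>2" using card_dvd assms by metis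
  then obtain i where i: "card Z = p ^ i" "i \<le> 2" using divides_primepow_nat[OF p] by blast
  have "i \<noteq> 0" using i(1) assms(4,7) subgroup.one_closed by (metis card_1_singletonE power_0 singletonD)
  moreover have "i \<noteq> 1" using no_normal_p[OF assms(4) _ _ ] assms(2,5,6) i(1) by (metis power_one_right subset_trans)
  ultimately have "i = 2" using i by simp
  then show ?thesis using i assms finite_sub by (metis card_subset_eq)
qed

text \<open>The fixed point congruence for A acting on itself by conjugation makes the center of A
  nontrivial. The center is normalized by T, so \<open>normal_in_p_part\<close> makes it A.\<close>

lemma p_part_abelian:
  assumes A: "subgroup A G" "A \<subseteq> T" "card A = p\<^sup>2" and "x \<in> A" "y \<in> A"
  shows "x \<otimes> y = y \<otimes> x"
proof -
  have Ac: "A \<subseteq> carrier G" using A subgroup.subset by blast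
  let ?Z = "{z \<in> A. \<forall>g\<in>A. g \<otimes> z \<otimes> inv g = z}"
  have comm: "g \<otimes> z = z \<otimes> g" if "z \<in> ?Z" "g \<in> A" for z g
  proof -
    have "g \<otimes> z \<otimes> inv g = z" using that by blast
    then have "g \<otimes> z \<otimes> inv g \<otimes> g = z \<otimes> g" by simp
    then show ?thesis using that Ac by (auto simp: m_assoc subset_iff)
  qed
  have Zi: "z \<in> ?Z" if "z \<in> A" "\<And>g. g \<in> A \<Longrightarrow> g \<otimes> z = z \<otimes> g" for z
    using that Ac by (auto simp: m_assoc subset_iff)
  have "acts A A (\<lambda>g z. g \<otimes> z \<otimes> inv g)"
    using A Ac by (auto simp: acts_def conj_mult_dist subset_iff subgroup.m_closed subgroup.m_inv_closed)
  from fixed_points_cong[OF this A(3) p] finite_sub[OF A(1)]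
  have "[p\<^sup>2 = card ?Z] (mod p)" using A(3) by simp
  from cong_dvd_iff[OF this] have "p dvd card ?Z" by simp
  then have "card ?Z \<noteq> 1" using p by auto
  have sZ: "subgroup ?Z G"
  proof (rule subgroupI)
    show "?Z \<subseteq> carrier G" using Ac by auto
    have "\<one> \<in> ?Z" using subgroup.one_closed[OF A(1)] Ac by auto
    then show "?Z \<noteq> {}" by blast
    fix z assume z: "z \<in> ?Z"
    show "inv z \<in> ?Z"
    proof (rule Zi)
      show "inv z \<in> A" using z A by (simp add: subgroup.m_inv_closed)
      fix g assume g: "g \<in> A"
      have c: "g \<in> carrier G" "z \<in> carrier G" using g z Ac by auto
      have "g \<otimes> z = z \<otimes> g" using comm z g by blast
      then show "g \<otimes> inv z = inv z \<otimes> g"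
        using c by (metis inv_closed inv_solve_left inv_solve_right m_assoc m_closed)
    qed
    fix w assume w: "w \<in> ?Z"
    show "z \<otimes> w \<in> ?Z"
    proof (rule Zi)
      show "z \<otimes> w \<in> A" using z w A by (simp add: subgroup.m_closed)
      fix g assume g: "g \<in> A"
      have c: "g \<in> carrier G" "z \<in> carrier G" "w \<in> carrier G" using g z w Ac by auto
      show "g \<otimes> (z \<otimes> w) = z \<otimes> w \<otimes> g"
        using comm[OF z g] comm[OF w g] c by (metis m_assoc)
    qed
  qed
  have "T \<subseteq> nrm ?Z"
  proof
    fix t assume t: "t \<in> T"
    then have tc: "t \<in> carrier G" using T subgroup.mem_carrier by metis
    have tA: "t \<in> nrm A" using p_part_normal[OF A] t by blast
    then have tA': "inv t \<in> nrm A" using subgroup_nrm[OF Ac] subgroup.m_inv_closed by metis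
    show "t \<in> nrm ?Z"
    proof (rule in_nrmI)
      fix z assume z: "z \<in> ?Z"
      show "t \<otimes> z \<otimes> inv t \<in> ?Z"
      proof (rule Zi)
        show "t \<otimes> z \<otimes> inv t \<in> A" using nrm_mem[OF tA] z by blast
        fix g assume g: "g \<in> A"
        have g': "inv t \<otimes> g \<otimes> t \<in> A" using nrm_mem[OF tA' g] tc by simp
        have c: "g \<in> carrier G" "z \<in> carrier G" "t \<in> carrier G" using g z Ac tc by auto
        have "t \<otimes> ((inv t \<otimes> g \<otimes> t) \<otimes> z) \<otimes> inv t = t \<otimes> (z \<otimes> (inv t \<otimes> g \<otimes> t)) \<otimes> inv t"
          using comm[OF z g'] by simp
        moreover have "t \<otimes> ((inv t \<otimes> g \<otimes> t) \<otimes> z) \<otimes> inv t = g \<otimes> (t \<otimes> z \<otimes> inv t)"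
          using c by (simp add: m_assoc) (simp add: m_assoc[symmetric])
        moreover have "t \<otimes> (z \<otimes> (inv t \<otimes> g \<otimes> t)) \<otimes> inv t = t \<otimes> z \<otimes> inv t \<otimes> g"
          using c by (simp add: m_assoc)
        ultimately show "g \<otimes> (t \<otimes> z \<otimes> inv t) = t \<otimes> z \<otimes> inv t \<otimes> g" by simp
      qed
    qed (use Ac tc in auto)
  qed
  then have "?Z = A"
    using normal_in_p_part[OF A sZ] \<open>card ?Z \<noteq> 1\<close> by fastforce
  then show ?thesis using comm[of y x] assms(4,5) by blast
qed

text \<open>Same scheme as for the center: as A is abelian, the elements killed by p form a
  subgroup; it is normalized by T and nontrivial by Cauchy.\<close>

lemma p_part_exponent:
  assumes A: "subgroup A G" "A \<subseteq> T" "card A = p\<^sup>2" and "x \<in> A"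
  shows "x [^] p = \<one>"
proof -
  have Ac: "A \<subseteq> carrier G" using A subgroup.subset by blast
  let ?Z = "{z \<in> A. z [^] p = \<one>}"
  have sZ: "subgroup ?Z G"
  proof (rule subgroupI)
    show "?Z \<subseteq> carrier G" using Ac by auto
    have "\<one> \<in> ?Z" using subgroup.one_closed[OF A(1)] by auto
    then show "?Z \<noteq> {}" by blast
    fix z assume z: "z \<in> ?Z"
    then show "inv z \<in> ?Z" using A Ac by (auto simp: subgroup.m_inv_closed nat_pow_inv subset_iff)
    fix w assume w: "w \<in> ?Z"
    have "z \<otimes> w = w \<otimes> z" using p_part_abelian[OF A] z w by blast
    then show "z \<otimes> w \<in> ?Z"
      using A Ac z w pow_mult_distrib[of z w p] by (auto simp: subgroup.m_closed subset_iff)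
  qed
  have "T \<subseteq> nrm ?Z"
  proof
    fix t assume t: "t \<in> T"
    then have tc: "t \<in> carrier G" using T subgroup.mem_carrier by metis
    have tA: "t \<in> nrm A" using p_part_normal[OF A] t by blast
    show "t \<in> nrm ?Z"
      by (rule in_nrmI) (use nrm_mem[OF tA] conj_pow[OF tc] Ac tc in auto)
  qed
  moreover have "?Z \<noteq> {\<one>}"
  proof -
    obtain K where K: "subgroup K G" "K \<subseteq> A" "card K = p"
      using cauchy_sub[OF A(1) p] A(3) by auto
    obtain k where k: "k \<in> K" "k \<noteq> \<one>" using nontrivial_elem[OF K(1)] K(3) p prime_gt_1_nat by blast
    then have "k \<in> ?Z" using K pow_card_eq_one[OF K(1)] by auto
    then show ?thesis using k by blast
  qed
  ultimately have "?Z = A" using normal_in_p_part[OF A sZ] by blast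
  then show ?thesis using assms(4) by blast
qed

text \<open>A subgroup of order q acts without fixed points on the p + 1 subgroups of order p.\<close>

lemma q_dvd_p_plus_1: "q dvd p + 1"
proof -
  obtain Q where Q: "subgroup Q G" "Q \<subseteq> T" "card Q = q" using cauchy_sub[OF T q] card_T by auto
  obtain A where A: "subgroup A G" "A \<subseteq> T" "card A = p\<^sup>2" using sylow_exists[OF T p, of 2] card_T by auto
  have Ac: "A \<subseteq> carrier G" using A subgroup.subset by blast
  let ?S = "{K. subgroup K G \<and> K \<subseteq> A \<and> card K = p}"
  have fS: "finite ?S" using finite_sub[OF A(1)] by (rule_tac finite_subset[of _ "Pow A"]) auto
  \<comment> \<open>A has exponent p, so its p^2 - 1 nontrivial elements split into the p - 1
    nontrivial elements of each subgroup of order p; hence there are p + 1 such subgroups.\<close>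
  have "card (\<Union>K\<in>?S. K - {\<one>}) = (\<Sum>K\<in>?S. card (K - {\<one>}))"
  proof (rule card_UN_disjoint[OF fS])
    show "\<forall>K\<in>?S. finite (K - {\<one>})" using finite_sub by blast
    show "\<forall>K\<in>?S. \<forall>L\<in>?S. K \<noteq> L \<longrightarrow> (K - {\<one>}) \<inter> (L - {\<one>}) = {}"
      using prime_inter[OF _ _ _ _ p] by blast
  qed
  also have "\<dots> = (\<Sum>K\<in>?S. p - 1)"
    by (rule sum.cong) (auto simp: card_Diff_singleton subgroup.one_closed)
  also have "(\<Union>K\<in>?S. K - {\<one>}) = A - {\<one>}"
  proof (intro equalityI subsetI)
    fix x assume x: "x \<in> A - {\<one>}"
    then have xc: "x \<in> carrier G" using Ac by auto
    have "generate G {x} \<in> ?S"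
      using gen_subgroup[OF xc] gen_subset[OF A(1)] card_gen_prime[OF xc _ _ p] p_part_exponent[OF A] x by auto
    then show "x \<in> (\<Union>K\<in>?S. K - {\<one>})" using gen_self[of x] x by blast
  qed blast
  also have "card (A - {\<one>}) = p\<^sup>2 - 1"
    using A subgroup.one_closed[OF A(1)] by (simp add: card_Diff_singleton)
  also have "\<dots> = (p + 1) * (p - 1)" by (simp add: power2_eq_square algebra_simps)
  finally have "card ?S * (p - 1) = (p + 1) * (p - 1)" by simp
  moreover have "p - 1 \<noteq> 0" using prime_gt_1_nat[OF p] by simp
  ultimately have "card ?S = p + 1" by (metis mult_cancel2)
  moreover have "[card ?S = card {K \<in> ?S. \<forall>g\<in>Q. cj g K = K}] (mod q)"
  proof (rule fixed_points_cong[OF _ _ q fS])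
    show "card Q = q ^ 1" using Q by simp
    show "acts Q ?S cj"
    proof (rule acts_cj[OF Q(1)])
      fix g K assume g: "g \<in> Q" and K: "K \<in> ?S"
      have "g \<in> nrm A" using p_part_normal[OF A] Q g by blast
      then show "cj g K \<in> ?S"
        using cj_in_T[of K g] K g Q A nrm_mem[of g A] by (auto simp: cj_def)
    qed (use Ac in auto)
  qed
  moreover have "card {K \<in> ?S. \<forall>g\<in>Q. cj g K = K} = 0"
  proof -
    have False if K: "K \<in> ?S" "\<forall>g\<in>Q. cj g K = K" for K
    proof -
      have "Q \<subseteq> T \<inter> nrm K" using K Q subgroup.subset[OF Q(1)] by (auto simp: nrm_def)
      moreover have KT: "subgroup K G" "K \<subseteq> T" "card K = p" using K A by auto
      ultimately have "q dvd card (T \<inter> nrm K)"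
        using card_dvd[OF Q(1) nrm_dvd(1)[OF T]] Q(3) subgroup.subset[OF KT(1)] by metis
      then show False using no_q_normalizes_p[OF KT] by blast
    qed
    then have "{K \<in> ?S. \<forall>g\<in>Q. cj g K = K} = {}" by blast
    then show ?thesis by (simp only: card.empty)
  qed
  ultimately show ?thesis by (simp only: cong_0_iff)
qed

text \<open>If x is an involution in Q, then v (x v x^-1) is fixed by x because A is abelian. A
  nontrivial fixed element would span a subgroup of order p normalized by Q, so the product is 1 and
  x inverts v. Then x normalizes <v>, which is the same contradiction.\<close>

lemma q_odd: "q \<noteq> 2"
proof
  assume q2: "q = 2"
  obtain Q where Q: "subgroup Q G" "Q \<subseteq> T" "card Q = q" using cauchy_sub[OF T q] card_T by auto
  obtain A where A: "subgroup A G" "A \<subseteq> T" "card A = p\<^sup>2" using sylow_exists[OF T p, of 2] card_T by auto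
  have Ac: "A \<subseteq> carrier G" using A subgroup.subset by blast
  obtain x where x: "x \<in> Q" "x \<noteq> \<one>" using nontrivial_elem[OF Q(1)] Q(3) q prime_gt_1_nat by blast
  obtain v where v: "v \<in> A" "v \<noteq> \<one>" using nontrivial_elem[OF A(1)] A(3) prime_gt_1_nat[OF p] by (metis one_less_power zero_less_numeral)
  have xc: "x \<in> carrier G" and vc: "v \<in> carrier G" using x v Ac subgroup.mem_carrier[OF Q(1)] by auto
  have "x [^] (2::nat) = \<one>" using pow_card_eq_one[OF Q(1) x(1)] Q q2 by simp
  then have xx: "x \<otimes> x = \<one>" using xc by (simp add: numeral_2_eq_2)
  then have ix: "inv x = x" using xc by (simp add: inv_equality)
  have xA: "x \<in> nrm A" using p_part_normal[OF A] Q x by blast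
  have no: False if w: "w \<in> A" "w \<noteq> \<one>" "x \<otimes> w \<otimes> inv x \<in> generate G {w}" for w
  proof -
    have wc: "w \<in> carrier G" using w Ac by auto
    have K: "subgroup (generate G {w}) G" "generate G {w} \<subseteq> T" "card (generate G {w}) = p"
      using gen_subgroup[OF wc] gen_subset[OF A(1) w(1)] A(2) card_gen_prime[OF wc w(2) p_part_exponent[OF A w(1)] p] by auto
    have "x \<in> T \<inter> nrm (generate G {w})" using gen_normI[OF xc wc w(3)] x Q by blast
    then have "generate G {x} \<subseteq> T \<inter> nrm (generate G {w})"
      using gen_subset[OF nrm_dvd(1)[OF T]] subgroup.subset[OF K(1)] by blast
    then have "card Q dvd card (T \<inter> nrm (generate G {w}))"
      using prime_gen[OF Q(1,3) q x] card_dvd[OF Q(1) nrm_dvd(1)[OF T]] subgroup.subset[OF K(1)] by metis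
    then show False using no_q_normalizes_p[OF K] Q(3) by simp
  qed
  let ?w = "v \<otimes> (x \<otimes> v \<otimes> inv x)"
  have u: "x \<otimes> v \<otimes> inv x \<in> A" using nrm_mem[OF xA v(1)] .
  have wA: "?w \<in> A" using u v A by (simp add: subgroup.m_closed)
  have "x \<otimes> ?w \<otimes> inv x = (x \<otimes> v \<otimes> inv x) \<otimes> v"
    using xc vc by (simp add: ix m_assoc xx)
  then have "x \<otimes> ?w \<otimes> inv x = ?w" using p_part_abelian[OF A u v(1)] by simp
  then have "?w = \<one>" using no[OF wA] gen_self[of ?w] by force
  then have "inv (x \<otimes> v \<otimes> inv x) = v" using xc vc by (intro inv_equality) auto
  then have "x \<otimes> v \<otimes> inv x = inv v" using xc vc by (metis inv_closed inv_inv m_closed)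
  then have "x \<otimes> v \<otimes> inv x \<in> generate G {v}"
    using subgroup.m_inv_closed[OF gen_subgroup[OF vc] gen_self] by simp
  then show False using no[OF v] by blast
qed

lemma q_not_dvd_p_minus_1: "\<not> q dvd p - 1"
proof
  assume "q dvd p - 1"
  then have "q dvd (p + 1) - (p - 1)" using q_dvd_p_plus_1 dvd_diff_nat by blast
  then have "q dvd 2" using prime_gt_1_nat[OF p] by (simp add: numeral_2_eq_2)
  then show False using q_odd q by (simp add: primes_dvd_imp_eq two_is_prime_nat)
qed

text \<open>The number of conjugates of Q in S divides p and is 1 modulo q; the value p would give q
  dvd p - 1. S is any subgroup of G of order p q, and T enters through
  \<open>q_not_dvd_p_minus_1\<close>.\<close>

lemma order_pq_normal:
  assumes "subgroup S G" "card S = p * q" "subgroup Q G" "Q \<subseteq> S" "card Q = q"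
  shows "S \<subseteq> nrm Q"
proof -
  have Qc: "Q \<subseteq> carrier G" using assms subgroup.subset by blast
  let ?c = "card ((\<lambda>g. cj g Q) ` S)"
  have "\<not> q ^ Suc 1 dvd card S"
    using assms(2) q p pq by (auto simp: prime_gt_0_nat dest: primes_dvd_imp_eq)
  then have c1: "[?c = 1] (mod q)" using sylow_count[OF assms(1,3,4) _ q, of 1] assms(5) by simp
  have eq: "?c * card (S \<inter> nrm Q) = p * q" using card_conjugates[OF assms(1) Qc] assms(2) by simp
  have "Q \<subseteq> S \<inter> nrm Q" using assms self_subset_nrm by blast
  then have "q dvd card (S \<inter> nrm Q)" using card_dvd[OF assms(3) nrm_dvd(1)[OF assms(1) Qc]] assms(5) by simp
  then obtain m where m: "card (S \<inter> nrm Q) = q * m" by blast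
  then have "?c * m = p" using eq prime_gt_0_nat[OF q] by (simp add: algebra_simps)
  then have "?c = 1 \<or> ?c = p" using p by (metis dvd_triv_left prime_nat_iff)
  moreover have "?c \<noteq> p"
  proof
    assume "?c = p"
    then have "q dvd p - 1" using c1 prime_gt_1_nat[OF p]
      by (metis cong_altdef_nat cong_sym less_imp_le_nat)
    then show False using q_not_dvd_p_minus_1 by blast
  qed
  ultimately have "card (S \<inter> nrm Q) = card S" using eq assms(2) by simp
  then have "S \<inter> nrm Q = S" using finite_sub[OF assms(1)] by (metis card_subset_eq inf_le1)
  then show ?thesis by blast
qed

end

section \<open>The order in the icosahedral case\<close>

lemma cong_1_dvd: "[a = 1] (mod m) \<Longrightarrow> a \<ge> 1 \<Longrightarrow> m dvd a - 1" for a m :: nat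
  using cong_altdef_nat[of 1 a m] by blast

lemma successive_primes:
  fixes p :: nat
  assumes "nprime p" "nprime (p + 1)" shows "p = 2"
proof (rule ccontr)
  assume "p \<noteq> 2"
  then have "odd p" "p > 2" using assms(1) prime_gt_1_nat[of p] prime_odd_nat[of p] by auto
  then show False using assms(2) prime_odd_nat[of "p + 1"] by simp
qed

text \<open>Write p q = r k + 1 and r = p m + 1. Modulo p this gives p dvd k + 1, so r k is at least
  (p + 1)(p - 1), too large for q < p. With q dvd p + 1 only q = p + 1 remains, hence p = 2.\<close>

lemma numerics60:
  fixes p q r :: nat
  assumes "nprime p" "nprime q" "nprime r" "p \<noteq> q" "p \<noteq> r"
    and rp: "[r = 1] (mod p)" and pqr: "[p * q = 1] (mod r)" and qp: "q dvd p + 1"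
  shows "p = 2 \<and> q = 3 \<and> r = 5"
proof -
  have gt: "p > 1" "q > 1" "r > 1" using assms by (blast intro: prime_gt_1_nat)+
  then have ge: "1 \<le> p * q" "1 \<le> r" by auto
  then have d: "r dvd p * q - 1" "p dvd r - 1" using cong_1_dvd[OF rp] cong_1_dvd[OF pqr] by blast+
  obtain k where k: "p * q - 1 = r * k" using d by blast
  obtain m where m: "r - 1 = p * m" using d by blast
  have k': "p * q = r * k + 1" using k ge by linarith
  have m': "r = p * m + 1" using m ge by linarith
  have m0: "m \<ge> 1" using m' gt by (cases m) auto
  have "p * q = p * (m * k) + (k + 1)" using k' m' by (simp add: algebra_simps)
  then have "p dvd k + 1" by (metis dvd_add_right_iff dvd_triv_left)
  then have kp: "p \<le> k + 1" by (simp add: dvd_imp_le)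
  have rp: "r \<ge> p + 1" using m' m0 by simp
  have "q \<le> p + 1" using qp by (simp add: dvd_imp_le)
  moreover have "\<not> q \<le> p - 1"
  proof
    assume "q \<le> p - 1"
    then have "p * q \<le> p * (p - 1)" by simp
    moreover have "(p + 1) * (p - 1) \<le> r * k" using rp kp by (intro mult_mono) auto
    ultimately show False using k' gt by (cases p) (auto simp: algebra_simps)
  qed
  ultimately have q: "q = p + 1" using assms(4) gt by linarith
  have "p = 2" using successive_primes[OF assms(1)] assms(2) q by simp
  then have "r * k = 5" using k q by simp
  then have "r dvd 5" by (metis dvd_triv_left)
  then have "r = 5" using assms(3) primes_dvd_imp_eq[of r 5] by simp
  then show ?thesis using \<open>p = 2\<close> q by simp
qed

lemma primes_consecutive:
  fixes p q :: nat
  assumes "nprime p" "nprime q" "q dvd p + 1" "[q = 1] (mod p)"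
  shows "p = 2 \<and> q = 3"
proof -
  have gt: "p > 1" "q > 1" using assms by (blast intro: prime_gt_1_nat)+
  then have "p dvd q - 1" using assms(4) cong_1_dvd[of q p] by simp
  then have "p \<le> q - 1" using gt by (simp add: dvd_imp_le)
  moreover have "q \<le> p + 1" using assms(3) by (simp add: dvd_imp_le)
  ultimately have q: "q = p + 1" using gt by simp
  have "p = 2" using successive_primes[OF assms(1)] assms(2) q by simp
  then show ?thesis using q by simp
qed

context fin_group
begin

lemma card_conj_class:
  assumes "subgroup H G" shows "card ((\<lambda>g. cj g H) ` carrier G) * card (nrm H) = order G"
  using card_conjugates[OF subgroup_self subgroup.subset[OF assms]] nrm_carrier
  by (simp add: order_def Int_absorb1)

lemma nrm_sub: "subgroup H G \<Longrightarrow> subgroup (nrm H) G"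
  by (simp add: subgroup_nrm subgroup.subset)

lemma sub_nrm_dvd: "subgroup H G \<Longrightarrow> subgroup K G \<Longrightarrow> K \<subseteq> nrm H \<Longrightarrow> card K dvd card (nrm H)"
  by (simp add: card_dvd nrm_sub)

lemma nrm_prod:
  assumes "subgroup H G" "nprime s" "s ^ n dvd card (nrm H)" "coprime (card H) s"
  obtains L where "subgroup L G" "card L = card H * s ^ n"
  using coprime_normalized_prod[OF subgroup_self assms(1) subgroup.subset[OF assms(1)] assms(2) _ assms(4)] assms(3)
  by (metis Int_absorb1 nrm_carrier)

end

text \<open>In PSL(2,5), T is an alternating group of degree 4 and D is dihedral of order 10, while
  the orders 15 and 20 do not occur.\<close>

locale case60 = fin_group +
  fixes p q r
  assumes p: "nprime p" and q: "nprime q" and r: "nprime r" and ne: "p \<noteq> q" "p \<noteq> r" "q \<noteq> r"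
    and ord: "order G = p\<^sup>2 * q * r"
    and no_qr: "\<And>H. subgroup H G \<Longrightarrow> card H \<noteq> q * r"
    and no_ppr: "\<And>H. subgroup H G \<Longrightarrow> card H \<noteq> p\<^sup>2 * r"
    and no_sub: "\<And>T K. subgroup T G \<Longrightarrow> subgroup K G \<Longrightarrow> card T = p\<^sup>2 * q \<Longrightarrow> K \<subseteq> T \<Longrightarrow> card K \<noteq> p * q"
    and ex_T: "\<exists>T. subgroup T G \<and> card T = p\<^sup>2 * q"
    and ex_D: "\<exists>D. subgroup D G \<and> card D = p * r"
begin

lemma p2q: "subgroup T G \<Longrightarrow> card T = p\<^sup>2 * q \<Longrightarrow> p2q_subgroup G T p q"
  using p q ne no_sub by (intro p2q_subgroup.intro fin_group_axioms p2q_subgroup_axioms.intro) auto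

lemma cops: "coprime p q" "coprime p r" "coprime q r" "coprime q p" "coprime r p" "coprime r q"
  using p q r ne by (auto simp: primes_coprime)

text \<open>A Sylow p-subgroup A of T has exactly r conjugates: its normalizer contains T, and r
  cannot divide the order of the normalizer, because A times a subgroup of order r would have the
  excluded order p^2 r.\<close>

lemma r_cong: "[r = 1] (mod p)"
proof -
  obtain T where T: "subgroup T G" "card T = p\<^sup>2 * q" using ex_T by blast
  interpret T: p2q_subgroup G T p q using p2q T by blast
  obtain A where A: "subgroup A G" "A \<subseteq> T" "card A = p\<^sup>2" using sylow_exists[OF T(1) p, of 2] T by auto
  let ?N = "card (nrm A)"
  have "p\<^sup>2 * q dvd ?N" using sub_nrm_dvd[OF A(1) T(1) T.p_part_normal[OF A]] T by simp
  then obtain k where k: "?N = p\<^sup>2 * q * k" by blast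
  have "?N dvd p\<^sup>2 * q * r" using card_dvd_order[OF nrm_sub[OF A(1)]] ord by simp
  then have "k dvd r" using k p q by (simp add: prime_gt_0_nat)
  moreover have "\<not> r dvd ?N"
  proof
    assume "r dvd ?N"
    then obtain L where "subgroup L G" "card L = p\<^sup>2 * r"
      using nrm_prod[OF A(1) r, of 1] A(3) cops by auto
    then show False using no_ppr by blast
  qed
  ultimately have "k = 1" using k r by (metis dvd_triv_right prime_nat_iff)
  then have "card ((\<lambda>g. cj g A) ` carrier G) = r"
    using card_conj_class[OF A(1)] k ord p q by (simp add: prime_gt_0_nat)
  moreover have "\<not> p ^ Suc 2 dvd card (carrier G)"
    using ord p q r ne by (simp add: order_def power_Suc numeral_2_eq_2 prime_gt_0_nat prime_dvd_mult_iff primes_dvd_imp_eq)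
      (metis primes_dvd_imp_eq)
  ultimately show ?thesis
    using sylow_count[OF subgroup_self A(1) _ A(3) p] subgroup.subset[OF A(1)] by simp
qed

text \<open>In D the number of conjugates of R divides p and is 1 modulo r; as r > p it is 1. So p r
  divides the order of the normalizer, and a further factor q or p would create a subgroup of order
  q r or p^2 r.\<close>

lemma R_norm:
  shows "\<exists>R. subgroup R G \<and> card R = r \<and> card (nrm R) = p * r \<and> card ((\<lambda>g. cj g R) ` carrier G) = p * q"
    and pq_cong: "[p * q = 1] (mod r)"
proof -
  obtain D where D: "subgroup D G" "card D = p * r" using ex_D by blast
  obtain R where R: "subgroup R G" "R \<subseteq> D" "card R = r" using cauchy_sub[OF D(1) r] D by auto
  have Rc: "R \<subseteq> carrier G" using R subgroup.subset by blast
  have gt: "p > 1" "q > 1" "r > 1" using p q r by (blast intro: prime_gt_1_nat)+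
  have "p dvd r - 1" using cong_1_dvd[OF r_cong] gt by simp
  then have rp: "r > p" using dvd_imp_le[of p "r - 1"] gt by simp
  let ?c = "card ((\<lambda>g. cj g R) ` D)"
  have nr: "\<not> r ^ Suc 1 dvd card D" using D r p ne gt by (auto dest: primes_dvd_imp_eq)
  have c1: "[?c = 1] (mod r)" using sylow_count[OF D(1) R(1,2) _ r, of 1] nr R by simp
  have eq: "?c * card (D \<inter> nrm R) = p * r" using card_conjugates[OF D(1) Rc] D by simp
  have "R \<subseteq> D \<inter> nrm R" using R self_subset_nrm by blast
  then have "r dvd card (D \<inter> nrm R)" using card_dvd[OF R(1) nrm_dvd(1)[OF D(1) Rc]] R by simp
  then obtain m where m: "card (D \<inter> nrm R) = r * m" by blast
  then have "?c * m = p" using eq gt by (simp add: algebra_simps)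
  then have "?c = 1 \<or> ?c = p" using p by (metis dvd_triv_left prime_nat_iff)
  moreover have "?c \<noteq> p"
  proof
    assume "?c = p"
    then have "r dvd p - 1" using cong_1_dvd[OF c1] gt by simp
    then show False using rp gt dvd_imp_le[of r "p - 1"] by simp
  qed
  ultimately have cD: "card (D \<inter> nrm R) = p * r" using eq by simp
  let ?N = "card (nrm R)"
  have "p * r dvd ?N" using card_dvd[OF nrm_dvd(1)[OF D(1) Rc] nrm_sub[OF R(1)]] cD by simp
  then obtain k where k: "?N = p * r * k" by blast
  have "?N dvd (p * r) * (p * q)" using card_dvd_order[OF nrm_sub[OF R(1)]] ord by (simp add: power2_eq_square ac_simps)
  then have kd: "k dvd p * q" using k gt by simp
  have nq: "\<not> q dvd ?N"
  proof
    assume "q dvd ?N"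
    then obtain L where "subgroup L G" "card L = r * q" using nrm_prod[OF R(1) q, of 1] R(3) cops by auto
    then show False using no_qr[of L] by (simp add: mult.commute)
  qed
  have np: "\<not> p\<^sup>2 dvd ?N"
  proof
    assume "p\<^sup>2 dvd ?N"
    then obtain L where "subgroup L G" "card L = r * p\<^sup>2" using nrm_prod[OF R(1) p, of 2] R(3) cops by auto
    then show False using no_ppr[of L] by (simp add: mult.commute)
  qed
  have "k = 1"
  proof (rule ccontr)
    assume "k \<noteq> 1"
    then obtain x where x: "nprime x" "x dvd k" using prime_factor_nat by blast
    then have "x dvd p * q" using kd dvd_trans by blast
    then have "x = p \<or> x = q" using x p q by (auto simp: prime_dvd_mult_iff dest: primes_dvd_imp_eq)
    then show False
    proof
      assume "x = p"
      then have "p * p dvd p * r * k" using x by (metis dvd_triv_left mult.assoc mult.commute mult_dvd_mono)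
      then show False using np k by (simp add: power2_eq_square)
    next
      assume "x = q" then show False using nq k x by simp
    qed
  qed
  then have N: "?N = p * r" using k by simp
  then have C: "card ((\<lambda>g. cj g R) ` carrier G) = p * q"
    using card_conj_class[OF R(1)] ord gt by (simp add: power2_eq_square ac_simps)
  show "\<exists>R. subgroup R G \<and> card R = r \<and> card (nrm R) = p * r \<and> card ((\<lambda>g. cj g R) ` carrier G) = p * q"
    using R N C by blast
  have "\<not> r ^ Suc 1 dvd card (carrier G)"
  proof
    assume "r ^ Suc 1 dvd card (carrier G)"
    then have "r * r dvd (p\<^sup>2 * q) * r" using ord by (simp add: order_def)
    then have "r dvd p\<^sup>2 * q" using gt by simp
    then show False using p q r ne by (auto simp: prime_dvd_mult_iff prime_dvd_power_iff dest: primes_dvd_imp_eq)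
  qed
  then show "[p * q = 1] (mod r)" using sylow_count[OF subgroup_self R(1) Rc _ r, of 1] R(3) C by simp
qed

lemma numbers: "p = 2 \<and> q = 3 \<and> r = 5"
proof -
  obtain T where T: "subgroup T G" "card T = p\<^sup>2 * q" using ex_T by blast
  interpret T: p2q_subgroup G T p q using p2q T by blast
  show ?thesis using numerics60[OF p q r ne(1,2) r_cong pq_cong T.q_dvd_p_plus_1] .
qed

end

section \<open>The order in the case of 168\<close>

context fin_group
begin

lemma sylow_conj_eq:
  assumes "subgroup P G" "card P = p ^ n" "subgroup Q G" "card Q = p ^ n" "nprime p" "\<not> p ^ Suc n dvd order G"
  obtains g where "g \<in> carrier G" "Q = cj g P"
proof -
  have Pc: "P \<subseteq> carrier G" and Qc: "Q \<subseteq> carrier G" using assms(1,3) by (simp_all add: subgroup.subset)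
  obtain g where g: "g \<in> carrier G" "Q \<subseteq> cj g P"
    using sylow_conj[OF subgroup_self assms(1) Pc assms(2,5) _ assms(3) Qc assms(4)] assms(6)
    by (auto simp: order_def)
  then have "Q = cj g P"
    using card_cj[OF Pc g(1)] assms finite_sub[OF subgroup_cj[OF assms(1) g(1)]] by (metis card_subset_eq)
  then show thesis using that g(1) by blast
qed

text \<open>Conjugate subgroups have the same conjugacy class, hence normalizers of the same index.
  This carries a normalizer order found for one convenient Sylow subgroup over to all of
  them.\<close>

lemma sylow_nrm_card:
  assumes "subgroup P G" "card P = p ^ n" "subgroup Q G" "card Q = p ^ n" "nprime p" "\<not> p ^ Suc n dvd order G"
  shows "card (nrm P) = card (nrm Q)"
proof -
  have Pc: "P \<subseteq> carrier G" using assms(1) by (simp add: subgroup.subset)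
  obtain g where g: "g \<in> carrier G" "Q = cj g P" using sylow_conj_eq[OF assms] .
  let ?E = "(\<lambda>g. cj g P) ` carrier G"
  have "P \<in> ?E" using cj_one[OF Pc] by (metis imageI one_closed)
  from orbit_eq[OF acts_conjugates[OF subgroup_self Pc] this g(1)]
  have "(\<lambda>g. cj g Q) ` carrier G = ?E" unfolding g(2) .
  then have "card ?E * card (nrm Q) = card ?E * card (nrm P)"
    using card_conj_class[OF assms(1)] card_conj_class[OF assms(3)] by simp
  moreover have "card ?E \<noteq> 0" using \<open>P \<in> ?E\<close> fin by auto
  ultimately show ?thesis by simp
qed

end

text \<open>In PSL(2,7), S, T and U are copies of S3, A4 and S4, and W is the normalizer of a Sylow
  7-subgroup. There \<open>full\<close> means that proper subgroups of order divisible by 7 have odd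
  order.\<close>

locale case168 = fin_group +
  fixes p q r
  assumes p: "nprime p" and q: "nprime q" and r: "nprime r" and ne: "p \<noteq> q" "p \<noteq> r" "q \<noteq> r"
    and ord: "order G = p ^ 3 * q * r"
    and full: "\<And>H. subgroup H G \<Longrightarrow> p dvd card H \<Longrightarrow> r dvd card H \<Longrightarrow> H = carrier G"
    and no_sub: "\<And>T K. subgroup T G \<Longrightarrow> subgroup K G \<Longrightarrow> card T = p\<^sup>2 * q \<Longrightarrow> K \<subseteq> T \<Longrightarrow> card K \<noteq> p * q"
    and ex_T: "\<exists>T. subgroup T G \<and> card T = p\<^sup>2 * q"
    and ex_SU: "\<exists>S U. subgroup S G \<and> subgroup U G \<and> S \<subseteq> U \<and> card S = p * q \<and> card U = p ^ 3 * q"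
    and ex_W: "\<exists>W. subgroup W G \<and> card W = q * r"
begin

lemma p2q: "subgroup T G \<Longrightarrow> card T = p\<^sup>2 * q \<Longrightarrow> p2q_subgroup G T p q"
  using p q ne no_sub by (intro p2q_subgroup.intro fin_group_axioms p2q_subgroup_axioms.intro) auto

lemma cops: "coprime p q" "coprime p r" "coprime q r" "coprime q p" "coprime r p" "coprime r q"
  using p q r ne by (auto simp: primes_coprime)

lemma gt: "p > 1" "q > 1" "r > 1" using p q r by (blast intro: prime_gt_1_nat)+

lemma prime_dvd_eq: "p dvd q \<longleftrightarrow> False" "p dvd r \<longleftrightarrow> False" "q dvd p \<longleftrightarrow> False"
    "q dvd r \<longleftrightarrow> False" "r dvd p \<longleftrightarrow> False" "r dvd q \<longleftrightarrow> False"
  using p q r ne by (auto dest: primes_dvd_imp_eq)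

lemma sylow_q: "\<not> q ^ Suc 1 dvd order G"
proof
  assume "q ^ Suc 1 dvd order G"
  then have "q * q dvd (p ^ 3 * r) * q" using ord by (simp add: ac_simps)
  then have "q dvd p ^ 3 * r" using gt by simp
  then show False using q p r prime_dvd_eq by (simp add: prime_dvd_mult_iff prime_dvd_power_iff)
qed

lemma sylow_r: "\<not> r ^ Suc 1 dvd order G"
proof
  assume "r ^ Suc 1 dvd order G"
  then have "r * r dvd (p ^ 3 * q) * r" using ord by (simp add: ac_simps)
  then have "r dvd p ^ 3 * q" using gt by simp
  then show False using q p r prime_dvd_eq by (simp add: prime_dvd_mult_iff prime_dvd_power_iff)
qed

lemma not_full:
  assumes "subgroup H G" "p dvd card H" "r dvd card H" "card H \<noteq> p ^ 3 * q * r" shows False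
  using full[OF assms(1-3)] ord assms(4) by (simp add: order_def)

text \<open>S normalizes its subgroup of order q by \<open>order_pq_normal\<close>. If p^2 divided
  the order of the normalizer, a subgroup of order p^2 q would normalize Q, contrary to
  \<open>q_selfnorm\<close>; if r did, \<open>full\<close> would make the normalizer everything, and
  p^2 would divide its order after all.\<close>

lemma Q_norm:
  assumes "subgroup Q G" "card Q = q" shows "card (nrm Q) = p * q"
proof -
  obtain S where S: "subgroup S G" "card S = p * q" using ex_SU by blast
  obtain T where T: "subgroup T G" "card T = p\<^sup>2 * q" using ex_T by blast
  interpret T: p2q_subgroup G T p q using p2q T by blast
  obtain Q0 where Q0: "subgroup Q0 G" "Q0 \<subseteq> S" "card Q0 = q" using cauchy_sub[OF S(1) q] S by auto
  let ?N = "card (nrm Q0)"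
  have "p * q dvd ?N" using sub_nrm_dvd[OF Q0(1) S(1) T.order_pq_normal[OF S Q0]] S by simp
  then obtain k where k: "?N = p * q * k" by blast
  have "?N dvd (p * q) * (p\<^sup>2 * r)"
    using card_dvd_order[OF nrm_sub[OF Q0(1)]] ord by (simp add: power2_eq_square power3_eq_cube ac_simps)
  then have kd: "k dvd p\<^sup>2 * r" using k gt by simp
  have np: "\<not> p\<^sup>2 dvd ?N"
  proof
    assume "p\<^sup>2 dvd ?N"
    then obtain A where A: "subgroup A G" "A \<subseteq> nrm Q0" "card A = p\<^sup>2"
      using sylow_exists[OF nrm_sub[OF Q0(1)] p] by blast
    let ?L = "Q0 <#> A"
    have L: "subgroup ?L G" "card ?L = p\<^sup>2 * q"
      using coprime_prod[OF subgroup_self Q0(1) A(1) subgroup.subset[OF Q0(1)] subgroup.subset[OF A(1)] A(2)]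
        Q0 A cops by auto
    interpret L: p2q_subgroup G ?L p q using p2q L by blast
    have "?L \<subseteq> nrm Q0" using prod_subset[OF nrm_sub[OF Q0(1)] self_subset_nrm[OF Q0(1)] A(2)] .
    moreover have "Q0 \<subseteq> ?L" using subset_prod[OF Q0(1) A(1)] by blast
    ultimately have "?L = Q0" using L.q_selfnorm[OF Q0(1) _ Q0(3)] by blast
    then show False using L Q0(3) gt one_less_power[OF gt(1), of 2] by simp
  qed
  have "\<not> r dvd ?N"
  proof
    assume "r dvd ?N"
    then have "nrm Q0 = carrier G" using full[OF nrm_sub[OF Q0(1)]] k by simp
    then have "?N = p\<^sup>2 * (p * q * r)" using ord by (simp add: order_def power2_eq_square power3_eq_cube ac_simps)
    then show False using np by (metis dvd_triv_left)
  qed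
  have "k = 1"
  proof (rule ccontr)
    assume "k \<noteq> 1"
    then obtain x where x: "nprime x" "x dvd k" using prime_factor_nat by blast
    then have "x dvd p\<^sup>2 * r" using kd dvd_trans by blast
    then have "x = p \<or> x = r" using x p r by (auto simp: prime_dvd_mult_iff prime_dvd_power_iff dest: primes_dvd_imp_eq)
    then show False
    proof
      assume "x = p"
      then have "p * p dvd p * q * k" using x by (metis dvd_triv_left mult.assoc mult.commute mult_dvd_mono)
      then show False using np k by (simp add: power2_eq_square)
    next
      assume "x = r" then show False using \<open>\<not> r dvd ?N\<close> k x by simp
    qed
  qed
  moreover have "card (nrm Q) = ?N" using sylow_nrm_card[of Q q 1 Q0] assms Q0 q sylow_q by simp
  ultimately show ?thesis using k by simp
qed

text \<open>The order of the normalizer of Q in W divides both q r and p q, so Q has r conjugates in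
  W; hence r is 1 modulo q and r > q. This makes R normal in W. A factor p in the normalizer of R
  would give a proper subgroup of order p r.\<close>

lemma R_norm_ex: "\<exists>R. subgroup R G \<and> card R = r \<and> card (nrm R) = q * r"
proof -
  obtain W where W: "subgroup W G" "card W = q * r" using ex_W by blast
  obtain Q where Q: "subgroup Q G" "Q \<subseteq> W" "card Q = q" using cauchy_sub[OF W(1) q] W by auto
  obtain R where R: "subgroup R G" "R \<subseteq> W" "card R = r" using cauchy_sub[OF W(1) r] W by auto
  have Qc: "Q \<subseteq> carrier G" and Rc: "R \<subseteq> carrier G" using Q(1) R(1) by (simp_all add: subgroup.subset)
  have sW: "\<not> q ^ Suc 1 dvd card W" "\<not> r ^ Suc 1 dvd card W"
    using sylow_q sylow_r card_dvd_order[OF W(1)] dvd_trans by blast+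
  have d: "card (W \<inter> nrm Q) dvd q * r" "card (W \<inter> nrm Q) dvd q * p"
    using nrm_dvd[OF W(1) Qc] card_dvd[OF nrm_dvd(1)[OF W(1) Qc] nrm_sub[OF Q(1)]] Q_norm[OF Q(1,3)] W
    by (auto simp: mult.commute)
  have "q dvd card (W \<inter> nrm Q)" using card_dvd[OF Q(1) nrm_dvd(1)[OF W(1) Qc]] Q self_subset_nrm[OF Q(1)] by simp
  then obtain k where k: "card (W \<inter> nrm Q) = q * k" by blast
  have "k dvd r" "k dvd p" using d k gt by simp_all
  then have "k = 1" using cops(5) by (metis coprime_common_divisor_nat)
  then have "card ((\<lambda>g. cj g Q) ` W) = r" using card_conjugates[OF W(1) Qc] k W gt by simp
  then have "[r = 1] (mod q)" using sylow_count[OF W(1) Q(1,2) _ q, of 1] sW Q by simp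
  from cong_1_dvd[OF this] have rq: "r > q" using dvd_imp_le[of q "r - 1"] gt by simp
  let ?c = "card ((\<lambda>g. cj g R) ` W)"
  have c1: "[?c = 1] (mod r)" using sylow_count[OF W(1) R(1,2) _ r, of 1] sW R by simp
  have eq: "?c * card (W \<inter> nrm R) = q * r" using card_conjugates[OF W(1) Rc] W by simp
  have "r dvd card (W \<inter> nrm R)" using card_dvd[OF R(1) nrm_dvd(1)[OF W(1) Rc]] R self_subset_nrm[OF R(1)] by simp
  then obtain m where m: "card (W \<inter> nrm R) = r * m" by blast
  then have "?c * m = q" using eq gt by (simp add: algebra_simps)
  then have "?c = 1 \<or> ?c = q" using q by (metis dvd_triv_left prime_nat_iff)
  moreover have "?c \<noteq> q"
  proof
    assume "?c = q"
    then have "r dvd q - 1" using cong_1_dvd[OF c1] gt by simp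
    then show False using rq gt dvd_imp_le[of r "q - 1"] by simp
  qed
  ultimately have cW: "card (W \<inter> nrm R) = q * r" using eq by simp
  let ?N = "card (nrm R)"
  have "q * r dvd ?N" using card_dvd[OF nrm_dvd(1)[OF W(1) Rc] nrm_sub[OF R(1)]] cW by simp
  then obtain k where k: "?N = q * r * k" by blast
  have "?N dvd (q * r) * p ^ 3" using card_dvd_order[OF nrm_sub[OF R(1)]] ord by (simp add: ac_simps)
  then have kd: "k dvd p ^ 3" using k gt by simp
  then obtain i where i: "k = p ^ i" using divides_primepow_nat[OF p] by blast
  have "\<not> p dvd ?N"
  proof
    assume "p dvd ?N"
    then obtain L where "subgroup L G" "card L = r * p" using nrm_prod[OF R(1) p, of 1] R(3) cops by auto
    moreover have "r * p \<noteq> p ^ 3 * q * r"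
    proof
      assume "r * p = p ^ 3 * q * r"
      then have "r * p * 1 = r * p * (p\<^sup>2 * q)" by (simp add: power2_eq_square power3_eq_cube ac_simps)
      then have "p\<^sup>2 * q = 1" using gt by (metis mult_cancel1 mult_eq_0_iff not_one_less_zero)
      then show False using gt by simp
    qed
    ultimately show False using not_full[of L] by simp
  qed
  then have "i = 0" using k i by (cases i) auto
  then have "?N = q * r" using k i by simp
  then show ?thesis using R by blast
qed

lemma R_norm: assumes "subgroup R G" "card R = r" shows "card (nrm R) = q * r"
proof -
  obtain R0 where R0: "subgroup R0 G" "card R0 = r" "card (nrm R0) = q * r" using R_norm_ex by blast
  show ?thesis using sylow_nrm_card[of R r 1 R0] assms R0 r sylow_r by simp
qed

lemma card_Q_class: assumes "subgroup Q G" "card Q = q" shows "card ((\<lambda>g. cj g Q) ` carrier G) = p\<^sup>2 * r"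
proof -
  have "card ((\<lambda>g. cj g Q) ` carrier G) * (p * q) = (p\<^sup>2 * r) * (p * q)"
    using card_conj_class[OF assms(1)] Q_norm[OF assms] ord by (simp add: power2_eq_square power3_eq_cube ac_simps)
  then show ?thesis using gt by simp
qed

lemma card_R_class: assumes "subgroup R G" "card R = r" shows "card ((\<lambda>g. cj g R) ` carrier G) = p ^ 3"
proof -
  have "card ((\<lambda>g. cj g R) ` carrier G) * (q * r) = p ^ 3 * (q * r)"
    using card_conj_class[OF assms(1)] R_norm[OF assms] ord by (simp add: ac_simps)
  then show ?thesis using gt by simp
qed

text \<open>If Q were centralized by an element of order p, there would be at least p^3 r (q - 1) elements
  whose order is a multiple of q; together with the p^3 (r - 1) elements of order r they would leave
  only p^3 elements, so that a Sylow p-subgroup would be normal.\<close>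

lemma Q_not_centralized:
  assumes Q: "subgroup Q G" "card Q = q" and y: "y \<in> carrier G" "y \<noteq> \<one>" "y [^] p = \<one>"
    and comm: "\<And>k. k \<in> Q \<Longrightarrow> k \<otimes> y = y \<otimes> k"
  shows False
proof -
  obtain R where R: "subgroup R G" "card R = r" using R_norm_ex by blast
  have Qc: "Q \<subseteq> carrier G" and Rc: "R \<subseteq> carrier G" using Q(1) R(1) by (simp_all add: subgroup.subset)
  let ?Y = "generate G {y}"
  have Y: "subgroup ?Y G" "card ?Y = p" using gen_subgroup[OF y(1)] card_gen_prime[OF y p] by auto
  have Yc: "?Y \<subseteq> carrier G" using Y(1) by (simp add: subgroup.subset)
  \<comment> \<open>These sets are disjoint for different conjugates K of Q, because such K meet
    trivially. \<open>M Q\<close> contains all products k z with k nontrivial in Q and z in <y>,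
    since z and k commute and z is killed by p.\<close>
  define M where "M K = {x \<in> carrier G. x [^] p \<in> K - {\<one>}}" for K
  let ?C = "(\<lambda>g. cj g Q) ` carrier G" and ?D = "(\<lambda>g. cj g R) ` carrier G"
  have C: "subgroup K G \<and> card K = q" if K: "K \<in> ?C" for K
    using K Q Qc subgroup_cj card_cj by auto
  have D: "subgroup K G \<and> card K = r" if K: "K \<in> ?D" for K
    using K R Rc subgroup_cj card_cj by auto
  have finC: "finite ?C" "finite ?D" using fin by auto
  have finM: "finite (M K)" for K unfolding M_def using fin by simp
  have YQ: "?Y \<inter> Q = {\<one>}" using coprime_inter[OF Y(1) Q(1)] Y Q cops by simp
  have "card ((Q - {\<one>}) \<times> ?Y) \<le> card (M Q)"
  proof (rule card_inj_on_le[OF _ _ finM])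
    show "inj_on (\<lambda>(k, z). k \<otimes> z) ((Q - {\<one>}) \<times> ?Y)"
    proof (rule inj_onI)
      fix a b assume ab: "a \<in> (Q - {\<one>}) \<times> ?Y" "b \<in> (Q - {\<one>}) \<times> ?Y" "(\<lambda>(k, z). k \<otimes> z) a = (\<lambda>(k, z). k \<otimes> z) b"
      then obtain k z k' z' where eq: "a = (k, z)" "b = (k', z')" by (metis surj_pair)
      have h: "k \<in> Q" "z \<in> ?Y" "k' \<in> Q" "z' \<in> ?Y" "k \<otimes> z = k' \<otimes> z'" using ab eq by auto
      have c: "k \<in> carrier G" "z \<in> carrier G" "k' \<in> carrier G" "z' \<in> carrier G" using h Qc Yc by auto
      have e: "inv k' \<otimes> k = z' \<otimes> inv z"
        using h(5) c by (metis inv_closed inv_solve_left inv_solve_right m_assoc m_closed)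
      moreover have "inv k' \<otimes> k \<in> Q" using h Q by (simp add: subgroup.m_closed subgroup.m_inv_closed)
      moreover have "z' \<otimes> inv z \<in> ?Y" using h Y by (simp add: subgroup.m_closed subgroup.m_inv_closed)
      ultimately have "inv k' \<otimes> k = \<one>" "z' \<otimes> inv z = \<one>" using YQ by auto
      then have "k = k' \<and> z = z'" using c by (metis inv_closed inv_equality inv_inv)
      then show "a = b" using eq by simp
    qed
    show "(\<lambda>(k, z). k \<otimes> z) ` ((Q - {\<one>}) \<times> ?Y) \<subseteq> M Q"
    proof (rule image_subsetI)
      fix a assume "a \<in> (Q - {\<one>}) \<times> ?Y"
      then obtain k z where a: "a = (k, z)" and h: "k \<in> Q" "z \<in> ?Y" "k \<noteq> \<one>" by blast
      have c: "k \<in> carrier G" "z \<in> carrier G" using h Qc Yc by auto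
      obtain n :: nat where n: "z = y [^] n" using gen_elems[OF y(1) h(2)] by blast
      have "k \<otimes> z = z \<otimes> k" unfolding n using group_commutes_pow[of y k n] comm[OF h(1)] y(1) c by simp
      then have "(k \<otimes> z) [^] p = k [^] p \<otimes> z [^] p" using pow_mult_distrib c by simp
      also have "z [^] p = \<one>" using pow_card_eq_one[OF Y(1) h(2)] Y(2) by simp
      finally have kz: "(k \<otimes> z) [^] p = k [^] p" using c by simp
      have "ord k = q" using ord_prime[OF c(1) h(3) _ q] pow_card_eq_one[OF Q(1) h(1)] Q by simp
      then have "k [^] p \<noteq> \<one>" using pow_eq_id[OF c(1), of p] prime_dvd_eq by simp
      moreover have "k [^] p \<in> Q" by (rule subgroup_nat_pow_closed[OF Q(1) h(1)])
      ultimately show "(\<lambda>(k, z). k \<otimes> z) a \<in> M Q" using kz c a by (simp add: M_def)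
    qed
  qed
  then have cMQ: "p * (q - 1) \<le> card (M Q)"
    using Y Q subgroup.one_closed[OF Q(1)] by (simp add: card_cartesian_product card_Diff_singleton mult.commute)
  have cM: "p * (q - 1) \<le> card (M K)" if K: "K \<in> ?C" for K
  proof -
    obtain g where g: "g \<in> carrier G" "K = cj g Q" using K by blast
    have MQ: "M Q \<subseteq> carrier G" by (auto simp: M_def)
    have "cj g (M Q) \<subseteq> M K"
    proof
      fix x assume "x \<in> cj g (M Q)"
      then obtain m where m: "m \<in> M Q" "x = g \<otimes> m \<otimes> inv g" by (auto simp: cj_def)
      then have mc: "m \<in> carrier G" "m [^] p \<in> Q" "m [^] p \<noteq> \<one>" by (auto simp: M_def)
      have "x [^] p = g \<otimes> m [^] p \<otimes> inv g" using conj_pow[OF g(1) mc(1)] m(2) by simp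
      moreover have "g \<otimes> m [^] p \<otimes> inv g \<in> K" using cj_mem mc(2) g(2) by blast
      moreover have "g \<otimes> m [^] p \<otimes> inv g \<noteq> \<one>"
      proof
        assume "g \<otimes> m [^] p \<otimes> inv g = \<one>"
        then have "g \<otimes> m [^] p = g" using g mc by (metis inv_closed inv_equality inv_inv m_closed nat_pow_closed)
        then show False using g mc by (metis l_cancel_one nat_pow_closed)
      qed
      ultimately show "x \<in> M K" using m(2) mc g by (simp add: M_def)
    qed
    then have "card (cj g (M Q)) \<le> card (M K)" using finM card_mono by blast
    then show ?thesis using card_cj[OF MQ g(1)] cMQ by simp
  qed
  have "card (\<Union>K\<in>?C. M K) = (\<Sum>K\<in>?C. card (M K))"
  proof (rule card_UN_disjoint[OF finC(1)])
    show "\<forall>K\<in>?C. finite (M K)" using finM by blast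
    show "\<forall>K\<in>?C. \<forall>L\<in>?C. K \<noteq> L \<longrightarrow> M K \<inter> M L = {}"
      using prime_inter[OF _ _ _ _ q] C unfolding M_def by blast
  qed
  also have "\<dots> \<ge> (\<Sum>K\<in>?C. p * (q - 1))" by (rule sum_mono) (rule cM)
  finally have cUM: "p\<^sup>2 * r * (p * (q - 1)) \<le> card (\<Union>K\<in>?C. M K)" using card_Q_class[OF Q] by simp
  have "card (\<Union>K\<in>?D. K - {\<one>}) = (\<Sum>K\<in>?D. card (K - {\<one>}))"
  proof (rule card_UN_disjoint[OF finC(2)])
    show "\<forall>K\<in>?D. finite (K - {\<one>})" using D finite_sub by blast
    show "\<forall>K\<in>?D. \<forall>L\<in>?D. K \<noteq> L \<longrightarrow> (K - {\<one>}) \<inter> (L - {\<one>}) = {}"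
      using prime_inter[OF _ _ _ _ r] D by blast
  qed
  also have "\<dots> = (\<Sum>K\<in>?D. r - 1)"
  proof (rule sum.cong)
    fix K assume "K \<in> ?D"
    then have "subgroup K G" "card K = r" using D by auto
    then show "card (K - {\<one>}) = r - 1" using subgroup.one_closed[of K G] by (simp add: card_Diff_singleton)
  qed simp
  finally have cUR: "card (\<Union>K\<in>?D. K - {\<one>}) = p ^ 3 * (r - 1)" using card_R_class[OF R] by simp
  let ?UM = "\<Union>K\<in>?C. M K" and ?UR = "\<Union>K\<in>?D. K - {\<one>}"
  have powin: "x [^] (n::nat) \<in> K" if "subgroup K G" "x \<in> K" for K x n
    using that by (simp add: subgroup_nat_pow_closed)
  have disj: "?UM \<inter> ?UR = {}"
  proof -
    have False if "K \<in> ?C" "L \<in> ?D" "x \<in> M K" "x \<in> L" for K L x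
    proof -
      have "K \<inter> L = {\<one>}" using C[OF that(1)] D[OF that(2)] cops by (intro coprime_inter) auto
      moreover have "x [^] p \<in> L" using powin that D by blast
      ultimately show False using that(3) by (auto simp: M_def)
    qed
    then show ?thesis by blast
  qed
  have sub: "?UM \<union> ?UR \<subseteq> carrier G" using D subgroup.subset unfolding M_def by blast
  let ?E = "carrier G - (?UM \<union> ?UR)"
  have "card (?UM \<union> ?UR) = card ?UM + card ?UR"
    using card_Un_disjoint[OF _ _ disj] sub fin finite_subset by (metis le_sup_iff)
  then have "card ?E = order G - (card ?UM + card ?UR)"
    using card_Diff_subset[OF finite_subset[OF sub fin] sub] by (simp add: order_def)
  then have "card ?E \<le> p ^ 3 * q * r - (p\<^sup>2 * r * (p * (q - 1)) + p ^ 3 * (r - 1))"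
    using cUM cUR ord by simp
  also have "p\<^sup>2 * r * (p * (q - 1)) = p ^ 3 * r * (q - 1)" by (simp add: power2_eq_square power3_eq_cube ac_simps)
  also have "p ^ 3 * q * r - (p ^ 3 * r * (q - 1) + p ^ 3 * (r - 1)) = p ^ 3"
  proof -
    obtain q' r' where "q = Suc q'" "r = Suc r'" using gt by (metis Suc_pred less_trans zero_less_one)
    then show ?thesis by (simp add: algebra_simps)
  qed
  finally have cE: "card ?E \<le> p ^ 3" .
  \<comment> \<open>A p-subgroup meets all conjugates of Q and R trivially, so it lies in the
    remainder \<open>?E\<close>. By cardinality every subgroup of order p^3 equals
    \<open>?E\<close>, so there is only one.\<close>
  have PE: "P = ?E" if P: "subgroup P G" "card P = p ^ 3" for P
  proof -
    have "x \<notin> ?UM" if "x \<in> P" for x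
    proof
      assume "x \<in> ?UM"
      then obtain K where K: "K \<in> ?C" "x \<in> M K" by blast
      have "P \<inter> K = {\<one>}" using C[OF K(1)] P cops by (intro coprime_inter) auto
      moreover have "x [^] p \<in> P" using powin P(1) that by blast
      ultimately show False using K(2) by (auto simp: M_def)
    qed
    moreover have "x \<notin> ?UR" if "x \<in> P" for x
    proof
      assume "x \<in> ?UR"
      then obtain K where K: "K \<in> ?D" "x \<in> K" "x \<noteq> \<one>" by blast
      have "P \<inter> K = {\<one>}" using D[OF K(1)] P cops by (intro coprime_inter) auto
      then show False using K that by blast
    qed
    ultimately have "P \<subseteq> ?E" using subgroup.subset[OF P(1)] by blast
    then show ?thesis using cE P(2) card_seteq[of ?E P] fin by auto
  qed
  obtain P where P: "subgroup P G" "card P = p ^ 3"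
    using sylow_exists[OF subgroup_self p, of 3] ord by (auto simp: order_def)
  have "nrm P = carrier G"
  proof -
    have "cj g P = P" if g: "g \<in> carrier G" for g
      using PE[OF subgroup_cj[OF P(1) g]] card_cj[OF subgroup.subset[OF P(1)] g] PE[OF P] P(2) by simp
    then show ?thesis by (auto simp: nrm_def)
  qed
  then have "r dvd card (nrm P)" using ord by (simp add: order_def)
  then obtain L where L: "subgroup L G" "card L = p ^ 3 * r" using nrm_prod[OF P(1) r, of 1] P(2) cops by auto
  moreover have "p ^ 3 * r \<noteq> p ^ 3 * q * r" using gt by simp
  moreover have "p dvd p ^ 3 * r" by simp
  ultimately show False using not_full[of L] by simp
qed

text \<open>A Sylow p-subgroup P of U has 1 or q conjugates in U. With q of them, q is 1 modulo p,
  and q dvd p + 1 makes the primes consecutive. Then r divides p^3 - 1 = 7 by counting Sylow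
  r-subgroups.\<close>

lemma numbers: "p = 2 \<and> q = 3 \<and> r = 7"
proof -
  obtain S U where SU: "subgroup S G" "subgroup U G" "S \<subseteq> U" "card S = p * q" "card U = p ^ 3 * q"
    using ex_SU by blast
  obtain T where T: "subgroup T G" "card T = p\<^sup>2 * q" using ex_T by blast
  interpret T: p2q_subgroup G T p q using p2q T by blast
  obtain P where P: "subgroup P G" "P \<subseteq> U" "card P = p ^ 3" using sylow_exists[OF SU(2) p, of 3] SU by auto
  have Pc: "P \<subseteq> carrier G" using P(1) by (simp add: subgroup.subset)
  let ?c = "card ((\<lambda>g. cj g P) ` U)"
  have nU: "\<not> p ^ Suc 3 dvd card U"
  proof
    assume "p ^ Suc 3 dvd card U"
    moreover have "\<not> a * p dvd a * q" if "a > 0" for a :: nat using gt prime_dvd_eq that by simp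
    from this[of "p ^ 3"] have "\<not> p ^ Suc 3 dvd p ^ 3 * q" using gt(1) by (metis mult.commute power_Suc zero_less_power less_trans zero_less_one)
    ultimately show False using SU by simp
  qed
  have c1: "[?c = 1] (mod p)" using sylow_count[OF SU(2) P p nU] .
  have eq: "?c * card (U \<inter> nrm P) = p ^ 3 * q" using card_conjugates[OF SU(2) Pc] SU by simp
  have "p ^ 3 dvd card (U \<inter> nrm P)"
    using card_dvd[OF P(1) nrm_dvd(1)[OF SU(2) Pc]] P self_subset_nrm[OF P(1)] by simp
  then obtain m where m: "card (U \<inter> nrm P) = p ^ 3 * m" by blast
  then have "?c * m = q" using eq gt by (simp add: algebra_simps)
  then have "?c = 1 \<or> ?c = q" using q by (metis dvd_triv_left prime_nat_iff)
  moreover have "?c \<noteq> 1"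
  proof
    assume "?c = 1"
    then have "card (U \<inter> nrm P) = card U" using eq SU by simp
    then have UP: "U \<subseteq> nrm P" using finite_sub[OF SU(2)] by (metis card_subset_eq inf_le1 inf_le2)
    obtain Q where Q: "subgroup Q G" "Q \<subseteq> S" "card Q = q" using cauchy_sub[OF SU(1) q] SU by auto
    obtain Y where Y: "subgroup Y G" "Y \<subseteq> S" "card Y = p" using cauchy_sub[OF SU(1) p] SU by auto
    obtain y where y: "y \<in> Y" "y \<noteq> \<one>" using nontrivial_elem[OF Y(1)] Y gt by auto
    \<comment> \<open>If P is normal in U, then y lies in P, while y normalizes Q. For k in Q the
      commutator of y and k lies in P and in Q, hence is trivial, against
      \<open>Q_not_centralized\<close>.\<close>
    have YP: "Y \<subseteq> P"
      using sylow_contains[OF SU(2) P p nU Y(1), of 1] Y SU UP by auto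
    have yc: "y \<in> carrier G" using subgroup.mem_carrier[OF Y(1) y(1)] .
    have "k \<otimes> y = y \<otimes> k" if k: "k \<in> Q" for k
    proof -
      have kc: "k \<in> carrier G" using subgroup.mem_carrier[OF Q(1) k] .
      have "y \<in> nrm Q" using T.order_pq_normal[OF SU(1,4) Q] Y y by blast
      then have 1: "y \<otimes> k \<otimes> inv y \<otimes> inv k \<in> Q"
        using nrm_mem k Q(1) by (simp add: subgroup.m_closed subgroup.m_inv_closed)
      have "k \<in> nrm P" using UP SU Q k by blast
      moreover have yP: "y \<in> P" using y YP by blast
      ultimately have "k \<otimes> inv y \<otimes> inv k \<in> P" using nrm_mem P(1) by (simp add: subgroup.m_inv_closed)
      then have "y \<otimes> (k \<otimes> inv y \<otimes> inv k) \<in> P" using yP P(1) by (simp add: subgroup.m_closed)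
      then have 2: "y \<otimes> k \<otimes> inv y \<otimes> inv k \<in> P" using yc kc by (simp add: m_assoc)
      have "P \<inter> Q = {\<one>}" using P Q cops by (intro coprime_inter) auto
      then have "y \<otimes> k \<otimes> inv y \<otimes> inv k = \<one>" using 1 2 by blast
      then have "y \<otimes> k \<otimes> inv y = k" using yc kc by (metis inv_closed inv_equality inv_inv m_closed)
      then show ?thesis using yc kc by (metis inv_closed inv_solve_right m_closed)
    qed
    then show False
      using Q_not_centralized[OF Q(1,3) yc y(2)] pow_card_eq_one[OF Y(1) y(1)] Y(3) by simp
  qed
  ultimately have "[q = 1] (mod p)" using c1 by simp
  then have pq: "p = 2 \<and> q = 3" using primes_consecutive[OF p q T.q_dvd_p_plus_1] by blast
  obtain R where R: "subgroup R G" "card R = r" using R_norm_ex by blast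
  have "[p ^ 3 = 1] (mod r)"
    using sylow_count[OF subgroup_self R(1) subgroup.subset[OF R(1)] _ r, of 1] R sylow_r card_R_class[OF R]
    by (simp add: order_def)
  from cong_1_dvd[OF this] have "r dvd 7" using pq by simp
  then have "r = 7" using primes_dvd_imp_eq[OF r, of 7] by simp
  then show ?thesis using pq by simp
qed

end

section \<open>Permutation representations on Sylow subgroups\<close>

text \<open>The target mentions only n and the functions F, nothing of the represented group, so two
  groups with equal generator images become isomorphic to one object. Restriction makes the
  functions extensional, as elements of \<open>BijGroup\<close> are.\<close>

definition perm_group :: "nat \<Rightarrow> (nat \<Rightarrow> nat) set \<Rightarrow> (nat \<Rightarrow> nat) monoid" where
  "perm_group n F = (BijGroup {..<n})\<lparr>carrier := generate (BijGroup {..<n}) ((\<lambda>f. restrict f {..<n}) ` F)\<rparr>"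

context fin_group
begin

text \<open>The action a is read off on labelled points: lam numbers the points, and f s is the permutation
  of the labels induced by the generator s.\<close>

lemma iso_perm_group:
  assumes act: "acts (carrier G) E a" and lam: "bij_betw lam {..<n} E"
    and faithful: "\<And>g. g \<in> carrier G \<Longrightarrow> (\<And>x. x \<in> E \<Longrightarrow> a g x = x) \<Longrightarrow> g = \<one>"
    and S: "S \<subseteq> carrier G" and gen: "generate G S = carrier G"
    and img: "\<And>s i. s \<in> S \<Longrightarrow> i < n \<Longrightarrow> f s i < n \<and> a s (lam i) = lam (f s i)"
  shows "G \<cong> perm_group n (f ` S)"
proof -
  define b where "b g i = inv_into {..<n} lam (a g (lam i))" for g i
  have lamE: "lam i \<in> E" if "i < n" for i using lam that by (auto simp: bij_betw_def)
  have aE: "a g x \<in> E" if "g \<in> carrier G" "x \<in> E" for g x using act that by (auto simp: acts_def)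
  have invl: "inv_into {..<n} lam (lam i) = i" if "i < n" for i
    using lam that by (simp add: bij_betw_def)
  have invr: "lam (inv_into {..<n} lam x) = x" "inv_into {..<n} lam x < n" if "x \<in> E" for x
    using lam that inv_into_into[of x lam "{..<n}"] by (auto simp: bij_betw_def f_inv_into_f)
  have lamb: "lam (b g i) = a g (lam i)" "b g i < n" if "g \<in> carrier G" "i < n" for g i
    using invr[OF aE[OF that(1) lamE[OF that(2)]]] by (simp_all add: b_def)
  have act': "acts (carrier G) {..<n} b"
    unfolding acts_def
  proof (intro conjI ballI)
    show "subgroup (carrier G) G" by (rule subgroup_self)
    fix i assume i: "i \<in> {..<n}"
    then show "b \<one> i = i" using act lamE by (simp add: b_def acts_def invl)
    fix g assume g: "g \<in> carrier G"
    then show "b g i \<in> {..<n}" using lamb i by simp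
    fix h assume h: "h \<in> carrier G"
    have "a (g \<otimes> h) (lam i) = a g (a h (lam i))" using act g h lamE i by (simp add: acts_def)
    then show "b (g \<otimes> h) i = b g (b h i)" using lamb[of h i] h i by (simp add: b_def[of "g \<otimes> h"] b_def[of g])
  qed
  let ?B = "BijGroup {..<n}"
  let ?h = "\<lambda>g. restrict (b g) {..<n}"
  have "G\<lparr>carrier := carrier G\<rparr> = G" by simp
  then have "group_action G {..<n} ?h" using acts_group_action[OF act'] by simp
  then interpret H: group_hom G ?B ?h by (rule group_action.group_hom)
  have inj: "inj_on ?h (carrier G)"
  proof -
    have "g = \<one>" if g: "g \<in> carrier G" "?h g = \<one>\<^bsub>?B\<^esub>" for g
    proof (rule faithful[OF g(1)])
      fix x assume x: "x \<in> E"
      obtain i where i: "i < n" "x = lam i" using invr[OF x] by metis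
      have "b g i = i" using g(2) i(1) by (simp add: BijGroup_def fun_eq_iff) metis
      then show "a g x = x" using lamb[OF g(1) i(1)] i by simp
    qed
    then show ?thesis using H.inj_on_one_iff by blast
  qed
  have "?h ` S = (\<lambda>f. restrict f {..<n}) ` (f ` S)"
  proof -
    have "?h s = restrict (f s) {..<n}" if s: "s \<in> S" for s
    proof
      fix i show "?h s i = restrict (f s) {..<n} i"
        using img[OF s, of i] invl[of "f s i"] by (simp add: b_def)
    qed
    then show ?thesis unfolding image_image by (rule image_cong[OF refl])
  qed
  then have "?h ` carrier G = carrier (perm_group n (f ` S))"
    using H.generate_img[OF S] gen by (simp add: perm_group_def)
  moreover have "?h \<in> hom G (perm_group n (f ` S))"
  proof (rule homI)
    fix x assume "x \<in> carrier G"
    then show "?h x \<in> carrier (perm_group n (f ` S))" using calculation by blast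
    fix y assume "y \<in> carrier G"
    with \<open>x \<in> carrier G\<close> show "?h (x \<otimes> y) = ?h x \<otimes>\<^bsub>perm_group n (f ` S)\<^esub> ?h y"
      using H.hom_mult[of x y] by (simp add: perm_group_def)
  qed
  ultimately have "?h \<in> iso G (perm_group n (f ` S))" using inj by (simp add: iso_def bij_betw_def)
  then show ?thesis by (auto simp: is_iso_def)
qed

lemma involution:
  assumes "u \<in> carrier G" "u \<otimes> u = \<one>" shows "inv u = u"
  using assms by (simp add: inv_equality)

lemma card2_involution:
  assumes "subgroup K G" "card K = 2" obtains u where "u \<in> K" "u \<noteq> \<one>" "u \<otimes> u = \<one>" "u \<in> carrier G"
proof -
  obtain u where u: "u \<in> K" "u \<noteq> \<one>" using nontrivial_elem[OF assms(1)] assms(2) by auto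
  have uc: "u \<in> carrier G" using subgroup.mem_carrier[OF assms(1) u(1)] .
  have "u [^] (2::nat) = \<one>" using pow_card_eq_one[OF assms(1) u(1)] assms(2) by simp
  then have "u \<otimes> u = \<one>" using uc by (simp add: numeral_2_eq_2)
  then show thesis using that u uc by blast
qed

end

text \<open>The projective line over the field with r elements: R is infinity, \<open>\<rho>\<close>
  is the translation z + 1 and K is the origin.\<close>

locale sylow_points = fin_group +
  fixes R r \<rho> K
  assumes R: "subgroup R G" and card_R: "card R = r" and r: "nprime r" and sylow: "\<not> r ^ Suc 1 dvd order G"
    and card_class: "card ((\<lambda>g. cj g R) ` carrier G) = Suc r"
    and \<rho>: "\<rho> \<in> R" "\<rho> \<noteq> \<one>" and K: "K \<in> (\<lambda>g. cj g R) ` carrier G" "K \<noteq> R"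
begin

abbreviation "points \<equiv> (\<lambda>g. cj g R) ` carrier G"

definition pt :: "nat \<Rightarrow> 'a set" where "pt i = cj (\<rho> [^] i) K"

lemma Rc: "R \<subseteq> carrier G" using R by (simp add: subgroup.subset)

lemma \<rho>c: "\<rho> \<in> carrier G" using \<rho> Rc by blast

lemma point: "L \<in> points \<Longrightarrow> subgroup L G \<and> card L = r \<and> L \<subseteq> carrier G"
  using subgroup_cj[OF R] card_cj[OF Rc] card_R cj_carrier[OF Rc] by auto

lemma Kc: "K \<subseteq> carrier G" using point K by blast

lemma cj_point: "g \<in> carrier G \<Longrightarrow> L \<in> points \<Longrightarrow> cj g L \<in> points"
  using acts_conjugates[OF subgroup_self Rc] by (auto simp: acts_def)

lemma R_point: "R \<in> points" using cj_one[OF Rc] by (metis imageI one_closed)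

lemma pt_point: "pt i \<in> points" unfolding pt_def using cj_point[OF _ K(1)] \<rho>c by simp

lemma pt_0: "pt 0 = K" by (simp add: pt_def cj_one[OF Kc])

lemma cj_inj: "g \<in> carrier G \<Longrightarrow> L \<in> points \<Longrightarrow> M \<in> points \<Longrightarrow> cj g L = cj g M \<Longrightarrow> L = M"
  using cj_inv_cancel(1) point by metis

lemma \<rho>_pow_r: "\<rho> [^] r = \<one>" using pow_card_eq_one[OF R \<rho>(1)] card_R by simp

lemma ord_\<rho>: "ord \<rho> = r" using ord_prime[OF \<rho>c \<rho>(2) \<rho>_pow_r r] .

lemma pt_mod: "pt i = pt (i mod r)"
proof -
  have "\<rho> [^] i = \<rho> [^] (r * (i div r)) \<otimes> \<rho> [^] (i mod r)" using \<rho>c by (simp add: nat_pow_mult)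
  also have "\<rho> [^] (r * (i div r)) = \<one>" using \<rho>c nat_pow_pow[of \<rho> r "i div r", symmetric] \<rho>_pow_r by simp
  finally show ?thesis using \<rho>c by (simp add: pt_def)
qed

lemma cj_\<rho>_pow: "cj (\<rho> [^] i) (pt j) = pt (i + j)"
  using \<rho>c Kc by (simp add: pt_def cj_mult[symmetric] nat_pow_mult)

lemma cj_\<rho>: "cj \<rho> (pt j) = pt (Suc j)"
  using cj_\<rho>_pow[of 1 j] \<rho>c by simp

lemma cj_R: "g \<in> R \<Longrightarrow> cj g R = R"
  using self_subset_nrm[OF R] by (auto simp: nrm_def)

text \<open>R is generated by g, so R normalizes a fixed L and therefore lies in it, both being
  Sylow subgroups. As a consequence \<open>\<rho>\<close> permutes the other r points in one
  cycle.\<close>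

lemma R_only_fixes_R:
  assumes "g \<in> R" "g \<noteq> \<one>" "L \<in> points" "cj g L = L" shows "L = R"
proof -
  have L: "subgroup L G" "card L = r" "L \<subseteq> carrier G" using point[OF assms(3)] by auto
  have gc: "g \<in> carrier G" using assms Rc by blast
  have "g \<in> nrm L" using assms gc by (simp add: nrm_def)
  then have "R \<subseteq> nrm L"
    using prime_gen[OF R card_R r assms(1,2)] gen_subset[OF nrm_sub[OF L(1)]] by metis
  then have "R \<subseteq> L"
    using sylow_contains[OF subgroup_self L(1,3) _ r _ R Rc, of 1 1] L(2) card_R sylow by (simp add: order_def)
  then show ?thesis using L card_R finite_sub[OF L(1)] by (metis card_subset_eq)
qed

lemma pt_ne_R: "pt i \<noteq> R"
proof
  assume "pt i = R"
  then have "cj (\<rho> [^] i) K = cj (\<rho> [^] i) R"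
    using cj_R[OF subgroup_nat_pow_closed[OF R \<rho>(1)]] by (simp add: pt_def)
  then show False using cj_inj[OF _ K(1) R_point] \<rho>c K(2) by blast
qed

lemma pt_inj_aux: assumes "i \<le> j" "j < r" "pt i = pt j" shows "i = j"
proof (rule ccontr)
  assume "i \<noteq> j"
  then have d: "0 < j - i" "j - i < r" using assms by auto
  have "cj (\<rho> [^] i) (pt (j - i)) = cj (\<rho> [^] i) (pt 0)" using assms by (simp add: cj_\<rho>_pow)
  then have "pt (j - i) = pt 0" using cj_inj[OF _ pt_point pt_point] \<rho>c by blast
  then have "cj (\<rho> [^] (j - i)) K = K" unfolding pt_0 unfolding pt_def .
  moreover have "\<rho> [^] (j - i) \<noteq> \<one>" using pow_eq_id[OF \<rho>c, of "j - i"] ord_\<rho> d by (auto dest: dvd_imp_le)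
  moreover have "\<rho> [^] (j - i) \<in> R" by (rule subgroup_nat_pow_closed[OF R \<rho>(1)])
  ultimately show False using R_only_fixes_R K by blast
qed

lemma pt_inj: "i < r \<Longrightarrow> j < r \<Longrightarrow> pt i = pt j \<longleftrightarrow> i = j"
  using pt_inj_aux[of i j] pt_inj_aux[of j i] by (metis nat_le_linear)

text \<open>The label r plays the role of the point at infinity of the projective line, and label i < r that
  of the residue i.\<close>

definition label :: "nat \<Rightarrow> 'a set" where "label i = (if i = r then R else pt i)"

lemma label_bij: "bij_betw label {..<Suc r} points"
proof -
  have inj: "inj_on label {..<Suc r}"
  proof (rule inj_onI)
    fix i j assume "i \<in> {..<Suc r}" "j \<in> {..<Suc r}" "label i = label j"
    then show "i = j" using pt_ne_R[of i] pt_ne_R[of j] pt_inj[of i j]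
      by (auto simp: label_def split: if_splits)
  qed
  moreover have "label ` {..<Suc r} \<subseteq> points" using R_point pt_point by (auto simp: label_def)
  moreover have "finite points" using fin by simp
  ultimately have "label ` {..<Suc r} = points"
    using card_image[OF inj] card_class by (metis card_subset_eq card_lessThan)
  then show ?thesis using inj by (simp add: bij_betw_def)
qed

lemma points_cases:
  assumes "L \<in> points" obtains "L = R" | i where "i < r" "L = pt i"
proof -
  have "L \<in> label ` {..<Suc r}" using label_bij assms unfolding bij_betw_def by blast
  then obtain i where "i < Suc r" "L = label i" by blast
  then show thesis using that(1) that(2)[of i] by (cases "i = r") (simp_all add: label_def)
qed

text \<open>The powers of \<open>\<rho>\<close> move K to r different points, so in the stabilizer
  of infinity the index of the stabilizer of the origin is at least r. This bounds the kernel of the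
  action.\<close>

lemma two_point_stabilizer: "card (nrm R \<inter> nrm K) * r \<le> card (nrm R)"
proof -
  have N: "subgroup (nrm R) G" by (rule nrm_sub[OF R])
  have act: "acts (nrm R) points cj"
    using acts_conjugates[OF subgroup_self Rc] N nrm_carrier by (auto simp: acts_def subset_iff)
  have eq: "card ((\<lambda>g. cj g K) ` nrm R) * card {g \<in> nrm R. cj g K = K} = card (nrm R)"
    by (rule orbit_stabilizer[OF act K(1)])
  have "{g \<in> nrm R. cj g K = K} = nrm R \<inter> nrm K" by (auto simp: nrm_def)
  moreover have "pt ` {..<r} \<subseteq> (\<lambda>g. cj g K) ` nrm R"
    using self_subset_nrm[OF R] subgroup_nat_pow_closed[OF R \<rho>(1)] by (auto simp: pt_def)
  then have "card (pt ` {..<r}) \<le> card ((\<lambda>g. cj g K) ` nrm R)"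
    using card_mono finite_imageI[OF finite_sub[OF N]] by blast
  moreover have "card (pt ` {..<r}) = r" using pt_inj by (subst card_image) (auto simp: inj_on_def)
  ultimately show ?thesis using eq by (metis mult.commute mult_le_mono1)
qed

lemma conj_\<rho>_pow:
  assumes "h \<in> carrier G" "h \<otimes> \<rho> \<otimes> inv h = \<rho> [^] (k::nat)"
  shows "h \<otimes> \<rho> [^] (i::nat) \<otimes> inv h = \<rho> [^] (k * i)"
  using conj_pow[OF assms(1) \<rho>c, of i] assms(2) \<rho>c by (simp add: nat_pow_pow)

text \<open>h fixes the origin and conjugates z + 1 to z + k, so it acts as multiplication by
  k.\<close>

lemma normalizer_action:
  assumes "h \<in> carrier G" "h \<otimes> \<rho> \<otimes> inv h = \<rho> [^] (k::nat)" "cj h K = K"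
  shows "cj h (pt i) = pt (k * i)"
proof -
  have "h \<otimes> \<rho> [^] i \<otimes> inv h = \<rho> [^] (k * i)" by (rule conj_\<rho>_pow[OF assms(1,2)])
  then have "h \<otimes> \<rho> [^] i = \<rho> [^] (k * i) \<otimes> h" using assms(1) \<rho>c by (metis inv_solve_right m_closed nat_pow_closed)
  then have "cj (h \<otimes> \<rho> [^] i) K = cj (\<rho> [^] (k * i) \<otimes> h) K" by simp
  then show ?thesis using assms \<rho>c Kc by (simp add: cj_mult pt_def)
qed

lemma R_conj_pow:
  assumes "h \<in> nrm R" obtains k where "k < r" "h \<otimes> \<rho> \<otimes> inv h = \<rho> [^] (k::nat)"
proof -
  have "h \<otimes> \<rho> \<otimes> inv h \<in> R" using nrm_mem[OF assms \<rho>(1)] .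
  then have "h \<otimes> \<rho> \<otimes> inv h \<in> generate G {\<rho>}" using prime_gen[OF R card_R r \<rho>] by simp
  then obtain n :: nat where n: "h \<otimes> \<rho> \<otimes> inv h = \<rho> [^] n" using gen_elems[OF \<rho>c] by blast
  have "\<rho> [^] n = \<rho> [^] (r * (n div r)) \<otimes> \<rho> [^] (n mod r)" using \<rho>c by (simp add: nat_pow_mult)
  also have "\<rho> [^] (r * (n div r)) = \<one>" using \<rho>c nat_pow_pow[of \<rho> r "n div r", symmetric] \<rho>_pow_r by simp
  finally have "\<rho> [^] n = \<rho> [^] (n mod r)" using \<rho>c by simp
  then show thesis using that[of "n mod r"] n r prime_gt_0_nat by simp
qed

lemma \<rho>_pow_eq: "\<rho> [^] (i::nat) = \<rho> [^] (j::nat) \<longleftrightarrow> [i = j] (mod r)"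
  using pow_eq_iff[OF \<rho>c] ord_\<rho> by simp

end

section \<open>The group of order 60\<close>

lemma dvd_20: "4 dvd n \<Longrightarrow> 5 dvd n \<Longrightarrow> 20 dvd (n::nat)" by presburger
lemma nat_cases5: "i < (5::nat) \<Longrightarrow> i = 0 \<or> i = 1 \<or> i = 2 \<or> i = 3 \<or> i = 4" by linarith
lemma nat_cases6: "i < (6::nat) \<Longrightarrow> i = 0 \<or> i = 1 \<or> i = 2 \<or> i = 3 \<or> i = 4 \<or> i = 5" by linarith
lemma nat_cases7: "i < (7::nat) \<Longrightarrow> i = 0 \<or> i = 1 \<or> i = 2 \<or> i = 3 \<or> i = 4 \<or> i = 5 \<or> i = 6" by linarith
lemma nat_cases8: "i < (8::nat) \<Longrightarrow> i = 0 \<or> i = 1 \<or> i = 2 \<or> i = 3 \<or> i = 4 \<or> i = 5 \<or> i = 6 \<or> i = 7" by linarith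

context case60
begin

lemma pqr: "p = 2" "q = 3" "r = 5" using numbers by auto

lemma ord60: "order G = 60" using ord pqr by simp

text \<open>Subgroups of order 4 are Sylow subgroups here, so some conjugate of the T from
  \<open>ex_T\<close> contains A.\<close>

lemma order4_in_order12:
  assumes A: "subgroup A G" "card A = 4"
  obtains T where "p2q_subgroup G T p q" "subgroup T G" "card T = 12" "A \<subseteq> T"
proof -
  obtain T where T: "subgroup T G" "card T = p\<^sup>2 * q" using ex_T by blast
  obtain B where B: "subgroup B G" "B \<subseteq> T" "card B = 2 ^ 2"
    using sylow_exists[OF T(1) two_is_prime_nat, of 2] T(2) pqr by auto
  obtain g where g: "g \<in> carrier G" "A = cj g B"
    using sylow_conj_eq[of B 2 2 A] A B two_is_prime_nat ord60 by auto
  have T': "subgroup (cj g T) G" "card (cj g T) = p\<^sup>2 * q"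
    using subgroup_cj[OF T(1) g(1)] card_cj[OF subgroup.subset[OF T(1)] g(1)] T(2) by auto
  moreover have "A \<subseteq> cj g T" unfolding g(2) using B(2) by (auto simp: cj_def)
  ultimately show thesis using that[of "cj g T"] p2q pqr by simp
qed

text \<open>By Sylow, u is conjugate to an element w of A. A subgroup Q of order 3 in T then
  permutes the three involutions of A transitively, since an orbit of length 1 would give a subgroup
  of order 2 normalized by Q.\<close>

lemma involutions_conj:
  assumes A: "subgroup A G" "card A = 4"
    and u: "u \<in> carrier G" "u \<noteq> \<one>" "u \<otimes> u = \<one>"
    and v: "v \<in> A" "v \<noteq> \<one>" "v \<otimes> v = \<one>"
  obtains h where "h \<in> carrier G" "h \<otimes> u \<otimes> inv h = v"
proof -
  have Ac: "A \<subseteq> carrier G" using A(1) by (simp add: subgroup.subset)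
  have n8: "\<not> 2 ^ Suc 2 dvd card (carrier G)" using ord60 by (simp add: order_def)
  obtain T where T0: "p2q_subgroup G T p q" and T: "subgroup T G" "card T = 12" and AT: "A \<subseteq> T"
    using order4_in_order12[OF A] by blast
  interpret T: p2q_subgroup G T p q by (rule T0)
  have A': "card A = p\<^sup>2" using A pqr by simp
  obtain Q where Q: "subgroup Q G" "Q \<subseteq> T" "card Q = q" using cauchy_sub[OF T(1) q] T pqr by auto
  have u2: "u [^] (2::nat) = \<one>" using u by (simp add: numeral_2_eq_2)
  have U: "subgroup (generate G {u}) G" "card (generate G {u}) = 2 ^ 1"
    using gen_subgroup[OF u(1)] card_gen_prime[OF u(1,2) u2 two_is_prime_nat] by auto
  obtain g where g: "g \<in> carrier G" "generate G {u} \<subseteq> cj g A"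
    using sylow_conj[OF subgroup_self A(1) Ac _ two_is_prime_nat n8 U(1) subgroup.subset[OF U(1)] U(2)] A(2) by auto
  then obtain w where w: "w \<in> A" "u = g \<otimes> w \<otimes> inv g" using gen_self[of u] by (auto simp: cj_def)
  have wc: "w \<in> carrier G" using w Ac by blast
  have w_eq: "inv g \<otimes> u \<otimes> inv (inv g) = w" using w g wc by (simp add: m_assoc) (simp add: m_assoc[symmetric])
  have w1: "w \<noteq> \<one>" using w u g by auto
  have act: "acts Q (A - {\<one>}) (\<lambda>g x. g \<otimes> x \<otimes> inv g)"
    unfolding acts_def
  proof (intro conjI ballI Q(1))
    have Qc: "x \<in> carrier G" if "x \<in> Q" for x using subgroup.mem_carrier[OF Q(1) that] .
    fix x assume x: "x \<in> A - {\<one>}"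
    then have xc: "x \<in> carrier G" using Ac by blast
    then show "\<one> \<otimes> x \<otimes> inv \<one> = x" by simp
    fix k assume k: "k \<in> Q"
    have "k \<in> nrm A" using T.p_part_normal[OF A(1) AT A'] Q k by blast
    moreover have "k \<otimes> x \<otimes> inv k \<noteq> \<one>"
      using x xc Qc[OF k] by (metis DiffE inv_closed inv_equality inv_inv l_cancel_one' insertI1 m_closed nat_pow_closed r_one right_cancel)
    ultimately show "k \<otimes> x \<otimes> inv k \<in> A - {\<one>}" using nrm_mem x by blast
    fix h assume "h \<in> Q"
    then show "k \<otimes> h \<otimes> x \<otimes> inv (k \<otimes> h) = k \<otimes> (h \<otimes> x \<otimes> inv h) \<otimes> inv k"
      using conj_mult_dist[OF Qc Qc xc] k by blast
  qed
  let ?O = "(\<lambda>g. g \<otimes> w \<otimes> inv g) ` Q"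
  have wA: "w \<in> A - {\<one>}" using w w1 by blast
  have eq: "card ?O * card {g \<in> Q. g \<otimes> w \<otimes> inv g = w} = 3"
    using orbit_stabilizer[OF act wA] Q(3) pqr by simp
  have "card ?O \<noteq> 1"
  proof
    assume "card ?O = 1"
    then have "card {g \<in> Q. g \<otimes> w \<otimes> inv g = w} = card Q" using eq Q pqr by simp
    then have "{g \<in> Q. g \<otimes> w \<otimes> inv g = w} = Q" using finite_sub[OF Q(1)] by (intro card_subset_eq) auto
    then have fx: "g \<otimes> w \<otimes> inv g = w" if "g \<in> Q" for g using that by blast
    have "Q \<subseteq> nrm (generate G {w})"
    proof
      fix k assume k: "k \<in> Q"
      show "k \<in> nrm (generate G {w})"
        by (rule gen_normI) (use fx[OF k] gen_self[of w] wc subgroup.mem_carrier[OF Q(1) k] in auto)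
    qed
    moreover have W: "subgroup (generate G {w}) G" "generate G {w} \<subseteq> T" "card (generate G {w}) = p"
      using gen_subgroup[OF wc] gen_subset[OF A(1) w(1)] AT
        card_gen_prime[OF wc w1 T.p_part_exponent[OF A(1) AT A' w(1)] p] by auto
    ultimately have "q dvd card (T \<inter> nrm (generate G {w}))"
      using card_dvd[OF Q(1) nrm_dvd(1)[OF T(1) subgroup.subset[OF W(1)]]] Q by simp
    then show False using T.no_q_normalizes_p[OF W] by blast
  qed
  moreover have "card ?O dvd 3" using eq by (metis dvd_triv_left)
  ultimately have "card ?O = 3" using prime_nat_iff[of 3] by auto
  moreover have "?O \<subseteq> A - {\<one>}" using act wA by (auto simp: acts_def)
  moreover have "card (A - {\<one>}) = 3" using A subgroup.one_closed[OF A(1)] by (simp add: card_Diff_singleton)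
  ultimately have "?O = A - {\<one>}" using finite_sub[OF A(1)] by (metis card_subset_eq finite_Diff)
  then obtain k where k: "k \<in> Q" "k \<otimes> w \<otimes> inv k = v" using v by (metis (no_types, lifting) DiffI imageE singletonD)
  have kc: "k \<in> carrier G" using subgroup.mem_carrier[OF Q(1) k(1)] .
  have "k \<otimes> inv g \<otimes> u \<otimes> inv (k \<otimes> inv g) = v"
    using conj_mult_dist[OF kc inv_closed[OF g(1)] u(1)] w_eq k by simp
  then show thesis using that[of "k \<otimes> inv g"] kc g by simp
qed

lemma no_order_20: assumes "subgroup H G" "20 dvd card H" shows "H = carrier G"
proof -
  have "card H dvd 60" using card_dvd_order[OF assms(1)] ord60 by simp
  then obtain k where k: "60 = card H * k" by blast
  obtain m where m: "card H = 20 * m" using assms(2) by blast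
  have "m * k = 3" using k m by (simp add: mult.commute)
  then have "m dvd 3" by (metis dvd_triv_left)
  then have "m = 1 \<or> m = 3" using prime_nat_iff[of 3] by auto
  then have "card H = 60" using no_ppr[OF assms(1)] m pqr by auto
  then show ?thesis using subgroup.subset[OF assms(1)] fin ord60 by (metis card_subset_eq order_def)
qed

text \<open>If s and x commute, the normalizer of <s> contains R and the abelian group A. Its order
  is divisible by 20, so it is G by \<open>no_order_20\<close>. But T has no normal subgroup of
  order 2.\<close>

lemma involution_R:
  assumes R: "subgroup R G" "card R = 5" and s: "s \<in> carrier G" "s \<noteq> \<one>" "s \<otimes> s = \<one>"
    and A: "subgroup A G" "card A = 4" "s \<in> A" and x: "x \<in> R" "x \<noteq> \<one>"
  shows "s \<otimes> x \<otimes> inv s \<noteq> x"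
proof
  assume c: "s \<otimes> x \<otimes> inv s = x"
  have xc: "x \<in> carrier G" using subgroup.mem_carrier[OF R(1) x(1)] .
  obtain T where T0: "p2q_subgroup G T p q" and T: "subgroup T G" "card T = 12" and AT: "A \<subseteq> T"
    using order4_in_order12[OF A(1,2)] by blast
  interpret T: p2q_subgroup G T p q by (rule T0)
  let ?Z = "generate G {s}"
  have s2: "s [^] (2::nat) = \<one>" using s by (simp add: numeral_2_eq_2)
  have Z: "subgroup ?Z G" "card ?Z = 2" using gen_subgroup[OF s(1)] card_gen_prime[OF s(1,2) s2 two_is_prime_nat] by auto
  have Zc: "?Z \<subseteq> carrier G" using Z(1) by (simp add: subgroup.subset)
  have comm: "g \<otimes> s \<otimes> inv g = s \<Longrightarrow> g \<in> carrier G \<Longrightarrow> g \<in> nrm ?Z" for g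
    using gen_normI[of g s] gen_self[of s] s by simp
  have "x \<otimes> s \<otimes> inv x = s"
  proof -
    have "s \<otimes> x = x \<otimes> s" using c s xc by (metis inv_solve_right m_closed)
    then show ?thesis using s xc by (metis inv_solve_right' m_closed)
  qed
  then have "R \<subseteq> nrm ?Z" using comm[OF _ xc] prime_gen[OF R(1,2) _ x] gen_subset[OF nrm_sub[OF Z(1)]] by simp
  then have d5: "5 dvd card (nrm ?Z)" using sub_nrm_dvd[OF Z(1) R(1)] R(2) by simp
  have Ac: "A \<subseteq> carrier G" using A(1) by (simp add: subgroup.subset)
  have A': "card A = p\<^sup>2" using A pqr by simp
  have "A \<subseteq> nrm ?Z"
  proof
    fix y assume y: "y \<in> A"
    then have yc: "y \<in> carrier G" using Ac by blast
    have "y \<otimes> s = s \<otimes> y" using T.p_part_abelian[OF A(1) AT A' y A(3)] .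
    then have "y \<otimes> s \<otimes> inv y = s" using s yc by (metis inv_solve_right' m_closed)
    then show "y \<in> nrm ?Z" using comm yc by blast
  qed
  then have d4: "4 dvd card (nrm ?Z)" using sub_nrm_dvd[OF Z(1) A(1)] A(2) by simp
  have "20 dvd card (nrm ?Z)" using d4 d5 by (rule dvd_20)
  then have full: "nrm ?Z = carrier G" using no_order_20[OF nrm_sub[OF Z(1)]] by simp
  have ZT: "?Z \<subseteq> T" using gen_subset[OF A(1,3)] AT by blast
  have "T \<subseteq> nrm ?Z" using full T(1) by (simp add: subgroup.subset)
  then show False using T.no_normal_p[OF Z(1) ZT] Z(2) pqr by simp
qed

text \<open>The lists tabulate z + 1, - z and - 1 / z on the projective line over the field with 5 elements,
  with 5 for infinity.\<close>

theorem iso_perm_60: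
  "G \<cong> perm_group 6 {(!) [1, 2, 3, 4, 0, 5], (!) [0, 4, 3, 2, 1, 5], (!) [5, 4, 2, 3, 1, 0]}"
proof -
  obtain R where R: "subgroup R G" "card R = 5" "card (nrm R) = 10" "card ((\<lambda>g. cj g R) ` carrier G) = 6"
    using R_norm pqr by auto
  obtain \<rho> where \<rho>: "\<rho> \<in> R" "\<rho> \<noteq> \<one>" using nontrivial_elem[OF R(1)] R(2) by auto
  have N: "subgroup (nrm R) G" by (rule nrm_sub[OF R(1)])
  obtain S2 where S2: "subgroup S2 G" "S2 \<subseteq> nrm R" "card S2 = 2"
    using cauchy_sub[OF N two_is_prime_nat] R(3) by auto
  obtain s where s: "s \<in> S2" "s \<noteq> \<one>" "s \<otimes> s = \<one>" "s \<in> carrier G" using card2_involution[OF S2(1,3)] by blast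
  have sN: "s \<in> nrm R" using s S2 by blast
  obtain A0 where A0: "subgroup A0 G" "card A0 = 2 ^ 2"
    using sylow_exists[OF subgroup_self two_is_prime_nat, of 2] ord60 by (auto simp: order_def)
  have A0c: "A0 \<subseteq> carrier G" using A0(1) by (simp add: subgroup.subset)
  have n8: "\<not> 2 ^ Suc 2 dvd card (carrier G)" using ord60 by (simp add: order_def)
  \<comment> \<open>This puts s into a group \<open>?A\<close> of order 4, which is abelian of
    exponent 2. Other elements of \<open>?A\<close> commute with s and will supply the map - 1 /
    z.\<close>
  obtain g where g: "g \<in> carrier G" "S2 \<subseteq> cj g A0"
    using sylow_conj[OF subgroup_self A0(1) A0c A0(2) two_is_prime_nat n8 S2(1) subgroup.subset[OF S2(1)], of 1] S2(3) by auto
  let ?A = "cj g A0"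
  have A: "subgroup ?A G" "card ?A = 4" using subgroup_cj[OF A0(1) g(1)] card_cj[OF A0c g(1)] A0(2) by auto
  have Ac: "?A \<subseteq> carrier G" using A(1) by (simp add: subgroup.subset)
  have sA: "s \<in> ?A" using s g by blast
  obtain T where T0: "p2q_subgroup G T p q" and AT: "?A \<subseteq> T" using order4_in_order12[OF A] by blast
  interpret T: p2q_subgroup G T p q by (rule T0)
  have A': "card ?A = p\<^sup>2" using A pqr by simp
  note Aab = T.p_part_abelian[OF A(1) AT A']
  have Asq: "x \<otimes> x = \<one>" if x: "x \<in> ?A" for x
    using T.p_part_exponent[OF A(1) AT A' x] x Ac pqr by (auto simp: numeral_2_eq_2)
  \<comment> \<open>An element \<open>t0\<close> of \<open>?A\<close> outside the normalizer moves
    infinity, and the image of infinity is declared the origin K. It is fixed by s because s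
    commutes with \<open>t0\<close>.\<close>
  have "\<not> ?A \<subseteq> nrm R" using card_dvd[OF A(1) N] A(2) R(3) by auto
  then obtain t0 where t0: "t0 \<in> ?A" "t0 \<notin> nrm R" by blast
  have t0c: "t0 \<in> carrier G" using t0 Ac by blast
  define K where "K = cj t0 R"
  have Rc: "R \<subseteq> carrier G" using R(1) by (simp add: subgroup.subset)
  have K: "K \<in> (\<lambda>g. cj g R) ` carrier G" "K \<noteq> R" unfolding K_def using t0 t0c by (auto simp: nrm_def)
  interpret P: sylow_points G R 5 \<rho> K
  proof (unfold_locales)
    show "nprime 5" by simp
    show "\<not> 5 ^ Suc 1 dvd order G" using ord60 by simp
    show "card ((\<lambda>g. cj g R) ` carrier G) = Suc 5" using R by simp
  qed (use R \<rho> K in \<open>auto simp: subgroup.subset subgroup.m_closed subgroup.m_inv_closed subgroup.one_closed\<close>)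
  let ?x = P.pt
  have sR: "cj s R = R" using sN by (simp add: nrm_def)
  have sK: "cj s K = K"
    unfolding K_def using cj_mult[OF Rc s(4) t0c] cj_mult[OF Rc t0c s(4)] Aab[OF sA t0(1)] sR by simp
  \<comment> \<open>The exponent k satisfies k^2 = 1 modulo 5, and k = 1 is impossible by
    \<open>involution_R\<close>; so k = 4 = -1 and s acts as - z.\<close>
  have s\<rho>: "s \<otimes> \<rho> \<otimes> inv s = \<rho> [^] (4::nat)"
  proof -
    obtain k where k: "k < 5" "s \<otimes> \<rho> \<otimes> inv s = \<rho> [^] (k::nat)" using P.R_conj_pow[OF sN] by blast
    have "s \<otimes> (s \<otimes> \<rho> \<otimes> inv s) \<otimes> inv s = \<rho>"
      using conj_mult_dist[OF s(4) s(4) P.\<rho>c] s P.\<rho>c by simp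
    moreover have "s \<otimes> (s \<otimes> \<rho> \<otimes> inv s) \<otimes> inv s = \<rho> [^] (k * k)"
      using P.conj_\<rho>_pow[OF s(4) k(2), of k] k(2) by simp
    ultimately have "\<rho> [^] (k * k) = \<rho> [^] (1::nat)" using P.\<rho>c by simp
    then have "[k * k = 1] (mod 5)" using P.\<rho>_pow_eq by blast
    moreover have "k \<noteq> 1" using involution_R[OF R(1,2) s(4,2,3) A sA \<rho>] k P.\<rho>c by auto
    ultimately have "k = 4" using nat_cases5[OF k(1)] by (auto simp: cong_def)
    then show ?thesis using k by simp
  qed
  have sx: "cj s (?x i) = ?x (4 * i)" for i by (rule P.normalizer_action[OF s(4) s\<rho> sK])
  have sx': "cj s (?x 0) = ?x 0" "cj s (?x 1) = ?x 4" "cj s (?x 2) = ?x 3" "cj s (?x 3) = ?x 2" "cj s (?x 4) = ?x 1"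
    using sx[of 0] sx[of 1] sx[of 2] sx[of 3] sx[of 4] P.pt_mod[of 8] P.pt_mod[of 12] P.pt_mod[of 16] by simp_all
  \<comment> \<open>The fixed points of s are infinity and 0. All involutions of \<open>?A\<close>
    are conjugate to s, so each fixes exactly two points; this count later singles out - 1 /
    z.\<close>
  define F where "F u = {L \<in> P.points. cj u L = L}" for u
  have finF: "finite (F u)" for u unfolding F_def using fin by simp
  have "F s = {R, ?x 0}"
  proof (intro equalityI subsetI)
    fix L assume L: "L \<in> F s"
    then have "L \<in> P.points" by (simp add: F_def)
    then show "L \<in> {R, ?x 0}"
    proof (cases rule: P.points_cases)
      case (2 i)
      then have "?x (4 * i) = ?x i" using L sx by (simp add: F_def)
      then have "?x (4 * i mod 5) = ?x i" using P.pt_mod[of "4 * i"] by simp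
      then have "4 * i mod 5 = i" using P.pt_inj[of "4 * i mod 5" i] 2(1) by simp
      then have "i = 0" using nat_cases5[OF 2(1)] by auto
      then show ?thesis using 2 by simp
    qed simp
  qed (use sR sx' P.R_point P.pt_point in \<open>auto simp: F_def\<close>)
  then have Fs: "card (F s) = 2" using P.pt_ne_R[of 0] by simp
  have F2: "card (F v) = 2" if v: "v \<in> ?A" "v \<noteq> \<one>" for v
  proof -
    obtain h where h: "h \<in> carrier G" "h \<otimes> s \<otimes> inv h = v"
      using involutions_conj[OF A s(4,2,3) v Asq[OF v(1)]] by blast
    have hs: "h \<otimes> s = v \<otimes> h" using h s Ac v by (metis inv_solve_right m_closed subsetD)
    have vc: "v \<in> carrier G" using v Ac by blast
    have "bij_betw (cj h) (F s) (F v)"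
    proof (rule bij_betw_byWitness[where f' = "cj (inv h)"])
      have PC: "L \<subseteq> carrier G" if "L \<in> P.points" for L using P.point[OF that] by blast
      show "\<forall>L\<in>F s. cj (inv h) (cj h L) = L" "\<forall>L\<in>F v. cj h (cj (inv h) L) = L"
        using cj_inv_cancel[OF PC h(1)] by (auto simp: F_def)
      show "cj h ` F s \<subseteq> F v"
      proof (rule image_subsetI)
        fix L assume L: "L \<in> F s"
        then have LP: "L \<in> P.points" "cj s L = L" by (auto simp: F_def)
        have "cj v (cj h L) = cj h (cj s L)"
          using cj_mult[OF PC[OF LP(1)] vc h(1)] cj_mult[OF PC[OF LP(1)] h(1) s(4)] hs by simp
        then show "cj h L \<in> F v" using P.cj_point[OF h(1) LP(1)] LP by (simp add: F_def)
      qed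
      show "cj (inv h) ` F v \<subseteq> F s"
      proof (rule image_subsetI)
        fix L assume L: "L \<in> F v"
        then have LP: "L \<in> P.points" "cj v L = L" by (auto simp: F_def)
        have ih: "inv h \<in> carrier G" using h by simp
        have "s \<otimes> inv h = inv h \<otimes> v" using hs h(1) s(4) vc by (metis ih inv_solve_left inv_solve_right m_assoc m_closed)
        then have "cj s (cj (inv h) L) = cj (inv h) (cj v L)"
          using cj_mult[OF PC[OF LP(1)] s(4) ih] cj_mult[OF PC[OF LP(1)] ih vc] by simp
        then show "cj (inv h) L \<in> F s" using P.cj_point[OF ih LP(1)] LP by (simp add: F_def)
      qed
    qed
    from bij_betw_same_card[OF this] show ?thesis using Fs by simp
  qed
  \<comment> \<open>Stated for a general t since both \<open>t0\<close> and
    \<open>s \<otimes> t0\<close> are candidates: one of the two acts as - 1 / z, the other as 1 /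
    z.\<close>
  have basic: "cj t R = K \<and> cj t K = R \<and> (\<forall>L\<in>P.points. cj t (cj t L) = L) \<and> (\<forall>L\<in>P.points. cj t (cj s L) = cj s (cj t L)) \<and> t \<in> carrier G \<and> t \<noteq> \<one> \<and> s \<otimes> t \<noteq> \<one>"
    if t: "t \<in> ?A" "t \<notin> nrm R" "cj t R = K" for t
  proof -
    have tc: "t \<in> carrier G" using t Ac by blast
    have 1: "cj t (cj t L) = L" if "L \<in> P.points" for L
      using cj_mult[of L t t] P.point[OF that] tc Asq[OF t(1)] cj_one by simp
    have 2: "cj t (cj s L) = cj s (cj t L)" if "L \<in> P.points" for L
      using cj_mult[of L t s] cj_mult[of L s t] P.point[OF that] tc s(4) Aab[OF t(1) sA] by simp
    have 3: "cj t K = R" using 1[OF P.R_point] t(3) by simp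
    have "t \<noteq> \<one>" using t(2) subgroup.one_closed[OF N] by blast
    moreover have "s \<otimes> t \<noteq> \<one>"
    proof
      assume "s \<otimes> t = \<one>"
      from inv_equality[OF this tc s(4)] have "t = s" using involution[OF s(4,3)] inv_inv[OF tc] by simp
      then show False using t(2) sN by blast
    qed
    ultimately show ?thesis using 1 2 3 t tc by blast
  qed
  \<comment> \<open>The prescribed images of 1 and 2 are those of - 1 / z modulo 5. The image of 4
    follows as t is an involution, that of 3 as t commutes with - z.\<close>
  have good: "G \<cong> perm_group 6 {(!) [1, 2, 3, 4, 0, 5], (!) [0, 4, 3, 2, 1, 5], (!) [5, 4, 2, 3, 1, 0]}"
    if t: "t \<in> ?A" "t \<notin> nrm R" "cj t R = K" and x1: "cj t (?x 1) = ?x 4" and x2: "cj t (?x 2) = ?x 2" for t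
  proof -
    note b = basic[OF t]
    have tc: "t \<in> carrier G" using b by blast
    have x3: "cj t (?x 3) = ?x 3" using b P.pt_point[of 2] sx'(3) x2 by metis
    have x4: "cj t (?x 4) = ?x 1" using b P.pt_point[of 1] x1 by metis
    define f where "f y = (if y = \<rho> then (!) [1, 2, 3, 4, 0, 5] else if y = s then (!) [0, 4, 3, 2, 1, 5] else (!) [5, 4, 2, 3, 1, 0::nat])" for y
    have ns: "\<rho> \<noteq> s" using sx'(2) P.cj_\<rho>[of 1] P.pt_inj[of 2 4] by (auto simp: numeral_2_eq_2)
    have nt: "t \<noteq> \<rho>" "t \<noteq> s" using t(2) self_subset_nrm[OF R(1)] \<rho> sN by auto
    let ?S = "{\<rho>, s, t}"
    have Sc: "?S \<subseteq> carrier G" using P.\<rho>c s tc by blast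
    have lab: "P.label 0 = ?x 0" "P.label 1 = ?x 1" "P.label (Suc 0) = ?x 1" "P.label 2 = ?x 2" "P.label 3 = ?x 3" "P.label 4 = ?x 4" "P.label 5 = R"
      by (simp_all add: P.label_def)
    have \<rho>x: "cj \<rho> (?x 0) = ?x 1" "cj \<rho> (?x 1) = ?x 2" "cj \<rho> (?x 2) = ?x 3" "cj \<rho> (?x 3) = ?x 4" "cj \<rho> (?x 4) = ?x 0" "cj \<rho> R = R"
      using P.cj_\<rho>[of 0] P.cj_\<rho>[of 1] P.cj_\<rho>[of 2] P.cj_\<rho>[of 3] P.cj_\<rho>[of 4] P.pt_mod[of 5] P.cj_R[OF \<rho>(1)]
      by (simp_all add: numeral_eq_Suc)
    have "G \<cong> perm_group 6 (f ` ?S)"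
    proof (rule iso_perm_group[where a = cj and lam = P.label and E = P.points])
      show "acts (carrier G) P.points cj" by (rule acts_conjugates[OF subgroup_self Rc])
      show "bij_betw P.label {..<6} P.points" using P.label_bij by simp
      show "?S \<subseteq> carrier G" by (rule Sc)
      \<comment> \<open>The generated subgroup contains R of order 5 and at least three elements of
        \<open>?A\<close>, hence all of \<open>?A\<close>; so 20 divides its order and
        \<open>no_order_20\<close> applies.\<close>
      show "generate G ?S = carrier G"
      proof -
        let ?H = "generate G ?S"
        have H: "subgroup ?H G" by (rule generate_is_subgroup[OF Sc])
        have mem: "\<rho> \<in> ?H" "s \<in> ?H" "t \<in> ?H" by (auto intro: generate.incl)
        have "R \<subseteq> ?H" using prime_gen[OF R(1,2) _ \<rho>] gen_subset[OF H mem(1)] by simp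
        then have d5: "5 dvd card ?H" using card_dvd[OF R(1) H] R(2) by simp
        have I: "subgroup (?H \<inter> ?A) G" using subgroups_Inter_pair H A(1) by blast
        have "{\<one>, s, t} \<subseteq> ?H \<inter> ?A" using mem sA t subgroup.one_closed[OF I] by blast
        then have "card {\<one>, s, t} \<le> card (?H \<inter> ?A)" using finite_sub[OF I] card_mono by blast
        moreover have "card {\<one>, s, t} = 3" using s nt b by auto
        ultimately have c3: "3 \<le> card (?H \<inter> ?A)" by simp
        have "card (?H \<inter> ?A) dvd 4" using card_dvd[OF I A(1)] A(2) by simp
        then obtain m where m: "4 = card (?H \<inter> ?A) * m" by blast
        have "m = 1"
        proof (rule ccontr)
          assume "m \<noteq> 1"
          then have "2 \<le> m" using m by (cases m) auto
          then have "3 * 2 \<le> card (?H \<inter> ?A) * m" using c3 by (rule mult_le_mono[rotated])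
          then show False using m by simp
        qed
        then have "card (?H \<inter> ?A) = 4" using m by simp
        then have d4: "4 dvd card ?H" using card_dvd[OF I H] by simp
        have "20 dvd card ?H" using d4 d5 by (rule dvd_20)
        then show ?thesis using no_order_20[OF H] by simp
      qed
      fix y i assume y: "y \<in> ?S" and i: "i < (6::nat)"
      show "f y i < 6 \<and> cj y (P.label i) = P.label (f y i)"
        using y nat_cases6[OF i] ns nt b \<rho>x sx' sR x1 x2 x3 x4 P.pt_0 by (elim insertE emptyE disjE) (simp_all add: f_def lab)
    next
      fix g assume g: "g \<in> carrier G" and fx: "\<And>L. L \<in> P.points \<Longrightarrow> cj g L = L"
      \<comment> \<open>A kernel element fixes infinity and 0. That stabilizer has order at most 2,
        so it consists of 1 and s, and s moves the point 1.\<close>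
      let ?I = "nrm R \<inter> nrm K"
      have gI: "g \<in> ?I" using fx[OF P.R_point] fx[OF K(1)] g by (simp add: nrm_def)
      have sI: "s \<in> ?I" using sR sK s by (simp add: nrm_def)
      have I: "subgroup ?I G" using subgroups_Inter_pair N subgroup_nrm[OF P.Kc] by blast
      have "card ?I \<le> 2" using P.two_point_stabilizer R(3) by simp
      moreover have "{\<one>, s} \<subseteq> ?I" using sI subgroup.one_closed[OF I] by blast
      moreover have "card {\<one>, s} = 2" using s(2) by auto
      ultimately have "{\<one>, s} = ?I" using finite_sub[OF I] by (metis card_seteq)
      then have "g = \<one> \<or> g = s" using gI by blast
      moreover have "g \<noteq> s" using fx[OF P.pt_point[of 1]] sx'(2) P.pt_inj[of 1 4] by auto
      ultimately show "g = \<one>" by blast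
    qed
    moreover have "f ` ?S = {(!) [1, 2, 3, 4, 0, 5], (!) [0, 4, 3, 2, 1, 5], (!) [5, 4, 2, 3, 1, 0]}"
      using ns nt by (simp add: f_def insert_commute)
    ultimately show ?thesis by simp
  qed
  note b0 = basic[OF t0 K_def[symmetric]]
  have img: "\<exists>j. j \<in> {1,2,3,4} \<and> cj t0 (?x i) = ?x j" if i: "i \<in> {1,2,3,4}" for i
  proof -
    have "cj t0 (?x i) \<in> P.points" using P.cj_point[OF t0c P.pt_point] .
    then show ?thesis
    proof (cases rule: P.points_cases)
      case 1
      then have "?x i = K" using P.cj_inj[OF t0c P.pt_point K(1)] b0 by simp
      then show ?thesis using P.pt_inj[of i 0] P.pt_0 i by auto
    next
      case (2 j)
      have "j \<noteq> 0"
      proof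
        assume "j = 0"
        then have "cj t0 (?x i) = cj t0 R" using 2 b0 P.pt_0 by simp
        then show False using P.cj_inj[OF t0c P.pt_point P.R_point] P.pt_ne_R by blast
      qed
      then show ?thesis using 2 nat_cases5[OF 2(1)] by auto
    qed
  qed
  obtain a where a: "a \<in> {1,2,3,4}" "cj t0 (?x 1) = ?x a" using img[of 1] by auto
  obtain b where b: "b \<in> {1,2,3,4}" "cj t0 (?x 2) = ?x b" using img[of 2] by auto
  have t4: "cj t0 (?x 4) = cj s (?x a)" using b0 P.pt_point sx'(2) a(2) by metis
  have t3: "cj t0 (?x 3) = cj s (?x b)" using b0 P.pt_point sx'(3) b(2) by metis
  have x_eq: "?x i = ?x j \<longleftrightarrow> i = j" if "i \<in> {1,2,3,4}" "j \<in> {1,2,3,4}" for i j using P.pt_inj[of i j] that by auto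
  have F_pts: "L \<in> F u \<Longrightarrow> cj u R = K \<Longrightarrow> cj u K = R \<Longrightarrow> \<exists>i\<in>{1,2,3,4}. L = ?x i" for L u
  proof -
    assume L: "L \<in> F u" and u: "cj u R = K" "cj u K = R"
    then have "L \<in> P.points" "cj u L = L" by (auto simp: F_def)
    from this(1) show "\<exists>i\<in>{1,2,3,4}. L = ?x i"
    proof (cases rule: P.points_cases)
      case 1 then show ?thesis using \<open>cj u L = L\<close> u K by simp
    next
      case (2 i)
      have "i \<noteq> 0" using 2 P.pt_0 \<open>cj u L = L\<close> u K by auto
      then show ?thesis using 2 nat_cases5[OF 2(1)] by auto
    qed
  qed
  have bound: "\<not> (cj u (?x 1) = ?x 1 \<and> cj u (?x 2) = ?x 2 \<and> cj u (?x 3) = ?x 3)" "\<not> (\<forall>i\<in>{1,2,3,4}. cj u (?x i) \<noteq> ?x i)"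
    if u: "cj u R = K" "cj u K = R" "card (F u) = 2" for u
  proof
    assume "cj u (?x 1) = ?x 1 \<and> cj u (?x 2) = ?x 2 \<and> cj u (?x 3) = ?x 3"
    then have "{?x 1, ?x 2, ?x 3} \<subseteq> F u" using P.pt_point by (simp add: F_def)
    then have "card {?x 1, ?x 2, ?x 3} \<le> 2" using card_mono[OF finF] u(3) by metis
    then show False using x_eq by simp
  next
    show "\<not> (\<forall>i\<in>{1,2,3,4}. cj u (?x i) \<noteq> ?x i)"
    proof
      assume h: "\<forall>i\<in>{1,2,3,4}. cj u (?x i) \<noteq> ?x i"
      have "F u \<noteq> {}" using u(3) by auto
      then obtain L where L: "L \<in> F u" by blast
      then obtain i where "i \<in> {1,2,3,4}" "L = ?x i" using F_pts u by blast
      then show False using h L by (auto simp: F_def)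
    qed
  qed
  let ?t1 = "s \<otimes> t0"
  have t1A: "?t1 \<in> ?A" using sA t0 A(1) by (simp add: subgroup.m_closed)
  have t1L: "cj ?t1 L = cj s (cj t0 L)" if "L \<in> P.points" for L
    using cj_mult[of L s t0] P.point[OF that] s(4) t0c by simp
  have t1R: "cj ?t1 R = K" "cj ?t1 K = R" using t1L[OF P.R_point] t1L[OF K(1)] b0 sK sR by auto
  have t1N: "?t1 \<notin> nrm R" using t1R K(2) by (auto simp: nrm_def)
  have t0F: "card (F t0) = 2" using F2 t0(1) b0 by blast
  have t1F: "card (F ?t1) = 2" using F2 t1A b0 by blast
  have t1x: "cj ?t1 (?x i) = cj s (cj t0 (?x i))" for i using t1L P.pt_point by blast
  \<comment> \<open>As \<open>t0\<close> commutes with - z, the images a of 1 and b of 2 determine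
    it. The sixteen pairs are tested against the fixed point count for both \<open>t0\<close> and
    \<open>s \<otimes> t0\<close>; what remains is - 1 / z and 1 / z.\<close>
  have "(a = 4 \<and> b = 2) \<or> (a = 1 \<and> b = 3)"
    using a(1) b(1) bound[OF _ _ t0F] bound[OF t1R t1F] b0 a(2) b(2) t3 t4 t1x sx' x_eq
    by (elim insertE emptyE) simp_all
  then show ?thesis
  proof
    assume "a = 4 \<and> b = 2" then show ?thesis using good[OF t0 K_def[symmetric]] a(2) b(2) by simp
  next
    assume "a = 1 \<and> b = 3"
    then show ?thesis using good[OF t1A t1N t1R(1)] a(2) b(2) t1x sx' by simp
  qed
qed

end

section \<open>The group of order 168\<close>

context case168
begin

lemma pqr: "p = 2" "q = 3" "r = 7" using numbers by auto

lemma ord168: "order G = 168" using ord pqr by simp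

text \<open>The lists tabulate z + 1, 2 z and - 1 / z on the projective line over the field with 7 elements,
  with 7 for infinity.\<close>

theorem iso_perm_168:
  "G \<cong> perm_group 8 {(!) [1, 2, 3, 4, 5, 6, 0, 7], (!) [0, 2, 4, 6, 1, 3, 5, 7], (!) [7, 6, 3, 2, 5, 4, 1, 0]}"
proof -
  obtain R where R: "subgroup R G" "card R = 7" "card (nrm R) = 21" using R_norm_ex pqr by auto
  have cR: "card ((\<lambda>g. cj g R) ` carrier G) = 8" using card_R_class[OF R(1)] R(2) pqr by simp
  have Rc: "R \<subseteq> carrier G" using R(1) by (simp add: subgroup.subset)
  obtain \<rho> where \<rho>: "\<rho> \<in> R" "\<rho> \<noteq> \<one>" using nontrivial_elem[OF R(1)] R(2) by auto
  have \<rho>c: "\<rho> \<in> carrier G" using \<rho> Rc by blast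
  have N: "subgroup (nrm R) G" by (rule nrm_sub[OF R(1)])
  have three: "nprime 3" by simp
  obtain Q where Q: "subgroup Q G" "Q \<subseteq> nrm R" "card Q = 3" using cauchy_sub[OF N three] R(3) by auto
  have Qc: "Q \<subseteq> carrier G" using Q(1) by (simp add: subgroup.subset)
  \<comment> \<open>The involution in this group of order 6 will be shown to invert the generator of
    Q.\<close>
  have NQ: "card (nrm Q) = 6" "subgroup (nrm Q) G" using Q_norm[OF Q(1)] Q(3) pqr nrm_sub[OF Q(1)] by auto
  obtain S2 where S2: "subgroup S2 G" "S2 \<subseteq> nrm Q" "card S2 = 2"
    using cauchy_sub[OF NQ(2) two_is_prime_nat] NQ(1) by auto
  obtain t0 where t0: "t0 \<in> S2" "t0 \<noteq> \<one>" "t0 \<otimes> t0 = \<one>" "t0 \<in> carrier G" using card2_involution[OF S2(1,3)] by blast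
  \<comment> \<open>Normalizers of Sylow 7-subgroups have the odd order 21, so an involution fixes
    no point.\<close>
  have no_inv: "t \<notin> nrm L" if L: "L \<in> (\<lambda>g. cj g R) ` carrier G" and t: "t \<in> carrier G" "t \<noteq> \<one>" "t \<otimes> t = \<one>" for t L
  proof
    assume tL: "t \<in> nrm L"
    have L': "subgroup L G" "card L = r" using L subgroup_cj[OF R(1)] card_cj[OF Rc] R(2) pqr by auto
    have t2: "t [^] (2::nat) = \<one>" using t by (simp add: numeral_2_eq_2)
    have "generate G {t} \<subseteq> nrm L" using gen_subset[OF nrm_sub[OF L'(1)] tL] .
    then have "card (generate G {t}) dvd card (nrm L)" using sub_nrm_dvd[OF L'(1) gen_subgroup[OF t(1)]] by blast
    then show False using card_gen_prime[OF t(1,2) t2 two_is_prime_nat] R_norm[OF L'] pqr by simp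
  qed
  have RP: "R \<in> (\<lambda>g. cj g R) ` carrier G" using cj_one[OF Rc] by (metis imageI one_closed)
  define K where "K = cj t0 R"
  have K: "K \<in> (\<lambda>g. cj g R) ` carrier G" "K \<noteq> R"
    unfolding K_def using t0(4) no_inv[OF RP t0(4,2,3)] by (auto simp: nrm_def)
  interpret P: sylow_points G R 7 \<rho> K
  proof (unfold_locales)
    show "nprime 7" by simp
    show "\<not> 7 ^ Suc 1 dvd order G" using ord168 by simp
    show "card ((\<lambda>g. cj g R) ` carrier G) = Suc 7" using cR by simp
  qed (use R \<rho> K in \<open>auto simp: subgroup.subset subgroup.m_closed subgroup.m_inv_closed subgroup.one_closed\<close>)
  let ?x = P.pt
  \<comment> \<open>A generator u of Q conjugates \<open>\<rho>\<close> to a power k with k^3 = 1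
    modulo 7, so k is 1, 2 or 4. The case k = 1 would put R into the normalizer of Q, of order 6;
    for k = 4 the square of u has exponent 16 = 2.\<close>
  obtain \<kappa> where \<kappa>: "\<kappa> \<in> Q" "\<kappa> \<noteq> \<one>" "\<kappa> \<otimes> \<rho> \<otimes> inv \<kappa> = \<rho> [^] (2::nat)"
  proof -
    obtain u where u: "u \<in> Q" "u \<noteq> \<one>" using nontrivial_elem[OF Q(1)] Q(3) by auto
    have uc: "u \<in> carrier G" using u Qc by blast
    obtain k where k: "k < 7" "u \<otimes> \<rho> \<otimes> inv u = \<rho> [^] (k::nat)" using P.R_conj_pow u Q(2) by blast
    have u3: "u [^] (3::nat) = \<one>" using pow_card_eq_one[OF Q(1) u(1)] Q(3) by simp
    then have u3': "u \<otimes> (u \<otimes> u) = \<one>" using uc by (simp add: numeral_3_eq_3 m_assoc)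
    have s2: "(u \<otimes> u) \<otimes> \<rho> \<otimes> inv (u \<otimes> u) = \<rho> [^] (k * k)"
      using conj_mult_dist[OF uc uc \<rho>c] k P.conj_\<rho>_pow[OF uc k(2), of k] by simp
    have "(u \<otimes> (u \<otimes> u)) \<otimes> \<rho> \<otimes> inv (u \<otimes> (u \<otimes> u)) = \<rho> [^] (k * (k * k))"
      using conj_mult_dist[OF uc _ \<rho>c, of "u \<otimes> u"] uc s2 P.conj_\<rho>_pow[OF uc k(2), of "k * k"] by simp
    then have "\<rho> [^] (k * (k * k)) = \<rho> [^] (1::nat)" using u3' \<rho>c by simp
    then have "[k * (k * k) = 1] (mod 7)" using P.\<rho>_pow_eq by blast
    then have k124: "k = 1 \<or> k = 2 \<or> k = 4" using nat_cases7[OF k(1)] by (auto simp: cong_def)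
    have "k \<noteq> 1"
    proof
      assume "k = 1"
      then have c: "u \<otimes> \<rho> = \<rho> \<otimes> u" using k uc \<rho>c by (metis inv_solve_right m_closed nat_pow_closed nat_pow_eone)
      then have "\<rho> \<otimes> u \<otimes> inv \<rho> = u" using uc \<rho>c by (metis inv_solve_right' m_closed)
      then have "\<rho> \<in> nrm (generate G {u})" using gen_normI[OF \<rho>c uc] gen_self by simp
      then have "\<rho> \<in> nrm Q" using prime_gen[OF Q(1,3) three u] by simp
      then have "R \<subseteq> nrm Q" using prime_gen[OF R(1,2) _ \<rho>] gen_subset[OF NQ(2)] by simp
      then have "7 dvd (6::nat)" using sub_nrm_dvd[OF Q(1) R(1)] R(2) NQ(1) by simp
      then show False by simp
    qed
    then have "k = 2 \<or> k = 4" using k124 by blast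
    then show thesis
    proof
      assume "k = 2" then show thesis using that u k by blast
    next
      assume k4: "k = 4"
      have "\<rho> [^] (16::nat) = \<rho> [^] (2::nat)" using P.\<rho>_pow_eq by (simp add: cong_def)
      then have "(u \<otimes> u) \<otimes> \<rho> \<otimes> inv (u \<otimes> u) = \<rho> [^] (2::nat)" using s2 k4 by simp
      moreover have "u \<otimes> u \<in> Q" using u Q(1) by (simp add: subgroup.m_closed)
      moreover have "u \<otimes> u \<noteq> \<one>" using u3' u uc by auto
      ultimately show thesis using that by blast
    qed
  qed
  have \<kappa>c: "\<kappa> \<in> carrier G" using \<kappa> Qc by blast
  have \<kappa>3: "\<kappa> [^] (3::nat) = \<one>" using pow_card_eq_one[OF Q(1) \<kappa>(1)] Q(3) by simp
  have \<kappa>ord: "ord \<kappa> = 3" using ord_prime[OF \<kappa>c \<kappa>(2) \<kappa>3 three] .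
  have Qgen: "Q = generate G {\<kappa>}" by (rule prime_gen[OF Q(1,3) three \<kappa>(1,2)])
  have Qel: "z = \<one> \<or> z = \<kappa> \<or> z = \<kappa> \<otimes> \<kappa>" if z: "z \<in> Q" for z
  proof -
    obtain n :: nat where n: "z = \<kappa> [^] n" using gen_elems[OF \<kappa>c] z Qgen by blast
    have "\<kappa> [^] n = \<kappa> [^] (3 * (n div 3)) \<otimes> \<kappa> [^] (n mod 3)" using \<kappa>c by (simp add: nat_pow_mult)
    also have "\<kappa> [^] (3 * (n div 3)) = \<one>" using \<kappa>c nat_pow_pow[of \<kappa> 3 "n div 3", symmetric] \<kappa>3 by simp
    finally have "z = \<kappa> [^] (n mod 3)" using \<kappa>c n by simp
    moreover have "n mod 3 = 0 \<or> n mod 3 = 1 \<or> n mod 3 = 2" by linarith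
    ultimately show ?thesis using \<kappa>c by (auto simp: numeral_2_eq_2)
  qed
  have \<kappa>R: "cj \<kappa> R = R" using \<kappa>(1) Q(2) by (auto simp: nrm_def)
  \<comment> \<open>\<open>t0\<close> normalizes Q, so it centralizes or inverts
    \<open>\<kappa>\<close>, whose inverse is its square. Centralizing is excluded by
    \<open>Q_not_centralized\<close>.\<close>
  have tk: "t0 \<otimes> \<kappa> \<otimes> inv t0 = \<kappa> \<otimes> \<kappa>"
  proof -
    have tQ: "t0 \<in> nrm Q" using t0 S2 by blast
    have in_Q: "t0 \<otimes> \<kappa> \<otimes> inv t0 \<in> Q" using nrm_mem[OF tQ \<kappa>(1)] .
    have "t0 \<otimes> \<kappa> \<otimes> inv t0 \<noteq> \<one>"
    proof
      assume "t0 \<otimes> \<kappa> \<otimes> inv t0 = \<one>"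
      then have "t0 \<otimes> \<kappa> = t0" using t0 \<kappa>c by (metis inv_solve_right l_one m_closed one_closed)
      then show False using t0 \<kappa>c \<kappa>(2) by simp
    qed
    moreover have "t0 \<otimes> \<kappa> \<otimes> inv t0 \<noteq> \<kappa>"
    proof
      assume "t0 \<otimes> \<kappa> \<otimes> inv t0 = \<kappa>"
      then have c: "t0 \<otimes> \<kappa> = \<kappa> \<otimes> t0" using t0 \<kappa>c by (metis inv_solve_right m_closed)
      have "k \<otimes> t0 = t0 \<otimes> k" if k: "k \<in> Q" for k
        using Qel[OF k] c t0 \<kappa>c by (elim disjE) (simp_all, metis m_assoc)
      moreover have "t0 [^] p = \<one>" using t0 pqr by (simp add: numeral_2_eq_2)
      ultimately show False using Q_not_centralized[OF Q(1) _ t0(4,2)] Q(3) pqr by simp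
    qed
    ultimately show ?thesis using Qel[OF in_Q] by blast
  qed
  have t\<kappa>: "t0 \<otimes> \<kappa> = \<kappa> \<otimes> \<kappa> \<otimes> t0" using tk t0 \<kappa>c by (metis inv_solve_right m_closed)
  have \<kappa>\<kappa>\<kappa>: "\<kappa> \<otimes> (\<kappa> \<otimes> \<kappa>) = \<one>" using \<kappa>3 \<kappa>c by (simp add: numeral_3_eq_3 m_assoc)
  have t\<kappa>2: "\<kappa> \<otimes> t0 = t0 \<otimes> (\<kappa> \<otimes> \<kappa>)"
  proof -
    have "t0 \<otimes> (\<kappa> \<otimes> \<kappa>) = \<kappa> \<otimes> \<kappa> \<otimes> (\<kappa> \<otimes> \<kappa>) \<otimes> t0"
      using t\<kappa> t0(4) \<kappa>c by (metis m_assoc m_closed)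
    also have "\<kappa> \<otimes> \<kappa> \<otimes> (\<kappa> \<otimes> \<kappa>) = \<kappa>" using \<kappa>\<kappa>\<kappa> \<kappa>c by (simp add: m_assoc)
    finally show ?thesis by simp
  qed
  have PC: "L \<subseteq> carrier G" if "L \<in> P.points" for L using P.point[OF that] by blast
  have cjm: "cj (g \<otimes> h) L = cj g (cj h L)" if "L \<in> P.points" "g \<in> carrier G" "h \<in> carrier G" for g h L
    using cj_mult[OF PC[OF that(1)] that(2,3)] .
  \<comment> \<open>By \<open>t\<kappa>2\<close>, \<open>\<kappa>\<close> passes \<open>t0\<close>
    as its square, which fixes infinity; so it fixes the image K of infinity under \<open>t0\<close>
    and acts as 2 z.\<close>
  have \<kappa>K: "cj \<kappa> K = K"
  proof -
    have "cj \<kappa> K = cj (\<kappa> \<otimes> t0) R" unfolding K_def using cjm[OF RP \<kappa>c t0(4)] by simp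
    also have "\<dots> = cj t0 (cj (\<kappa> \<otimes> \<kappa>) R)" unfolding t\<kappa>2 using cjm[OF RP t0(4)] \<kappa>c by simp
    also have "cj (\<kappa> \<otimes> \<kappa>) R = R" using cjm[OF RP \<kappa>c \<kappa>c] \<kappa>R by simp
    finally show ?thesis by (simp add: K_def)
  qed
  have \<kappa>x: "cj \<kappa> (?x i) = ?x (2 * i)" for i by (rule P.normalizer_action[OF \<kappa>c \<kappa>(3) \<kappa>K])
  have ord7: "?x 8 = ?x 1" "?x 10 = ?x 3" "?x 12 = ?x 5" "?x 7 = ?x 0" "?x (Suc 6) = ?x 0"
    using P.pt_mod[of 8] P.pt_mod[of 10] P.pt_mod[of 12] P.pt_mod[of 7] by simp_all
  have \<kappa>x': "cj \<kappa> (?x 0) = ?x 0" "cj \<kappa> (?x 1) = ?x 2" "cj \<kappa> (?x 2) = ?x 4" "cj \<kappa> (?x 3) = ?x 6"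
    "cj \<kappa> (?x 4) = ?x 1" "cj \<kappa> (?x 5) = ?x 3" "cj \<kappa> (?x 6) = ?x 5"
    using \<kappa>x[of 0] \<kappa>x[of 1] \<kappa>x[of 2] \<kappa>x[of 3] \<kappa>x[of 4] \<kappa>x[of 5] \<kappa>x[of 6] ord7 by simp_all
  \<comment> \<open>The relation between t and \<open>\<kappa>\<close> reads t(2 z) = 4 t(z), so the
    image 6 of 1 determines those of 2 and 4; the images of 3, 5 and 6 follow as t is an involution.
    Hence t is - 1 / z.\<close>
  have good: "G \<cong> perm_group 8 {(!) [1, 2, 3, 4, 5, 6, 0, 7], (!) [0, 2, 4, 6, 1, 3, 5, 7], (!) [7, 6, 3, 2, 5, 4, 1, 0]}"
    if t: "t \<in> carrier G" "t \<noteq> \<one>" "t \<otimes> t = \<one>" "t \<otimes> \<kappa> = \<kappa> \<otimes> \<kappa> \<otimes> t" "cj t R = K" and x1: "cj t (?x 1) = ?x 6" for t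
  proof -
    have tt: "cj t (cj t L) = L" if "L \<in> P.points" for L
      using cjm[OF that t(1) t(1)] t(3) cj_one[OF PC[OF that]] by simp
    have t\<kappa>L: "cj t (cj \<kappa> L) = cj \<kappa> (cj \<kappa> (cj t L))" if L: "L \<in> P.points" for L
    proof -
      have "cj t (cj \<kappa> L) = cj (\<kappa> \<otimes> \<kappa> \<otimes> t) L" using cjm[OF L t(1) \<kappa>c] t(4) by simp
      also have "\<dots> = cj (\<kappa> \<otimes> \<kappa>) (cj t L)" using cjm[OF L _ t(1)] \<kappa>c by simp
      also have "\<dots> = cj \<kappa> (cj \<kappa> (cj t L))" using cjm[OF P.cj_point[OF t(1) L] \<kappa>c \<kappa>c] .
      finally show ?thesis .
    qed
    have tx: "cj t K = R" using tt[OF RP] t(5) by simp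
    have x2: "cj t (?x 2) = ?x 3" using t\<kappa>L[OF P.pt_point[of 1]] x1 \<kappa>x' by simp
    have x4: "cj t (?x 4) = ?x 5" using t\<kappa>L[OF P.pt_point[of 2]] x2 \<kappa>x' by simp
    have x6: "cj t (?x 6) = ?x 1" using tt[OF P.pt_point[of 1]] x1 by simp
    have x3: "cj t (?x 3) = ?x 2" using tt[OF P.pt_point[of 2]] x2 by simp
    have x5: "cj t (?x 5) = ?x 4" using tt[OF P.pt_point[of 4]] x4 by simp
    define f where "f y = (if y = \<rho> then (!) [1, 2, 3, 4, 5, 6, 0, 7] else if y = \<kappa> then (!) [0, 2, 4, 6, 1, 3, 5, 7] else (!) [7, 6, 3, 2, 5, 4, 1, 0::nat])" for y
    have n1: "\<rho> \<noteq> \<kappa>" using \<kappa>K P.cj_\<rho>[of 0] P.pt_inj[of 1 0] P.pt_0 by auto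
    have tR: "cj t R \<noteq> R" using t(5) K(2) by simp
    have n2: "t \<noteq> \<rho>" "t \<noteq> \<kappa>" using tR \<kappa>R P.cj_R[OF \<rho>(1)] by auto
    let ?S = "{\<rho>, \<kappa>, t}"
    have Sc: "?S \<subseteq> carrier G" using \<rho>c \<kappa>c t by blast
    have lab: "P.label 0 = ?x 0" "P.label 1 = ?x 1" "P.label (Suc 0) = ?x 1" "P.label 2 = ?x 2" "P.label 3 = ?x 3"
      "P.label 4 = ?x 4" "P.label 5 = ?x 5" "P.label 6 = ?x 6" "P.label 7 = R"
      by (simp_all add: P.label_def)
    have \<rho>x: "cj \<rho> (?x 0) = ?x 1" "cj \<rho> (?x 1) = ?x 2" "cj \<rho> (?x 2) = ?x 3" "cj \<rho> (?x 3) = ?x 4" "cj \<rho> (?x 4) = ?x 5"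
      "cj \<rho> (?x 5) = ?x 6" "cj \<rho> (?x 6) = ?x 0" "cj \<rho> R = R"
      using P.cj_\<rho>[of 0] P.cj_\<rho>[of 1] P.cj_\<rho>[of 2] P.cj_\<rho>[of 3] P.cj_\<rho>[of 4] P.cj_\<rho>[of 5] P.cj_\<rho>[of 6] ord7 P.cj_R[OF \<rho>(1)]
      by (simp_all add: numeral_eq_Suc)
    have "G \<cong> perm_group 8 (f ` ?S)"
    proof (rule iso_perm_group[where a = cj and lam = P.label and E = P.points])
      show "acts (carrier G) P.points cj" by (rule acts_conjugates[OF subgroup_self Rc])
      show "bij_betw P.label {..<8} P.points" using P.label_bij by simp
      show "?S \<subseteq> carrier G" by (rule Sc)
      \<comment> \<open>The generated subgroup has elements of order 7 and of order 2, which is the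
        situation of \<open>full\<close>.\<close>
      show "generate G ?S = carrier G"
      proof -
        let ?H = "generate G ?S"
        have H: "subgroup ?H G" by (rule generate_is_subgroup[OF Sc])
        have mem: "\<rho> \<in> ?H" "\<kappa> \<in> ?H" "t \<in> ?H" by (auto intro: generate.incl)
        have "R \<subseteq> ?H" using prime_gen[OF R(1,2) _ \<rho>] gen_subset[OF H mem(1)] by simp
        then have d7: "r dvd card ?H" using card_dvd[OF R(1) H] R(2) pqr by simp
        have t2: "t [^] (2::nat) = \<one>" using t by (simp add: numeral_2_eq_2)
        have "p dvd card ?H"
          using card_dvd[OF gen_subgroup[OF t(1)] H gen_subset[OF H mem(3)]]
            card_gen_prime[OF t(1,2) t2 two_is_prime_nat] pqr by simp
        then show ?thesis using full[OF H] d7 by blast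
      qed
      fix y i assume y: "y \<in> ?S" and i: "i < (8::nat)"
      show "f y i < 8 \<and> cj y (P.label i) = P.label (f y i)"
        using y nat_cases8[OF i] n1 n2 t(5) tx \<rho>x \<kappa>x' \<kappa>R x1 x2 x3 x4 x5 x6 P.pt_0
        by (elim insertE emptyE disjE) (simp_all add: f_def lab)
    next
      fix g assume g: "g \<in> carrier G" and fx: "\<And>L. L \<in> P.points \<Longrightarrow> cj g L = L"
      \<comment> \<open>The stabilizer of infinity and 0 has order at most 3, so it is Q, and only
        the identity of Q fixes the point 1.\<close>
      let ?I = "nrm R \<inter> nrm K"
      have gI: "g \<in> ?I" using fx[OF P.R_point] fx[OF K(1)] g by (simp add: nrm_def)
      have I: "subgroup ?I G" using subgroups_Inter_pair N subgroup_nrm[OF P.Kc] by blast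
      have "card ?I \<le> 3" using P.two_point_stabilizer R(3) by simp
      moreover have "\<kappa> \<in> ?I" using \<kappa>R \<kappa>K \<kappa>c by (simp add: nrm_def)
      then have "Q \<subseteq> ?I" unfolding Qgen using gen_subset[OF I] by blast
      ultimately have "Q = ?I" using finite_sub[OF I] Q(3) by (metis card_seteq)
      then have "g = \<one> \<or> g = \<kappa> \<or> g = \<kappa> \<otimes> \<kappa>" using gI Qel by blast
      moreover have "g \<noteq> \<kappa>" using fx[OF P.pt_point[of 1]] \<kappa>x'(2) P.pt_inj[of 1 2] by auto
      moreover have "g \<noteq> \<kappa> \<otimes> \<kappa>"
        using fx[OF P.pt_point[of 1]] cjm[OF P.pt_point[of 1] \<kappa>c \<kappa>c] \<kappa>x' P.pt_inj[of 1 4] by auto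
      ultimately show "g = \<one>" by blast
    qed
    moreover have "f ` ?S = {(!) [1, 2, 3, 4, 5, 6, 0, 7], (!) [0, 2, 4, 6, 1, 3, 5, 7], (!) [7, 6, 3, 2, 5, 4, 1, 0]}"
      using n1 n2 by (simp add: f_def insert_commute)
    ultimately show ?thesis by simp
  qed
  have t0R: "cj t0 R = K" by (simp add: K_def)
  have tt0: "cj t0 (cj t0 L) = L" if "L \<in> P.points" for L
    using cjm[OF that t0(4) t0(4)] t0(3) cj_one[OF PC[OF that]] by simp
  have t0K: "cj t0 K = R" using tt0[OF RP] by (simp add: K_def)
  have nofix: "cj t0 (?x i) \<noteq> ?x i" for i using no_inv[OF P.pt_point t0(4,2,3)] t0(4) by (simp add: nrm_def)
  have t\<kappa>L: "cj t0 (cj \<kappa> L) = cj \<kappa> (cj \<kappa> (cj t0 L))" if L: "L \<in> P.points" for L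
  proof -
    have "cj t0 (cj \<kappa> L) = cj (\<kappa> \<otimes> \<kappa> \<otimes> t0) L" using cjm[OF L t0(4) \<kappa>c] t\<kappa> by simp
    also have "\<dots> = cj (\<kappa> \<otimes> \<kappa>) (cj t0 L)" using cjm[OF L _ t0(4)] \<kappa>c by simp
    also have "\<dots> = cj \<kappa> (cj \<kappa> (cj t0 L))" using cjm[OF P.cj_point[OF t0(4) L] \<kappa>c \<kappa>c] .
    finally show ?thesis .
  qed
  obtain a where a: "a \<in> {1,2,3,4,5,6}" "cj t0 (?x 1) = ?x a"
  proof -
    have "cj t0 (?x 1) \<in> P.points" using P.cj_point[OF t0(4) P.pt_point] .
    then show thesis
    proof (cases rule: P.points_cases)
      case 1
      then have "?x 1 = K" using P.cj_inj[OF t0(4) P.pt_point K(1)] t0K by simp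
      then show ?thesis using P.pt_inj[of 1 0] P.pt_0 by auto
    next
      case (2 j)
      have "j \<noteq> 0"
      proof
        assume "j = 0"
        then have "cj t0 (?x 1) = cj t0 R" using 2 t0R P.pt_0 by simp
        then show False using P.cj_inj[OF t0(4) P.pt_point P.R_point] P.pt_ne_R by blast
      qed
      then show ?thesis using 2 nat_cases7[OF 2(1)] that by auto
    qed
  qed
  have x2: "cj t0 (?x 2) = cj \<kappa> (cj \<kappa> (?x a))" using t\<kappa>L[OF P.pt_point[of 1]] a(2) \<kappa>x' by simp
  have x4: "cj t0 (?x 4) = cj \<kappa> (cj \<kappa> (cj t0 (?x 2)))" using t\<kappa>L[OF P.pt_point[of 2]] \<kappa>x' by simp
  \<comment> \<open>\<open>t0\<close> maps 1, 2, 4 to a, 4 a, 2 a. For a = 1, 2, 4 this would fix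
    the point 1, 4, 2 respectively, against \<open>nofix\<close>.\<close>
  have a356: "a = 3 \<or> a = 5 \<or> a = 6"
    using a nofix[of 1] nofix[of 2] nofix[of 4] x2 x4 \<kappa>x' by auto
  \<comment> \<open>\<open>t0\<close> acts as a / z with a one of 3, 5, 6. Multiplying it by
    \<open>\<kappa>\<close> or its square multiplies a by 2 or 4; since 2 * 3 and 4 * 5 are both 6
    modulo 7, the map - 1 / z is reached in every case.\<close>
  have twist: "h \<otimes> t0 \<in> carrier G \<and> h \<otimes> t0 \<noteq> \<one> \<and> (h \<otimes> t0) \<otimes> (h \<otimes> t0) = \<one>
      \<and> (h \<otimes> t0) \<otimes> \<kappa> = \<kappa> \<otimes> \<kappa> \<otimes> (h \<otimes> t0) \<and> cj (h \<otimes> t0) R = K \<and> (\<forall>L\<in>P.points. cj (h \<otimes> t0) L = cj h (cj t0 L))"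
    if h: "h \<in> carrier G" "t0 \<otimes> h = inv h \<otimes> t0" "h \<otimes> \<kappa> = \<kappa> \<otimes> h" "cj h K = K" for h
  proof -
    have L: "\<forall>L\<in>P.points. cj (h \<otimes> t0) L = cj h (cj t0 L)" using cjm[OF _ h(1) t0(4)] by blast
    have R': "cj (h \<otimes> t0) R = K" using bspec[OF L RP] t0R h(4) by simp
    have 1: "h \<otimes> t0 \<noteq> \<one>"
    proof
      assume "h \<otimes> t0 = \<one>"
      then have "cj \<one> R = K" using R' by simp
      then show False using cj_one[OF Rc] K(2) by simp
    qed
    have "(h \<otimes> t0) \<otimes> (h \<otimes> t0) = h \<otimes> (t0 \<otimes> h) \<otimes> t0" using h(1) t0(4) by (simp add: m_assoc)
    also have "\<dots> = (h \<otimes> inv h) \<otimes> (t0 \<otimes> t0)" unfolding h(2) using h(1) t0(4) inv_closed[OF h(1)] by (metis m_assoc m_closed)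
    also have "\<dots> = \<one>" using h(1) t0(3) by simp
    finally have 2: "(h \<otimes> t0) \<otimes> (h \<otimes> t0) = \<one>" .
    have "(h \<otimes> t0) \<otimes> \<kappa> = h \<otimes> (\<kappa> \<otimes> \<kappa> \<otimes> t0)" using h(1) t0(4) \<kappa>c t\<kappa> by (simp add: m_assoc)
    also have "\<dots> = (h \<otimes> \<kappa>) \<otimes> \<kappa> \<otimes> t0" using h(1) t0(4) \<kappa>c by (simp add: m_assoc)
    also have "\<dots> = \<kappa> \<otimes> (h \<otimes> \<kappa>) \<otimes> t0" unfolding h(3) using h t0(4) \<kappa>c by (simp add: m_assoc)
    also have "\<dots> = \<kappa> \<otimes> \<kappa> \<otimes> (h \<otimes> t0)" unfolding h(3) using h(1) t0(4) \<kappa>c by (simp add: m_assoc)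
    finally have 3: "(h \<otimes> t0) \<otimes> \<kappa> = \<kappa> \<otimes> \<kappa> \<otimes> (h \<otimes> t0)" .
    show ?thesis using L R' 1 2 3 h(1) t0(4) by blast
  qed
  have i\<kappa>: "inv \<kappa> = \<kappa> \<otimes> \<kappa>" using \<kappa>\<kappa>\<kappa> \<kappa>c by (intro inv_equality) (simp_all add: m_assoc)
  have i\<kappa>2: "inv (\<kappa> \<otimes> \<kappa>) = \<kappa>" using \<kappa>\<kappa>\<kappa> \<kappa>c by (intro inv_equality) simp_all
  from a356 show ?thesis
  proof (elim disjE)
    assume a6: "a = 6"
    show ?thesis by (rule good[OF t0(4,2,3) t\<kappa> t0R]) (use a a6 in simp)
  next
    assume a3: "a = 3"
    have w: "t0 \<otimes> \<kappa> = inv \<kappa> \<otimes> t0" using t\<kappa> i\<kappa> by simp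
    note tw = twist[OF \<kappa>c w refl \<kappa>K]
    have "cj (\<kappa> \<otimes> t0) (?x 1) = cj \<kappa> (cj t0 (?x 1))" using tw P.pt_point by blast
    then have "cj (\<kappa> \<otimes> t0) (?x 1) = ?x 6" using a a3 \<kappa>x' by simp
    then show ?thesis using good tw by blast
  next
    assume a5: "a = 5"
    have c: "\<kappa> \<otimes> \<kappa> \<in> carrier G" using \<kappa>c by simp
    have w: "t0 \<otimes> (\<kappa> \<otimes> \<kappa>) = inv (\<kappa> \<otimes> \<kappa>) \<otimes> t0" using t\<kappa>2 i\<kappa>2 by simp
    have m: "\<kappa> \<otimes> \<kappa> \<otimes> \<kappa> = \<kappa> \<otimes> (\<kappa> \<otimes> \<kappa>)" using \<kappa>c by (simp add: m_assoc)
    have KK: "cj (\<kappa> \<otimes> \<kappa>) K = K" using cjm[OF K(1) \<kappa>c \<kappa>c] \<kappa>K by simp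
    note tw = twist[OF c w m KK]
    have "cj (\<kappa> \<otimes> \<kappa> \<otimes> t0) (?x 1) = cj (\<kappa> \<otimes> \<kappa>) (cj t0 (?x 1))" using tw P.pt_point by blast
    also have "\<dots> = cj \<kappa> (cj \<kappa> (?x 5))" using a a5 cjm[OF P.pt_point \<kappa>c \<kappa>c] by simp
    finally have "cj (\<kappa> \<otimes> \<kappa> \<otimes> t0) (?x 1) = ?x 6" using \<kappa>x' by simp
    then show ?thesis using good tw by blast
  qed
qed

end

section \<open>Transfer along isomorphisms of subgroup posets\<close>

lemma prime_power_of_unique_prime:
  fixes n s :: nat
  assumes "n > 0" "nprime s" "\<And>x. nprime x \<Longrightarrow> x dvd n \<Longrightarrow> x = s"
  obtains m where "n = s ^ m"
proof -
  obtain y where y: "n = s ^ multiplicity s n * y" "\<not> s dvd y"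
    using multiplicity_decompose'[of n s] assms prime_gt_1_nat[of s] by auto
  have "y = 1"
  proof (rule ccontr)
    assume "y \<noteq> 1"
    then obtain x where "nprime x" "x dvd y" using prime_factor_nat by blast
    then show False using y assms(3)[of x] by (metis dvd_mult)
  qed
  then show thesis using that[of "multiplicity s n"] y(1) by simp
qed

lemma three_prime_decomposition:
  fixes p q r :: nat
  assumes pr: "nprime p" "nprime q" "nprime r" "p \<noteq> q" "p \<noteq> r" "q \<noteq> r" and n: "n > 0"
    and only: "\<And>x. nprime x \<Longrightarrow> x dvd n \<Longrightarrow> x = p \<or> x = q \<or> x = r"
    and "p ^ i dvd n" "\<not> p ^ Suc i dvd n" "q ^ j dvd n" "\<not> q ^ Suc j dvd n" "r ^ k dvd n" "\<not> r ^ Suc k dvd n"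
  shows "n = p ^ i * q ^ j * r ^ k"
proof -
  have c: "coprime (p ^ i) (q ^ j)" "coprime (p ^ i * q ^ j) (r ^ k)" using pr by (auto simp: primes_coprime)
  have "p ^ i * q ^ j * r ^ k dvd n" using assms c by (auto intro!: divides_mult)
  then obtain m where m: "n = p ^ i * q ^ j * r ^ k * m" by blast
  have "m = 1"
  proof (rule ccontr)
    assume "m \<noteq> 1"
    then obtain x where x: "nprime x" "x dvd m" using prime_factor_nat by blast
    then have "x dvd n" using m by simp
    from only[OF x(1) this] show False
    proof (elim disjE)
      assume "x = p"
      then have "p ^ i * p dvd p ^ i * (q ^ j * r ^ k * m)" using x by (simp add: mult_dvd_mono)
      then show False using assms(10) m by (simp add: ac_simps)
    next
      assume "x = q"
      then have "q ^ j * q dvd q ^ j * (p ^ i * r ^ k * m)" using x by (simp add: mult_dvd_mono)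
      then show False using assms(12) m by (simp add: ac_simps)
    next
      assume "x = r"
      then have "r ^ k * r dvd r ^ k * (p ^ i * q ^ j * m)" using x by (simp add: mult_dvd_mono)
      then show False using assms(14) m by (simp add: ac_simps)
    qed
  qed
  then show ?thesis using m by simp
qed

lemma prime_power_not_dvd:
  fixes p q r :: nat
  assumes "nprime p" "nprime q" "nprime r" "p \<noteq> q" "p \<noteq> r"
  shows "\<not> p ^ Suc i dvd p ^ i * q ^ j * r ^ k"
proof
  assume "p ^ Suc i dvd p ^ i * q ^ j * r ^ k"
  then have "p ^ i * p dvd p ^ i * (q ^ j * r ^ k)" by (simp add: ac_simps)
  then have "p dvd q ^ j * r ^ k" using prime_gt_0_nat[OF assms(1)] by simp
  then have "p dvd q \<or> p dvd r" using assms by (auto simp: prime_dvd_mult_iff dest: prime_dvd_power)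
  then show False using assms by (auto dest: primes_dvd_imp_eq)
qed

text \<open>The order of \<open>iso_poset\<close> read on representatives, so that later arguments
  handle subgroups rather than classes. It is a preorder; in a finite group mutual embedding means
  isomorphism.\<close>

definition emb :: "('a, 'm) monoid_scheme \<Rightarrow> 'a set \<Rightarrow> 'a set \<Rightarrow> bool" where
  "emb G H K \<longleftrightarrow> (\<exists>L. subgroup L G \<and> L \<subseteq> K \<and> G\<lparr>carrier := L\<rparr> \<cong> G\<lparr>carrier := H\<rparr>)"

context group
begin

lemma sub_group: "subgroup H G \<Longrightarrow> group (G\<lparr>carrier := H\<rparr>)"
  by (rule subgroup_imp_group)

text \<open>M is the image of L under an isomorphism from H to K. In a comparison of classes this
  allows the larger group to be replaced by a chosen representative.\<close>

lemma iso_image_subgroup: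
  assumes H: "subgroup H G" and K: "subgroup K G" and L: "subgroup L G" "L \<subseteq> H"
    and iso: "G\<lparr>carrier := H\<rparr> \<cong> G\<lparr>carrier := K\<rparr>"
  obtains M where "subgroup M G" "M \<subseteq> K" "G\<lparr>carrier := M\<rparr> \<cong> G\<lparr>carrier := L\<rparr>"
proof -
  obtain h where h: "h \<in> iso (G\<lparr>carrier := H\<rparr>) (G\<lparr>carrier := K\<rparr>)" using iso by (auto simp: is_iso_def)
  then have hom: "h \<in> hom (G\<lparr>carrier := H\<rparr>) (G\<lparr>carrier := K\<rparr>)" and bij: "bij_betw h H K" by (auto simp: iso_def)
  interpret h: group_hom "G\<lparr>carrier := H\<rparr>" "G\<lparr>carrier := K\<rparr>" h
    using hom sub_group H K by (simp add: group_hom_def group_hom_axioms_def)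
  have "subgroup L (G\<lparr>carrier := H\<rparr>)" using subgroup_incl[OF L(1) H L(2)] .
  then have "subgroup (h ` L) (G\<lparr>carrier := K\<rparr>)" by (rule h.subgroup_img_is_subgroup)
  then have M: "subgroup (h ` L) G" by (rule incl_subgroup[OF K])
  have MK: "h ` L \<subseteq> K" using bij L(2) by (auto simp: bij_betw_def)
  have "h \<in> iso (G\<lparr>carrier := L\<rparr>) (G\<lparr>carrier := h ` L\<rparr>)"
    using hom bij L(2) by (auto simp: iso_def hom_def bij_betw_def inj_on_subset subset_iff)
  then have "G\<lparr>carrier := L\<rparr> \<cong> G\<lparr>carrier := h ` L\<rparr>" by (auto simp: is_iso_def)
  then have "G\<lparr>carrier := h ` L\<rparr> \<cong> G\<lparr>carrier := L\<rparr>" using group.iso_sym[OF sub_group[OF L(1)]] by blast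
  then show thesis using that M MK by blast
qed

lemma iso_class_self: "subgroup H G \<Longrightarrow> H \<in> iso_class G H"
  by (simp add: iso_class_def iso_refl)

lemma iso_class_le:
  assumes H: "subgroup H G" and K: "subgroup K G"
  shows "iso_class G H \<sqsubseteq>\<^bsub>iso_poset G\<^esub> iso_class G K \<longleftrightarrow> emb G H K"
proof
  assume "iso_class G H \<sqsubseteq>\<^bsub>iso_poset G\<^esub> iso_class G K"
  then obtain K1 K2 where k: "subgroup K1 G" "G\<lparr>carrier := K1\<rparr> \<cong> G\<lparr>carrier := H\<rparr>"
    "subgroup K2 G" "G\<lparr>carrier := K2\<rparr> \<cong> G\<lparr>carrier := K\<rparr>" "K1 \<subseteq> K2"
    by (auto simp: iso_poset_def iso_class_def)
  obtain M where "subgroup M G" "M \<subseteq> K" "G\<lparr>carrier := M\<rparr> \<cong> G\<lparr>carrier := K1\<rparr>"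
    using iso_image_subgroup[OF k(3) K k(1,5,4)] by blast
  then show "emb G H K" using k(2) iso_trans unfolding emb_def by blast
next
  assume "emb G H K"
  then obtain L where "L \<in> iso_class G H" "L \<subseteq> K" by (auto simp: emb_def iso_class_def)
  then show "iso_class G H \<sqsubseteq>\<^bsub>iso_poset G\<^esub> iso_class G K"
    using iso_class_self[OF K] by (auto simp: iso_poset_def)
qed

end

context fin_group
begin

lemma iso_card: "G\<lparr>carrier := H\<rparr> \<cong> G\<lparr>carrier := K\<rparr> \<Longrightarrow> card H = card K"
  using iso_same_card by fastforce

lemma emb_subset: "subgroup H G \<Longrightarrow> H \<subseteq> K \<Longrightarrow> emb G H K"
  unfolding emb_def using iso_refl by blast

lemma emb_card: "emb G H K \<Longrightarrow> subgroup K G \<Longrightarrow> card H dvd card K"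
  using card_dvd iso_card unfolding emb_def by metis

lemma emb_sym: "emb G H K \<Longrightarrow> subgroup H G \<Longrightarrow> subgroup K G \<Longrightarrow> card H = card K \<Longrightarrow> emb G K H"
proof -
  assume a: "emb G H K" "subgroup H G" "subgroup K G" "card H = card K"
  then obtain L where L: "subgroup L G" "L \<subseteq> K" "G\<lparr>carrier := L\<rparr> \<cong> G\<lparr>carrier := H\<rparr>" by (auto simp: emb_def)
  then have "L = K" using iso_card[OF L(3)] a(3,4) finite_sub by (metis card_subset_eq)
  then have "G\<lparr>carrier := H\<rparr> \<cong> G\<lparr>carrier := K\<rparr>"
    using group.iso_sym[OF sub_group[OF L(1)] L(3)] by simp
  then show ?thesis using a(2) unfolding emb_def by blast
qed

text \<open>Both groups are cyclic with generators h and k of order p, and sending h^n to k^n is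
  well defined because exponents matter only modulo p on both sides; \<open>f\<close> picks some
  exponent.\<close>

lemma prime_order_iso:
  assumes H: "subgroup H G" "card H = p" and K: "subgroup K G" "card K = p" and p: "nprime p"
  shows "G\<lparr>carrier := H\<rparr> \<cong> G\<lparr>carrier := K\<rparr>"
proof -
  have p1: "1 < p" using prime_gt_1_nat[OF p] .
  obtain h where h: "h \<in> H" "h \<noteq> \<one>" using nontrivial_elem[OF H(1)] H(2) p1 by blast
  obtain k where k: "k \<in> K" "k \<noteq> \<one>" using nontrivial_elem[OF K(1)] K(2) p1 by blast
  have hc: "h \<in> carrier G" and kc: "k \<in> carrier G"
    using subgroup.mem_carrier[OF H(1) h(1)] subgroup.mem_carrier[OF K(1) k(1)] by auto
  have oh: "ord h = p" using ord_prime[OF hc h(2) _ p] pow_card_eq_one[OF H(1) h(1)] H(2) by simp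
  have ok: "ord k = p" using ord_prime[OF kc k(2) _ p] pow_card_eq_one[OF K(1) k(1)] K(2) by simp
  have Hel: "\<exists>n::nat. x = h [^] n" if "x \<in> H" for x
    using gen_elems[OF hc] prime_gen[OF H p h] that by metis
  have Kel: "\<exists>n::nat. x = k [^] n" if "x \<in> K" for x
    using gen_elems[OF kc] prime_gen[OF K p k] that by metis
  define f where "f x = k [^] (SOME n::nat. x = h [^] n)" for x
  have f: "f (h [^] n) = k [^] n" for n :: nat
  proof -
    have "h [^] n = h [^] (SOME m. h [^] n = h [^] (m::nat))" by (rule someI_ex) blast
    then show ?thesis unfolding f_def using pow_eq_iff[OF hc] pow_eq_iff[OF kc] oh ok cong_sym by metis
  qed
  have hH: "h [^] (n::nat) \<in> H" for n by (rule subgroup_nat_pow_closed[OF H(1) h(1)])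
  have kK: "k [^] (n::nat) \<in> K" for n by (rule subgroup_nat_pow_closed[OF K(1) k(1)])
  have img: "f ` H = K"
  proof
    show "f ` H \<subseteq> K" using Hel f kK by force
    show "K \<subseteq> f ` H"
    proof
      fix x assume "x \<in> K"
      then obtain n :: nat where "x = k [^] n" using Kel by blast
      then show "x \<in> f ` H" using f[of n] hH[of n] by (metis imageI)
    qed
  qed
  have "inj_on f H" using img H K finite_sub[OF H(1)] by (intro eq_card_imp_inj_on) auto
  moreover have "f (x \<otimes> y) = f x \<otimes> f y" if xy: "x \<in> H" "y \<in> H" for x y
  proof -
    obtain m n :: nat where "x = h [^] m" "y = h [^] n" using Hel[OF xy(1)] Hel[OF xy(2)] by blast
    then show ?thesis using hc kc f by (simp add: nat_pow_mult)
  qed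
  ultimately have "f \<in> iso (G\<lparr>carrier := H\<rparr>) (G\<lparr>carrier := K\<rparr>)"
    using img by (auto simp: iso_def hom_def bij_betw_def)
  then show ?thesis by (auto simp: is_iso_def)
qed

lemma prime_order_emb:
  assumes "subgroup H G" "nprime (card H)" "subgroup K G" "card H dvd card K"
  shows "emb G H K"
proof -
  obtain L where L: "subgroup L G" "L \<subseteq> K" "card L = card H" using cauchy_sub[OF assms(3,2,4)] by blast
  then have "G\<lparr>carrier := L\<rparr> \<cong> G\<lparr>carrier := H\<rparr>" using prime_order_iso[OF L(1) _ assms(1)] assms(2) by simp
  then show ?thesis unfolding emb_def using L by blast
qed

lemma one_emb: "subgroup H G \<Longrightarrow> card H = 1 \<Longrightarrow> subgroup K G \<Longrightarrow> emb G H K"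
  by (metis card_1_singletonE emb_subset empty_subsetI insert_subset singletonD subgroup.one_closed)

text \<open>An order-theoretic description: by Cauchy, the groups of prime order are exactly the
  minimal ones above the trivial class. Equality of classes is expressed by the reverse
  embedding.\<close>

lemma prime_card_iff:
  assumes H: "subgroup H G"
  shows "nprime (card H) \<longleftrightarrow> card H \<noteq> 1 \<and> (\<forall>K. subgroup K G \<and> emb G K H \<longrightarrow> card K = 1 \<or> emb G H K)"
proof
  assume p: "nprime (card H)"
  have "card K = 1 \<or> emb G H K" if K: "subgroup K G" "emb G K H" for K
  proof -
    have "card K = 1 \<or> card K = card H" using emb_card[OF K(2) H] p prime_nat_iff by blast
    then show ?thesis using emb_sym[OF K(2) K(1) H] by blast
  qed
  moreover have "card H \<noteq> 1" using p by auto
  ultimately show "card H \<noteq> 1 \<and> (\<forall>K. subgroup K G \<and> emb G K H \<longrightarrow> card K = 1 \<or> emb G H K)" by blast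
next
  assume a: "card H \<noteq> 1 \<and> (\<forall>K. subgroup K G \<and> emb G K H \<longrightarrow> card K = 1 \<or> emb G H K)"
  then obtain x where x: "nprime x" "x dvd card H" using prime_factor_nat by blast
  obtain K where K: "subgroup K G" "K \<subseteq> H" "card K = x" using cauchy_sub[OF H x] by blast
  then have "emb G H K" using a emb_subset[OF K(1,2)] x(1) by (metis not_prime_1)
  then have "card H dvd x" using emb_card K by metis
  then have "card H = x" using x a prime_nat_iff by auto
  then show "nprime (card H)" using x by simp
qed

end

text \<open>C K L expresses that an isomorphism of the posets sends the class of K to the class of L.\<close>

locale subgroup_corr = G: fin_group G + H: fin_group H
  for G :: "('a, 'm) monoid_scheme" and H :: "('b, 'n) monoid_scheme" +
  fixes C :: "'a set \<Rightarrow> 'b set \<Rightarrow> bool"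
  assumes C_sub: "C K L \<Longrightarrow> subgroup K G" "C K L \<Longrightarrow> subgroup L H"
    and C_left: "subgroup K G \<Longrightarrow> \<exists>L. C K L"
    and C_right: "subgroup L H \<Longrightarrow> \<exists>K. C K L"
    and C_emb: "C K L \<Longrightarrow> C K' L' \<Longrightarrow> emb G K K' \<longleftrightarrow> emb H L L'"
begin

text \<open>The correspondence is symmetric, so equivalences are obtained by proving one implication
  and applying it to the converse.\<close>

lemma converse_corr: "subgroup_corr H G (\<lambda>L K. C K L)"
  by (intro subgroup_corr.intro G.fin_group_axioms H.fin_group_axioms subgroup_corr_axioms.intro)
    (use C_sub C_left C_right C_emb in blast)+

text \<open>The trivial class is least: K embeds in the partner of the trivial subgroup of H, so L
  embeds in that trivial subgroup.\<close>

lemma card_one: "C K L \<Longrightarrow> card K = 1 \<Longrightarrow> card L = 1"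
proof -
  assume c: "C K L" "card K = 1"
  obtain K1 where K1: "C K1 {\<one>\<^bsub>H\<^esub>}" using C_right[OF H.triv_subgroup] by blast
  have "emb G K K1" using G.one_emb c C_sub K1 by blast
  then have "emb H L {\<one>\<^bsub>H\<^esub>}" using C_emb[OF c(1) K1] by blast
  then show "card L = 1" using H.emb_card[OF _ H.triv_subgroup, of L] by simp
qed

lemma card_one_iff: "C K L \<Longrightarrow> card K = 1 \<longleftrightarrow> card L = 1"
  using card_one subgroup_corr.card_one[OF converse_corr] by blast

lemma prime_iff: assumes "C K L" shows "nprime (card K) \<longleftrightarrow> nprime (card L)"
proof -
  have "(\<forall>K'. subgroup K' G \<and> emb G K' K \<longrightarrow> card K' = 1 \<or> emb G K K') \<longleftrightarrow>
    (\<forall>L'. subgroup L' H \<and> emb H L' L \<longrightarrow> card L' = 1 \<or> emb H L L')" (is "?l \<longleftrightarrow> ?r")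
  proof
    assume l: ?l
    show ?r
    proof clarify
      fix L' assume L': "subgroup L' H" "emb H L' L" "\<not> emb H L L'"
      obtain K' where K': "C K' L'" using C_right L'(1) by blast
      then show "card L' = 1" using l L' C_emb[OF K' assms] C_emb[OF assms K'] C_sub[OF K'] card_one_iff by blast
    qed
  next
    assume r: ?r
    show ?l
    proof clarify
      fix K' assume K': "subgroup K' G" "emb G K' K" "\<not> emb G K K'"
      obtain L' where L': "C K' L'" using C_left K'(1) by blast
      then show "card K' = 1" using r K' C_emb[OF L' assms] C_emb[OF assms L'] C_sub[OF L'] card_one_iff by blast
    qed
  qed
  then show ?thesis
    using G.prime_card_iff[OF C_sub(1)[OF assms]] H.prime_card_iff[OF C_sub(2)[OF assms]] card_one_iff[OF assms] by simp
qed

text \<open>prel p s: the primes p and s correspond to each other under the poset isomorphism.\<close>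

definition prel :: "nat \<Rightarrow> nat \<Rightarrow> bool" where
  "prel p s \<longleftrightarrow> nprime p \<and> (\<exists>K L. C K L \<and> card K = p \<and> card L = s)"

lemma prel_prime: "prel p s \<Longrightarrow> nprime p \<and> nprime s"
  using prime_iff unfolding prel_def by blast

lemma prel_converse: "prel p s \<longleftrightarrow> subgroup_corr.prel (\<lambda>L K. C K L) s p"
  using prime_iff unfolding prel_def subgroup_corr.prel_def[OF converse_corr] by blast

text \<open>Subgroups of the same prime order are isomorphic, so p determines one class and hence
  one partner class.\<close>

lemma prel_unique: assumes "prel p s" "prel p s'" shows "s = s'"
proof -
  obtain K L K' L' where c: "C K L" "C K' L'" "card K = p" "card K' = p" "card L = s" "card L' = s'"
    using assms unfolding prel_def by blast
  have p: "nprime p" using assms prel_def by blast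
  have "emb G K K'" "emb G K' K"
    using G.prime_order_emb[of K K'] G.prime_order_emb[of K' K] c p C_sub by auto
  then have "emb H L L'" "emb H L' L" using C_emb c by blast+
  then show ?thesis using H.emb_card c C_sub by (metis dvd_antisym)
qed

lemma prel_ex: assumes "C K L" "nprime p" "p dvd card K" shows "\<exists>s. prel p s \<and> s dvd card L"
proof -
  obtain P where P: "subgroup P G" "P \<subseteq> K" "card P = p" using G.cauchy_sub[OF C_sub(1)[OF assms(1)] assms(2,3)] by blast
  obtain Q where Q: "C P Q" using C_left P(1) by blast
  have "emb H Q L" using C_emb[OF Q assms(1)] G.emb_subset[OF P(1,2)] by blast
  then have "card Q dvd card L" using H.emb_card C_sub(2)[OF assms(1)] by blast
  then show ?thesis unfolding prel_def using Q P assms(2) by blast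
qed

lemma prel_dvd: "C K L \<Longrightarrow> prel p s \<Longrightarrow> p dvd card K \<Longrightarrow> s dvd card L"
  using prel_ex[of K L p] prel_unique[of p s] prel_prime by blast

lemma prel_dvd_iff: assumes "C K L" "prel p s" shows "p dvd card K \<longleftrightarrow> s dvd card L"
  using prel_dvd[OF assms] subgroup_corr.prel_dvd[OF converse_corr assms(1)] assms(2) prel_converse by blast

lemma prel_inj: assumes "prel p s" "prel p' s" shows "p = p'"
  using subgroup_corr.prel_unique[OF converse_corr, of s p p'] assms prel_converse by blast

text \<open>Each prime divisor of the order of L comes from one of K, so that order is a power of s.
  Its exponent grows with n, because a subgroup A of order p^n in a group K of order p^(n+1) lies
  strictly below, and so does its partner. Only this inequality is needed: the converse
  correspondence supplies the other one.\<close>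

lemma prime_power_card:
  assumes ps: "prel p s"
  shows "C K L \<Longrightarrow> card K = p ^ n \<Longrightarrow> \<exists>m\<ge>n. card L = s ^ m"
proof (induction n arbitrary: K L)
  have power: "\<exists>m. card L = s ^ m" if c: "C K L" "card K = p ^ n" for K L n
  proof -
    have "x = s" if x: "nprime x" "x dvd card L" for x
    proof -
      obtain y where y: "subgroup_corr.prel (\<lambda>L K. C K L) x y" "y dvd card K"
        using subgroup_corr.prel_ex[OF converse_corr c(1) x] by blast
      have yx: "prel y x" using y(1) prel_converse by blast
      then have "y = p" using y(2) c(2) prel_prime ps by (metis primes_dvd_imp_eq prime_dvd_power)
      then show ?thesis using yx ps prel_unique by blast
    qed
    moreover have "card L > 0" using H.card_sub_pos C_sub c by blast
    ultimately show ?thesis using prime_power_of_unique_prime[of "card L" s] prel_prime[OF ps] by metis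
  qed
  {
    case 0
    then show ?case using power by blast
  next
    case (Suc n)
    have p: "nprime p" using prel_prime ps by blast
    have K: "subgroup K G" and L: "subgroup L H" using C_sub Suc.prems(1) by auto
    obtain A where A: "subgroup A G" "A \<subseteq> K" "card A = p ^ n"
      using G.sylow_exists[OF K p, of n] Suc.prems(2) by auto
    obtain B where B: "C A B" using C_left A(1) by blast
    obtain a where a: "a \<ge> n" "card B = s ^ a" using Suc.IH[OF B A(3)] by blast
    obtain m where m: "card L = s ^ m" using power[OF Suc.prems] by blast
    have eBL: "emb H B L" using C_emb[OF B Suc.prems(1)] G.emb_subset[OF A(1,2)] by blast
    then have d: "s ^ a dvd s ^ m" using H.emb_card[OF _ L] a m by metis
    have "\<not> emb G K A"
    proof
      assume "emb G K A"
      then have "p ^ Suc n dvd p ^ n" using G.emb_card[OF _ A(1)] A(3) Suc.prems(2) by metis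
      then show False using dvd_imp_le[of "p ^ Suc n" "p ^ n"] prime_gt_1_nat[OF p] by simp
    qed
    then have "\<not> emb H L B" using C_emb[OF Suc.prems(1) B] by blast
    then have "card B \<noteq> card L" using H.emb_sym[OF eBL C_sub(2)[OF B] L] by blast
    then have "a \<noteq> m" using a m by auto
    moreover have "a \<le> m" using d prel_prime[OF ps] prime_gt_1_nat[of s] by (simp add: power_dvd_imp_le)
    ultimately show ?case using a m by (intro exI[of _ m]) simp
  }
qed

lemma prel_power_dvd: assumes "C K L" "prel p s" "p ^ n dvd card K" shows "s ^ n dvd card L"
proof -
  have p: "nprime p" using prel_prime assms by blast
  obtain A where A: "subgroup A G" "A \<subseteq> K" "card A = p ^ n"
    using G.sylow_exists[OF C_sub(1)[OF assms(1)] p assms(3)] by blast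
  obtain B where B: "C A B" using C_left A(1) by blast
  obtain m where m: "m \<ge> n" "card B = s ^ m" using prime_power_card[OF assms(2) B A(3)] by blast
  have "emb H B L" using C_emb[OF B assms(1)] G.emb_subset[OF A(1,2)] by blast
  then have "s ^ m dvd card L" using H.emb_card[OF _ C_sub(2)[OF assms(1)]] m by metis
  then show ?thesis using m(1) by (metis dvd_trans le_imp_power_dvd)
qed

lemma prel_power_iff: assumes "C K L" "prel p s" shows "p ^ n dvd card K \<longleftrightarrow> s ^ n dvd card L"
  using prel_power_dvd[OF assms] subgroup_corr.prel_power_dvd[OF converse_corr assms(1)] assms(2) prel_converse by blast

text \<open>\<open>prel_power_iff\<close> matches the exact exponent of each prime on both sides,
  and \<open>prel_ex\<close> shows that no further prime divides the order of K.\<close>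

lemma card_transfer:
  assumes c: "C K L" and pr: "prel p1 s1" "prel p2 s2" "prel p3 s3" and ne: "s1 \<noteq> s2" "s1 \<noteq> s3" "s2 \<noteq> s3"
    and card_L: "card L = s1 ^ i * s2 ^ j * s3 ^ k"
  shows "card K = p1 ^ i * p2 ^ j * p3 ^ k"
proof (rule three_prime_decomposition)
  have p: "nprime p1" "nprime p2" "nprime p3" "nprime s1" "nprime s2" "nprime s3" using prel_prime pr by auto
  show "nprime p1" "nprime p2" "nprime p3" by fact+
  show "p1 \<noteq> p2" "p1 \<noteq> p3" "p2 \<noteq> p3" using prel_unique pr ne by blast+
  show "card K > 0" using G.card_sub_pos C_sub c by blast
  show "x = p1 \<or> x = p2 \<or> x = p3" if x: "nprime x" "x dvd card K" for x
  proof -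
    obtain s where s: "prel x s" "s dvd card L" using prel_ex[OF c x] by blast
    then have "nprime s" using prel_prime by blast
    then have "s dvd s1 \<or> s dvd s2 \<or> s dvd s3"
      using s(2) card_L by (auto simp: prime_dvd_mult_iff dest: prime_dvd_power)
    then have "s = s1 \<or> s = s2 \<or> s = s3" using p \<open>nprime s\<close> by (auto dest: primes_dvd_imp_eq)
    then show ?thesis using prel_inj s(1) pr by blast
  qed
  show "p1 ^ i dvd card K" "p2 ^ j dvd card K" "p3 ^ k dvd card K"
    using prel_power_iff[OF c] pr card_L by auto
  have "\<not> s1 ^ Suc i dvd card L" using prime_power_not_dvd[OF p(4,5,6) ne(1,2)] card_L by simp
  then show "\<not> p1 ^ Suc i dvd card K" using prel_power_iff[OF c pr(1)] by blast
  have "\<not> s2 ^ Suc j dvd s2 ^ j * s1 ^ i * s3 ^ k" using prime_power_not_dvd[OF p(5,4,6)] ne by blast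
  then have "\<not> s2 ^ Suc j dvd card L" using card_L by (metis mult.commute)
  then show "\<not> p2 ^ Suc j dvd card K" using prel_power_iff[OF c pr(2)] by blast
  have "\<not> s3 ^ Suc k dvd s3 ^ k * s1 ^ i * s2 ^ j" using prime_power_not_dvd[OF p(6,4,5)] ne by blast
  then have "\<not> s3 ^ Suc k dvd card L" using card_L by (metis mult.assoc mult.commute)
  then show "\<not> p3 ^ Suc k dvd card K" using prel_power_iff[OF c pr(3)] by blast
qed

text \<open>The partner K of all of H embeds in G, so H embeds in the partner L of G, and comparing
  orders gives L = H.\<close>

lemma carrier_corr: "C (carrier G) (carrier H)"
proof -
  obtain L where L: "C (carrier G) L" using C_left G.subgroup_self by blast
  obtain K where K: "C K (carrier H)" using C_right H.subgroup_self by blast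
  have "emb G K (carrier G)" using G.emb_subset C_sub(1)[OF K] subgroup.subset by blast
  then have "emb H (carrier H) L" using C_emb[OF K L] by blast
  then have "card (carrier H) dvd card L" using H.emb_card C_sub(2)[OF L] by blast
  then have "card (carrier H) \<le> card L" using dvd_imp_le H.card_sub_pos C_sub(2)[OF L] by blast
  then have "L = carrier H" using subgroup.subset[OF C_sub(2)[OF L]] H.fin by (metis card_seteq)
  then show ?thesis using L by simp
qed

lemma prel_right: assumes "nprime s" "s dvd order H" shows "\<exists>p. prel p s"
  using subgroup_corr.prel_ex[OF converse_corr carrier_corr assms(1)] assms(2) prel_converse
  by (auto simp: order_def)

end

lemma poset_isomorphic_corr:
  assumes "group G" "finite (carrier G)" "group H" "finite (carrier H)"
    and iso: "poset_isomorphic (iso_poset G) (iso_poset H)"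
  shows "\<exists>C. subgroup_corr G H C"
proof -
  interpret G: fin_group G using assms by (simp add: fin_group_def fin_group_axioms_def)
  interpret H: fin_group H using assms by (simp add: fin_group_def fin_group_axioms_def)
  obtain f where f: "bij_betw f (carrier (iso_poset G)) (carrier (iso_poset H))"
    and le: "\<forall>x\<in>carrier (iso_poset G). \<forall>y\<in>carrier (iso_poset G). x \<sqsubseteq>\<^bsub>iso_poset G\<^esub> y \<longleftrightarrow> f x \<sqsubseteq>\<^bsub>iso_poset H\<^esub> f y"
    using iso unfolding poset_isomorphic_def by blast
  have cG: "carrier (iso_poset G) = {iso_class G K |K. subgroup K G}" and
    cH: "carrier (iso_poset H) = {iso_class H K |K. subgroup K H}" by (simp_all add: iso_poset_def)
  have "subgroup_corr G H (\<lambda>K L. subgroup K G \<and> subgroup L H \<and> f (iso_class G K) = iso_class H L)"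
  proof (intro subgroup_corr.intro G.fin_group_axioms H.fin_group_axioms subgroup_corr_axioms.intro)
    fix K assume K: "subgroup K G"
    then have "f (iso_class G K) \<in> carrier (iso_poset H)" using bij_betwE[OF f] cG by blast
    then show "\<exists>L. subgroup K G \<and> subgroup L H \<and> f (iso_class G K) = iso_class H L" using cH K by blast
  next
    fix L assume L: "subgroup L H"
    then have "iso_class H L \<in> f ` carrier (iso_poset G)" using bij_betw_imp_surj_on[OF f] cH by blast
    then show "\<exists>K. subgroup K G \<and> subgroup L H \<and> f (iso_class G K) = iso_class H L" using cG L by auto
  next
    fix K L K' L'
    assume 1: "subgroup K G \<and> subgroup L H \<and> f (iso_class G K) = iso_class H L"
      and 2: "subgroup K' G \<and> subgroup L' H \<and> f (iso_class G K') = iso_class H L'"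
    have "iso_class G K \<in> carrier (iso_poset G)" "iso_class G K' \<in> carrier (iso_poset G)" using cG 1 2 by auto
    then show "emb G K K' \<longleftrightarrow> emb H L L'"
      using le 1 2 G.iso_class_le[of K K'] H.iso_class_le[of L L'] by metis
  qed blast+
  then show ?thesis by blast
qed

text \<open>Orders are excluded in G by moving a subgroup to H with \<open>to_H\<close>; subgroups
  are found in G by moving one back from H with \<open>to_G\<close>.\<close>

lemma case60_transfer:
  assumes "subgroup_corr G H C" "case60 H s1 s2 s3"
  shows "\<exists>p q r. case60 G p q r"
proof -
  interpret subgroup_corr G H C by fact
  interpret H: case60 H s1 s2 s3 by fact
  have "s1 dvd order H" "s2 dvd order H" "s3 dvd order H" using H.ord by auto
  then obtain p q r where pr: "prel p s1" "prel q s2" "prel r s3" using prel_right H.p H.q H.r by metis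
  interpret S: subgroup_corr H G "\<lambda>L K. C K L" by (rule converse_corr)
  have pr': "S.prel s1 p" "S.prel s2 q" "S.prel s3 r" using pr prel_converse by auto
  have primes: "nprime p" "nprime q" "nprime r" using pr prel_prime by auto
  have ne: "p \<noteq> q" "p \<noteq> r" "q \<noteq> r" using prel_unique pr H.ne by blast+
  note to_G = card_transfer[OF _ pr H.ne] and to_H = S.card_transfer[OF _ pr' ne]
  have "case60 G p q r"
  proof (intro case60.intro G.fin_group_axioms case60_axioms.intro primes ne)
    show "order G = p\<^sup>2 * q * r"
      using to_G[OF carrier_corr, of 2 1 1] H.ord by (simp add: order_def)
    show "card K \<noteq> q * r" if K: "subgroup K G" for K
    proof
      assume k: "card K = q * r"
      obtain L where L: "C K L" using C_left[OF K] by blast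
      then show False using to_H[OF L, of 0 1 1] k H.no_qr[OF C_sub(2)[OF L]] by simp
    qed
    show "card K \<noteq> p\<^sup>2 * r" if K: "subgroup K G" for K
    proof
      assume k: "card K = p\<^sup>2 * r"
      obtain L where L: "C K L" using C_left[OF K] by blast
      then show False using to_H[OF L, of 2 0 1] k H.no_ppr[OF C_sub(2)[OF L]] by simp
    qed
    show "card K \<noteq> p * q" if K: "subgroup T G" "subgroup K G" "card T = p\<^sup>2 * q" "K \<subseteq> T" for T K
    proof
      assume k: "card K = p * q"
      obtain L where L: "C K L" using C_left[OF K(2)] by blast
      obtain M where M: "C T M" using C_left[OF K(1)] by blast
      have cL: "card L = s1 * s2" using to_H[OF L, of 1 1 0] k by simp
      have cM: "card M = s1\<^sup>2 * s2" using to_H[OF M, of 2 1 0] K by simp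
      \<comment> \<open>The poset sees inclusion only up to isomorphism: the partner L of K may lie
        outside the partner M of T, so an isomorphic copy N inside M is used.\<close>
      have "emb H L M" using C_emb[OF L M] G.emb_subset[OF K(2,4)] by blast
      then obtain N where N: "subgroup N H" "N \<subseteq> M" "H\<lparr>carrier := N\<rparr> \<cong> H\<lparr>carrier := L\<rparr>" unfolding emb_def by blast
      show False using H.no_sub[OF C_sub(2)[OF M] N(1) cM N(2)] H.iso_card[OF N(3)] cL by simp
    qed
    obtain T0 where T0: "subgroup T0 H" "card T0 = s1\<^sup>2 * s2" using H.ex_T by blast
    obtain T where T: "C T T0" using C_right[OF T0(1)] by blast
    show "\<exists>T. subgroup T G \<and> card T = p\<^sup>2 * q" using to_G[OF T, of 2 1 0] T0(2) C_sub(1)[OF T] by auto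
    obtain D0 where D0: "subgroup D0 H" "card D0 = s1 * s3" using H.ex_D by blast
    obtain D where D: "C D D0" using C_right[OF D0(1)] by blast
    show "\<exists>D. subgroup D G \<and> card D = p * r" using to_G[OF D, of 1 0 1] D0(2) C_sub(1)[OF D] by auto
  qed
  then show ?thesis by blast
qed

lemma case168_transfer:
  assumes "subgroup_corr G H C" "case168 H s1 s2 s3"
  shows "\<exists>p q r. case168 G p q r"
proof -
  interpret subgroup_corr G H C by fact
  interpret H: case168 H s1 s2 s3 by fact
  have "s1 dvd order H" "s2 dvd order H" "s3 dvd order H" using H.ord by auto
  then obtain p q r where pr: "prel p s1" "prel q s2" "prel r s3" using prel_right H.p H.q H.r by metis
  interpret S: subgroup_corr H G "\<lambda>L K. C K L" by (rule converse_corr)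
  have pr': "S.prel s1 p" "S.prel s2 q" "S.prel s3 r" using pr prel_converse by auto
  have primes: "nprime p" "nprime q" "nprime r" using pr prel_prime by auto
  have ne: "p \<noteq> q" "p \<noteq> r" "q \<noteq> r" using prel_unique pr H.ne by blast+
  note to_G = card_transfer[OF _ pr H.ne] and to_H = S.card_transfer[OF _ pr' ne]
  have ordG: "order G = p ^ 3 * q * r"
    using to_G[OF carrier_corr, of 3 1 1] H.ord by (simp add: order_def)
  have "case168 G p q r"
  proof (intro case168.intro G.fin_group_axioms case168_axioms.intro primes ne ordG)
    show "K = carrier G" if K: "subgroup K G" "p dvd card K" "r dvd card K" for K
    proof -
      obtain L where L: "C K L" using C_left[OF K(1)] by blast
      have "s1 dvd card L" "s3 dvd card L" using prel_dvd_iff[OF L] pr K by auto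
      then have "L = carrier H" using H.full[OF C_sub(2)[OF L]] by blast
      then have "card K = order G" using to_G[OF L, of 3 1 1] H.ord ordG by (simp add: order_def)
      then show ?thesis using subgroup.subset[OF K(1)] G.fin by (metis card_subset_eq order_def)
    qed
    show "card K \<noteq> p * q" if K: "subgroup T G" "subgroup K G" "card T = p\<^sup>2 * q" "K \<subseteq> T" for T K
    proof
      assume k: "card K = p * q"
      obtain L where L: "C K L" using C_left[OF K(2)] by blast
      obtain M where M: "C T M" using C_left[OF K(1)] by blast
      have cL: "card L = s1 * s2" using to_H[OF L, of 1 1 0] k by simp
      have cM: "card M = s1\<^sup>2 * s2" using to_H[OF M, of 2 1 0] K by simp
      have "emb H L M" using C_emb[OF L M] G.emb_subset[OF K(2,4)] by blast
      then obtain N where N: "subgroup N H" "N \<subseteq> M" "H\<lparr>carrier := N\<rparr> \<cong> H\<lparr>carrier := L\<rparr>" unfolding emb_def by blast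
      show False using H.no_sub[OF C_sub(2)[OF M] N(1) cM N(2)] H.iso_card[OF N(3)] cL by simp
    qed
    obtain T0 where T0: "subgroup T0 H" "card T0 = s1\<^sup>2 * s2" using H.ex_T by blast
    obtain T where T: "C T T0" using C_right[OF T0(1)] by blast
    show "\<exists>T. subgroup T G \<and> card T = p\<^sup>2 * q" using to_G[OF T, of 2 1 0] T0(2) C_sub(1)[OF T] by auto
    obtain W0 where W0: "subgroup W0 H" "card W0 = s2 * s3" using H.ex_W by blast
    obtain W where W: "C W W0" using C_right[OF W0(1)] by blast
    show "\<exists>W. subgroup W G \<and> card W = q * r" using to_G[OF W, of 0 1 1] W0(2) C_sub(1)[OF W] by auto
    obtain S0 U0 where SU0: "subgroup S0 H" "subgroup U0 H" "S0 \<subseteq> U0" "card S0 = s1 * s2" "card U0 = s1 ^ 3 * s2"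
      using H.ex_SU by blast
    obtain S' where S': "C S' S0" using C_right[OF SU0(1)] by blast
    obtain U where U: "C U U0" using C_right[OF SU0(2)] by blast
    \<comment> \<open>Here too S' may lie outside U, and a copy N of it inside U takes its
      place.\<close>
    have "emb G S' U" using C_emb[OF S' U] H.emb_subset[OF SU0(1,3)] by blast
    then obtain N where N: "subgroup N G" "N \<subseteq> U" "G\<lparr>carrier := N\<rparr> \<cong> G\<lparr>carrier := S'\<rparr>" unfolding emb_def by blast
    have "card N = p * q" using G.iso_card[OF N(3)] to_G[OF S', of 1 1 0] SU0 by simp
    moreover have "card U = p ^ 3 * q" using to_G[OF U, of 3 1 0] SU0 by simp
    ultimately show "\<exists>S U. subgroup S G \<and> subgroup U G \<and> S \<subseteq> U \<and> card S = p * q \<and> card U = p ^ 3 * q"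
      using N C_sub(1)[OF U] by blast
  qed
  then show ?thesis by blast
qed

section \<open>Projective special linear groups over prime fields\<close>

locale sl2_prime =
  fixes m :: int
  assumes prime_m: "Factorial_Ring.prime m" and m2: "m > 2"
begin

text \<open>Representing matrices by arbitrary integers makes products in SL2 integer polynomials.\<close>

definition mk :: "int \<Rightarrow> int \<Rightarrow> int \<Rightarrow> int \<Rightarrow> int \<times> int \<times> int \<times> int" where
  "mk a b c d = (a mod m, b mod m, c mod m, d mod m)"

abbreviation S :: "(int \<times> int \<times> int \<times> int) monoid" where "S \<equiv> SL2 (residue_ring m)"

lemma carrier_S: "(a, b, c, d) \<in> carrier S \<longleftrightarrow>
    0 \<le> a \<and> a < m \<and> 0 \<le> b \<and> b < m \<and> 0 \<le> c \<and> c < m \<and> 0 \<le> d \<and> d < m \<and> (a * d - b * c) mod m = 1"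
proof -
  have r: "residues m" using m2 by (simp add: residues_def)
  have n: "\<ominus>\<^bsub>residue_ring m\<^esub> x = (- x) mod m" for x using residues.res_neg_eq[OF r] by simp
  have "x \<ominus>\<^bsub>residue_ring m\<^esub> y = (x - y) mod m" for x y
    unfolding a_minus_def n by (simp add: residue_ring_def mod_simps)
  then show ?thesis by (auto simp: SL2_def residue_ring_def mod_simps)
qed

lemma mult_S: "(a, b, c, d) \<otimes>\<^bsub>S\<^esub> (a', b', c', d') =
    mk (a * a' + b * c') (a * b' + b * d') (c * a' + d * c') (c * b' + d * d')"
  by (simp add: SL2_def residue_ring_def mk_def mod_simps)

lemma one_S: "\<one>\<^bsub>S\<^esub> = mk 1 0 0 1"
  using m2 by (simp add: SL2_def residue_ring_def mk_def)

lemma mk_in: "mk a b c d \<in> carrier S \<longleftrightarrow> (a * d - b * c) mod m = 1"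
proof -
  have "(a mod m * (d mod m) - b mod m * (c mod m)) mod m = (a * d - b * c) mod m"
    by (intro mod_diff_cong mod_mult_cong) simp_all
  then show ?thesis unfolding mk_def carrier_S using m2 by simp
qed

lemma mk_mult: "mk a b c d \<otimes>\<^bsub>S\<^esub> mk a' b' c' d' =
    mk (a * a' + b * c') (a * b' + b * d') (c * a' + d * c') (c * b' + d * d')"
  unfolding mult_S mk_def prod.inject by (intro conjI mod_add_cong mod_mult_cong mod_mod_trivial)

lemma S_cases:
  assumes "x \<in> carrier S" obtains a b c d where "x = mk a b c d" "(a * d - b * c) mod m = 1"
proof -
  obtain a b c d where x: "x = (a, b, c, d)" by (metis surj_pair)
  then have "x = mk a b c d" using assms by (simp add: carrier_S mk_def)
  then show thesis using that assms mk_in by blast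
qed

lemma mk_eq: "mk a b c d = mk a' b' c' d' \<longleftrightarrow>
    a mod m = a' mod m \<and> b mod m = b' mod m \<and> c mod m = c' mod m \<and> d mod m = d' mod m"
  by (simp add: mk_def)

lemma det_mult:
  assumes "(a * d - b * c) mod m = 1" "(a' * d' - b' * c') mod m = 1"
  shows "((a * a' + b * c') * (c * b' + d * d') - (a * b' + b * d') * (c * a' + d * c')) mod m = (1::int)"
proof -
  have "(a * a' + b * c') * (c * b' + d * d') - (a * b' + b * d') * (c * a' + d * c') =
    (a * d - b * c) * (a' * d' - b' * c')" by (simp add: algebra_simps)
  then show ?thesis using assms mod_mult_eq[of "a * d - b * c" m "a' * d' - b' * c'"] m2 by simp
qed

lemma group_S: "group S"
proof (rule groupI)
  fix x y assume "x \<in> carrier S" "y \<in> carrier S"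
  then show "x \<otimes>\<^bsub>S\<^esub> y \<in> carrier S"
    by (elim S_cases) (simp add: mk_mult mk_in det_mult)
next
  show "\<one>\<^bsub>S\<^esub> \<in> carrier S" using m2 by (simp add: one_S mk_in)
next
  fix x y z assume "x \<in> carrier S" "y \<in> carrier S" "z \<in> carrier S"
  then show "x \<otimes>\<^bsub>S\<^esub> y \<otimes>\<^bsub>S\<^esub> z = x \<otimes>\<^bsub>S\<^esub> (y \<otimes>\<^bsub>S\<^esub> z)"
    by (elim S_cases) (simp add: mk_mult algebra_simps)
next
  fix x assume "x \<in> carrier S"
  then show "\<one>\<^bsub>S\<^esub> \<otimes>\<^bsub>S\<^esub> x = x" by (elim S_cases) (simp add: one_S mk_mult)
next
  fix x assume "x \<in> carrier S"
  then obtain a b c d where x: "x = mk a b c d" "(a * d - b * c) mod m = 1" by (rule S_cases)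
  have "mk d (- b) (- c) a \<in> carrier S" using x by (simp add: mk_in algebra_simps)
  moreover have "mk d (- b) (- c) a \<otimes>\<^bsub>S\<^esub> x = \<one>\<^bsub>S\<^esub>"
    using x m2 by (simp add: one_S mk_mult mk_eq algebra_simps)
  ultimately show "\<exists>y\<in>carrier S. y \<otimes>\<^bsub>S\<^esub> x = \<one>\<^bsub>S\<^esub>" by blast
qed

sublocale S: group S by (rule group_S)

lemma finite_S: "finite (carrier S)"
proof -
  have "carrier S \<subseteq> {0..<m} \<times> {0..<m} \<times> {0..<m} \<times> {0..<m}" by (auto simp: carrier_S)
  then show ?thesis by (rule finite_subset) simp
qed

lemma dvd_mod: "x mod m = y mod m \<longleftrightarrow> m dvd x - y" for x y by (rule mod_eq_dvd_iff)

lemma one_mod: "1 mod m = 1" using m2 by simp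

text \<open>Commuting with the two elementary matrices forces b = c = 0 and a = d modulo m. The
  determinant then gives a^2 = 1, so a is 1 or -1 as m is prime.\<close>

lemma center_S: "group_center S = {mk 1 0 0 1, mk (-1) 0 0 (-1)}"
proof (intro equalityI subsetI)
  fix z assume "z \<in> group_center S"
  then have z: "z \<in> carrier S" and comm: "\<And>x. x \<in> carrier S \<Longrightarrow> z \<otimes>\<^bsub>S\<^esub> x = x \<otimes>\<^bsub>S\<^esub> z"
    by (auto simp: group_center_def)
  obtain a b c d where abcd: "z = mk a b c d" "(a * d - b * c) mod m = 1" using z by (rule S_cases)
  have "z \<otimes>\<^bsub>S\<^esub> mk 1 1 0 1 = mk 1 1 0 1 \<otimes>\<^bsub>S\<^esub> z" using comm m2 by (simp add: mk_in)
  then have 1: "m dvd c" "m dvd a - d"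
    using abcd(1) by (simp_all add: mk_mult mk_eq dvd_mod algebra_simps)
  have "z \<otimes>\<^bsub>S\<^esub> mk 1 0 1 1 = mk 1 0 1 1 \<otimes>\<^bsub>S\<^esub> z" using comm m2 by (simp add: mk_in)
  then have 2: "m dvd b" using abcd(1) by (simp add: mk_mult mk_eq dvd_mod algebra_simps)
  have "m dvd a * d - b * c - 1" using abcd(2) one_mod dvd_mod[of "a * d - b * c" 1] by simp
  then have "m dvd (a * d - b * c - 1) + a * (a - d) + b * c" using 1 2 by (intro dvd_add dvd_mult) auto
  moreover have "(a * d - b * c - 1) + a * (a - d) + b * c = (a - 1) * (a + 1)" by (simp add: algebra_simps)
  ultimately have "m dvd (a - 1) * (a + 1)" by simp
  then have "m dvd a - 1 \<or> m dvd a + 1" using prime_m prime_dvd_mult_iff by blast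
  then show "z \<in> {mk 1 0 0 1, mk (-1) 0 0 (-1)}"
  proof
    assume "m dvd a - 1"
    moreover have "d - 1 = (a - 1) - (a - d)" by simp
    then have "m dvd d - 1" using \<open>m dvd a - 1\<close> 1(2) dvd_diff by metis
    ultimately have "z = mk 1 0 0 1" unfolding abcd(1) mk_eq dvd_mod using 1 2 by simp
    then show ?thesis by simp
  next
    assume h: "m dvd a + 1"
    have "d + 1 = (a + 1) - (a - d)" by simp
    then have "m dvd d + 1" using h 1(2) dvd_diff by metis
    then have "z = mk (-1) 0 0 (-1)" unfolding abcd(1) mk_eq dvd_mod using h 1 2 by simp
    then show ?thesis by simp
  qed
next
  fix z assume "z \<in> {mk 1 0 0 1, mk (-1) 0 0 (-1)}"
  then have z: "z = mk 1 0 0 1 \<or> z = mk (-1) 0 0 (-1)" by blast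
  then have "z \<in> carrier S" using m2 by (auto simp: mk_in)
  moreover have "z \<otimes>\<^bsub>S\<^esub> x = x \<otimes>\<^bsub>S\<^esub> z" if "x \<in> carrier S" for x
    using that z by (elim S_cases disjE) (simp_all add: mk_mult)
  ultimately show "z \<in> group_center S" by (simp add: group_center_def)
qed

section \<open>The quotient by the center\<close>

abbreviation Z where "Z \<equiv> group_center S"
abbreviation G0 where "G0 \<equiv> PSL2 (residue_ring m)"

lemma card_Z: "card Z = 2"
proof -
  have "\<not> m dvd 2" using m2 zdvd_not_zless[of 2 m] by simp
  then have "mk 1 0 0 1 \<noteq> mk (-1) 0 0 (-1)" by (simp add: mk_eq dvd_mod)
  then show ?thesis by (simp add: center_S)
qed

lemma normal_Z: "Z \<lhd> S"
proof (rule S.normal_invI)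
  show "subgroup Z S"
  proof (rule S.subgroupI)
    show "Z \<subseteq> carrier S" by (auto simp: group_center_def)
    show "Z \<noteq> {}" by (simp add: center_S)
    have "mk (-1) 0 0 (-1) \<otimes>\<^bsub>S\<^esub> mk (-1) 0 0 (-1) = \<one>\<^bsub>S\<^esub>" by (simp add: mk_mult one_S)
    moreover have "mk (-1) 0 0 (-1) \<in> carrier S" using m2 by (simp add: mk_in)
    ultimately have i: "inv\<^bsub>S\<^esub> mk (-1) 0 0 (-1) = mk (-1) 0 0 (-1)" by (simp add: S.inv_equality)
    show "inv\<^bsub>S\<^esub> z \<in> Z" if "z \<in> Z" for z using that i one_S by (auto simp: center_S) (metis S.inv_one)
    show "z \<otimes>\<^bsub>S\<^esub> w \<in> Z" if "z \<in> Z" "w \<in> Z" for z w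
      using that by (auto simp: center_S mk_mult)
  qed
  fix z x assume "z \<in> Z" "x \<in> carrier S"
  then have "x \<otimes>\<^bsub>S\<^esub> z = z \<otimes>\<^bsub>S\<^esub> x" "z \<in> carrier S" by (auto simp: group_center_def)
  then have "x \<otimes>\<^bsub>S\<^esub> z \<otimes>\<^bsub>S\<^esub> inv\<^bsub>S\<^esub> x = z" using \<open>x \<in> carrier S\<close> by (simp add: S.m_assoc)
  then show "x \<otimes>\<^bsub>S\<^esub> z \<otimes>\<^bsub>S\<^esub> inv\<^bsub>S\<^esub> x \<in> Z" using \<open>z \<in> Z\<close> by simp
qed

sublocale Z: normal Z S by (rule normal_Z)

lemma group_G0: "group G0"
  unfolding PSL2_def by (rule Z.factorgroup_is_group)

sublocale P: group G0 by (rule group_G0)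

text \<open>With arbitrary integer entries, computations in the quotient become arithmetic modulo m
  up to a common sign.\<close>

definition P :: "int \<Rightarrow> int \<Rightarrow> int \<Rightarrow> int \<Rightarrow> (int \<times> int \<times> int \<times> int) set" where
  "P a b c d = Z #>\<^bsub>S\<^esub> mk a b c d"

lemma P_alt: "P a b c d = {mk a b c d, mk (-a) (-b) (-c) (-d)}"
  unfolding P_def r_coset_def center_S by (auto simp: mk_mult)

lemma P_eq: "P a b c d = P a' b' c' d' \<longleftrightarrow> mk a b c d = mk a' b' c' d' \<or> mk a b c d = mk (-a') (-b') (-c') (-d')"
proof -
  have "mk (-a) (-b) (-c) (-d) = mk (-a') (-b') (-c') (-d')" if "mk a b c d = mk a' b' c' d'"
    using that unfolding mk_eq by (metis mod_minus_cong)
  moreover have "mk (-a) (-b) (-c) (-d) = mk a' b' c' d'" if "mk a b c d = mk (-a') (-b') (-c') (-d')"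
    using that unfolding mk_eq by (metis mod_minus_cong minus_minus)
  ultimately show ?thesis unfolding P_alt by (auto simp: doubleton_eq_iff)
qed

lemma P_in: "(a * d - b * c) mod m = 1 \<Longrightarrow> P a b c d \<in> carrier G0"
  unfolding PSL2_def P_def carrier_FactGroup using mk_in by blast

lemma P_cases:
  assumes "g \<in> carrier G0" obtains a b c d where "g = P a b c d" "(a * d - b * c) mod m = 1"
proof -
  obtain x where x: "x \<in> carrier S" "g = Z #>\<^bsub>S\<^esub> x" using assms by (auto simp: PSL2_def carrier_FactGroup)
  then show thesis using that by (elim S_cases) (auto simp: P_def)
qed

lemma P_mult:
  assumes "(a * d - b * c) mod m = 1" "(a' * d' - b' * c') mod m = 1"
  shows "P a b c d \<otimes>\<^bsub>G0\<^esub> P a' b' c' d' = P (a * a' + b * c') (a * b' + b * d') (c * a' + d * c') (c * b' + d * d')"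
proof -
  have "mk a b c d \<in> carrier S" "mk a' b' c' d' \<in> carrier S" using assms by (simp_all add: mk_in)
  then show ?thesis unfolding P_def PSL2_def using Z.rcos_sum by (simp add: mk_mult)
qed

lemma P_one: "\<one>\<^bsub>G0\<^esub> = P 1 0 0 1"
  unfolding PSL2_def by (simp add: P_alt center_S)

lemma finite_G0: "finite (carrier G0)"
  unfolding PSL2_def carrier_FactGroup using finite_S by simp

sublocale P: fin_group G0
  by (intro fin_group.intro group_G0 fin_group_axioms.intro finite_G0)

lemma ex_inverse:
  assumes "\<not> m dvd a" obtains x where "(a * x) mod m = 1"
proof -
  have "coprime a m" using prime_imp_coprime[OF prime_m assms] by (simp add: ac_simps)
  then obtain x where "[a * x = 1] (mod m)" using cong_solve_coprime_int by blast
  then show thesis using that[of x] one_mod by (simp add: cong_def)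
qed

text \<open>Unspecified when m divides a.\<close>

definition iv :: "int \<Rightarrow> int" where "iv a = (SOME x. (a * x) mod m = 1)"

lemma iv: "\<not> m dvd a \<Longrightarrow> (a * iv a) mod m = 1"
  unfolding iv_def by (rule ex_inverse[of a], assumption) (rule someI)

lemma iv': "\<not> m dvd a \<Longrightarrow> (a * (iv a * x)) mod m = x mod m"
proof -
  assume n: "\<not> m dvd a"
  have "(a * (iv a * x)) mod m = ((a * iv a) mod m * (x mod m)) mod m"
    using mod_mult_eq[of "a * iv a" m x] by (simp only: mult.assoc)
  then show ?thesis unfolding iv[OF n] by simp
qed

lemma solve: assumes "\<not> m dvd a" shows "(a * x) mod m = y mod m \<longleftrightarrow> x mod m = (iv a * y) mod m"
proof
  assume h: "(a * x) mod m = y mod m"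
  have "x mod m = (a * (iv a * x)) mod m" using iv'[OF assms] by simp
  also have "\<dots> = (iv a * ((a * x) mod m)) mod m" by (simp add: mod_simps ac_simps)
  also have "\<dots> = (iv a * y) mod m" unfolding h by (simp add: mod_simps)
  finally show "x mod m = (iv a * y) mod m" .
next
  assume h: "x mod m = (iv a * y) mod m"
  have "(a * x) mod m = (a * (x mod m)) mod m" by (simp add: mod_simps)
  also have "\<dots> = (a * (iv a * y)) mod m" unfolding h by (simp add: mod_simps)
  finally show "(a * x) mod m = y mod m" using iv'[OF assms] by simp
qed

lemma nat_m: "int (nat m) = m" using m2 by simp

lemma not_dvd: "0 < a \<Longrightarrow> a < m \<Longrightarrow> \<not> m dvd a" using zdvd_not_zless by blast

text \<open>If a is nonzero, then b and c are free and d = (1 + b c) / a. If a = 0, then b is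
  nonzero, c = - 1 / b and d is free. This gives (m - 1) m^2 + (m - 1) m matrices.\<close>

lemma card_S: "card (carrier S) = nat m * (nat m - 1) * (nat m + 1)"
proof -
  let ?I = "{0..<m}" and ?J = "{1..<m}"
  let ?f = "\<lambda>(a, b, c). (a, b, c, (iv a * (1 + b * c)) mod m)"
  let ?g = "\<lambda>(b, d). (0::int, b, (iv b * (-1)) mod m, d)"
  have A: "(a, b, c, d) \<in> carrier S \<longleftrightarrow> (a, b, c, d) \<in> ?f ` (?J \<times> ?I \<times> ?I)" if a: "a \<noteq> 0" for a b c d
  proof (cases "0 < a \<and> a < m")
    case True
    have "(a * d - b * c) mod m = 1 \<longleftrightarrow> (a * d) mod m = (1 + b * c) mod m"
      using one_mod dvd_mod[of "a * d - b * c" 1] dvd_mod[of "a * d" "1 + b * c"] by (simp add: algebra_simps)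
    also have "\<dots> \<longleftrightarrow> d mod m = (iv a * (1 + b * c)) mod m" using solve[OF not_dvd] True by blast
    finally show ?thesis using True by (auto simp: carrier_S image_iff)
  next
    case False
    then show ?thesis using a by (auto simp: carrier_S)
  qed
  have B: "(0, b, c, d) \<in> carrier S \<longleftrightarrow> (0, b, c, d) \<in> ?g ` (?J \<times> ?I)" for b c d
  proof (cases "0 < b \<and> b < m")
    case True
    have "(0 * d - b * c) mod m = 1 \<longleftrightarrow> (b * c) mod m = (-1) mod m"
    proof -
      have e: "- (b * c) - 1 = - (1 + b * c)" by simp
      have "m dvd - (b * c) - 1 \<longleftrightarrow> m dvd 1 + b * c" unfolding e by (rule dvd_minus_iff)
      then show ?thesis
        using one_mod dvd_mod[of "0 * d - b * c" 1] dvd_mod[of "b * c" "-1"] by (simp add: ac_simps)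
    qed
    also have "\<dots> \<longleftrightarrow> c mod m = (iv b * (-1)) mod m" using solve[OF not_dvd] True by blast
    finally show ?thesis using True by (auto simp: carrier_S image_iff)
  next
    case False
    then show ?thesis using m2 by (auto simp: carrier_S image_iff)
  qed
  have "carrier S = ?f ` (?J \<times> ?I \<times> ?I) \<union> ?g ` (?J \<times> ?I)"
  proof (rule Set.set_eqI)
    fix x :: "int \<times> int \<times> int \<times> int"
    obtain a b c d where x: "x = (a, b, c, d)" by (metis surj_pair)
    show "x \<in> carrier S \<longleftrightarrow> x \<in> ?f ` (?J \<times> ?I \<times> ?I) \<union> ?g ` (?J \<times> ?I)"
    proof (cases "a = 0")
      case True
      have "x \<notin> ?f ` (?J \<times> ?I \<times> ?I)" using x True by auto
      then show ?thesis using B[of b c d] unfolding x True Un_iff by blast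
    next
      case False
      have "x \<notin> ?g ` (?J \<times> ?I)" using x False by auto
      then show ?thesis using A[OF False, of b c d] unfolding x Un_iff by blast
    qed
  qed
  moreover have "?f ` (?J \<times> ?I \<times> ?I) \<inter> ?g ` (?J \<times> ?I) = {}" by auto
  moreover have "card (?f ` (?J \<times> ?I \<times> ?I)) = (nat m - 1) * (nat m * nat m)"
    using m2 by (subst card_image) (auto simp: inj_on_def card_cartesian_product nat_diff_distrib)
  moreover have "card (?g ` (?J \<times> ?I)) = (nat m - 1) * nat m"
    using m2 by (subst card_image) (auto simp: inj_on_def card_cartesian_product nat_diff_distrib)
  ultimately have "card (carrier S) = (nat m - 1) * (nat m * nat m) + (nat m - 1) * nat m"
    by (simp add: card_Un_disjoint)
  then show ?thesis by (cases "nat m") (simp_all add: algebra_simps)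
qed

lemma order_G0: "order G0 * 2 = nat m * (nat m - 1) * (nat m + 1)"
proof -
  have "card (rcosets\<^bsub>S\<^esub> Z) * card Z = order S" by (rule S.lagrange) (rule Z.is_subgroup)
  then show ?thesis using card_S card_Z by (simp add: order_def PSL2_def FactGroup_def)
qed

text \<open>The images of the upper and lower unitriangular matrices. They are two different Sylow
  m-subgroups, as m divides the order of \<open>G0\<close> exactly once.\<close>

abbreviation "unip_u \<equiv> generate G0 {P 1 1 0 1}"
abbreviation "unip_l \<equiv> generate G0 {P 1 0 1 1}"

lemma upper_pow: "P 1 1 0 1 [^]\<^bsub>G0\<^esub> (n::nat) = P 1 (int n) 0 1"
  using m2 by (induction n) (simp_all add: P_one P_mult algebra_simps)

lemma lower_pow: "P 1 0 1 1 [^]\<^bsub>G0\<^esub> (n::nat) = P 1 0 (int n) 1"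
  using m2 by (induction n) (simp_all add: P_one P_mult algebra_simps)

lemma u_in: "P 1 1 0 1 \<in> carrier G0" "P 1 0 1 1 \<in> carrier G0" using m2 by (auto intro!: P_in)

lemma upper_lower:
  shows "subgroup unip_u G0" "subgroup unip_l G0" "card unip_u = nat m" "card unip_l = nat m" "unip_u \<noteq> unip_l"
proof -
  have pm: "nprime (nat m)" using prime_m by (simp add: prime_nat_iff_prime)
  have n: "\<not> m dvd 1" using not_dvd[of 1] m2 by simp
  show "subgroup unip_u G0" "subgroup unip_l G0" using P.gen_subgroup u_in by auto
  have 1: "P 1 1 0 1 \<noteq> \<one>\<^bsub>G0\<^esub>" "P 1 0 1 1 \<noteq> \<one>\<^bsub>G0\<^esub>" unfolding P_one P_eq mk_eq dvd_mod using n by auto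
  have "P 1 (int (nat m)) 0 1 = \<one>\<^bsub>G0\<^esub>" "P 1 0 (int (nat m)) 1 = \<one>\<^bsub>G0\<^esub>"
    unfolding P_one P_eq mk_eq nat_m by simp_all
  then show "card unip_u = nat m" "card unip_l = nat m"
    using P.card_gen_prime[OF u_in(1) 1(1) _ pm] P.card_gen_prime[OF u_in(2) 1(2) _ pm] by (simp_all add: upper_pow lower_pow)
  show "unip_u \<noteq> unip_l"
  proof
    assume "unip_u = unip_l"
    then have "P 1 0 1 1 \<in> unip_u" using P.gen_self by simp
    then obtain k :: nat where "P 1 0 1 1 = P 1 (int k) 0 1" using P.gen_elems[OF u_in(1)] upper_pow by metis
    then show False unfolding P_eq mk_eq dvd_mod using n by auto
  qed
qed

lemma elementary_in:
  assumes "subgroup H G0" "unip_u \<subseteq> H" "unip_l \<subseteq> H"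
  shows "P 1 x 0 1 \<in> H" "P 1 0 x 1 \<in> H"
proof -
  have x: "int (nat (x mod m)) = x mod m" using m2 by simp
  have "P 1 x 0 1 = P 1 1 0 1 [^]\<^bsub>G0\<^esub> nat (x mod m)" unfolding upper_pow x P_eq mk_eq by simp
  moreover have "P 1 0 x 1 = P 1 0 1 1 [^]\<^bsub>G0\<^esub> nat (x mod m)" unfolding lower_pow x P_eq mk_eq by simp
  moreover have "P 1 1 0 1 \<in> H" "P 1 0 1 1 \<in> H" using assms P.gen_self by blast+
  ultimately show "P 1 x 0 1 \<in> H" "P 1 0 x 1 \<in> H"
    using P.subgroup_nat_pow_closed[OF assms(1)] by simp_all
qed

text \<open>A matrix with c invertible is a product of an upper, a lower and an upper elementary
  matrix; a matrix with c = 0 is brought to that case by adding its first row to the second.\<close>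

lemma upper_lower_generate:
  assumes H: "subgroup H G0" "unip_u \<subseteq> H" "unip_l \<subseteq> H"
  shows "H = carrier G0"
proof -
  note el = elementary_in[OF H]
  have step: "P a b c d \<in> H" if det: "(a * d - b * c) mod m = 1" and c: "\<not> m dvd c" for a b c d
  proof -
    \<comment> \<open>Chosen so that 1 + x c = a and c y + 1 = d modulo m. The upper right entry
      then agrees with b after multiplication by c, by the determinant condition, and c can be
      cancelled.\<close>
    define x y where "x = iv c * (a - 1)" and "y = iv c * (d - 1)"
    have x: "(c * x) mod m = (a - 1) mod m" and y: "(c * y) mod m = (d - 1) mod m"
      unfolding x_def y_def using iv'[OF c] by auto
    have eq: "P 1 x 0 1 \<otimes>\<^bsub>G0\<^esub> P 1 0 c 1 \<otimes>\<^bsub>G0\<^esub> P 1 y 0 1 = P (1 + x * c) ((1 + x * c) * y + x) c (c * y + 1)"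
      using m2 by (simp add: P_mult)
    have dx: "m dvd c * x - (a - 1)" and dy: "m dvd c * y - (d - 1)" using x y dvd_mod by blast+
    have dd: "m dvd a * d - b * c - 1" using det one_mod dvd_mod[of "a * d - b * c" 1] by simp
    have "c * (((1 + x * c) * y + x) - b) =
      (c * x - (a - 1)) * (c * y + 1) + a * (c * y - (d - 1)) + (a * d - b * c - 1)" by (simp add: algebra_simps)
    then have "m dvd c * (((1 + x * c) * y + x) - b)" using dx dy dd by (metis dvd_add dvd_mult dvd_mult2)
    then have db: "m dvd ((1 + x * c) * y + x) - b" using c prime_m prime_dvd_mult_iff by blast
    have "mk (1 + x * c) ((1 + x * c) * y + x) c (c * y + 1) = mk a b c d"
      unfolding mk_eq dvd_mod using dx dy db by (simp add: algebra_simps)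
    then have "P a b c d = P 1 x 0 1 \<otimes>\<^bsub>G0\<^esub> P 1 0 c 1 \<otimes>\<^bsub>G0\<^esub> P 1 y 0 1" unfolding eq P_eq by simp
    then show ?thesis using el H(1) by (simp add: subgroup.m_closed)
  qed
  have "carrier G0 \<subseteq> H"
  proof
    fix g assume "g \<in> carrier G0"
    then obtain a b c d where g: "g = P a b c d" "(a * d - b * c) mod m = 1" by (rule P_cases)
    show "g \<in> H"
    proof (cases "m dvd c")
      case False then show ?thesis using step g by blast
    next
      case True
      have "m dvd a * d - b * c - 1" using g(2) one_mod dvd_mod[of "a * d - b * c" 1] by simp
      moreover have "1 = (a * d - b * c) - (a * d - b * c - 1)" by simp
      ultimately have nd: "\<not> m dvd a"
        using True not_dvd[of 1] m2 by (metis dvd_diff dvd_mult dvd_mult2 less_trans one_less_numeral_iff semiring_norm(76) zero_less_one)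
      have na: "\<not> m dvd c + a" using True nd by (simp add: dvd_add_right_iff)
      have det: "(a * (b + d) - b * (a + c)) mod m = 1" using g(2) by (simp add: algebra_simps)
      have "P a b (a + c) (b + d) \<in> H" using step[OF det] na by (simp add: add.commute)
      moreover have "P 1 0 (-1) 1 \<otimes>\<^bsub>G0\<^esub> P a b (a + c) (b + d) = g"
        using m2 det g by (simp add: P_mult)
      ultimately show ?thesis using el(2)[of "-1"] H(1) subgroup.m_closed by metis
    qed
  qed
  then show ?thesis using subgroup.subset[OF H(1)] by blast
qed

end

section \<open>Subgroups of the two projective special linear groups\<close>

context fin_group
begin

lemma class_count:
  assumes T: "subgroup T G" and Q: "subgroup Q G" "Q \<subseteq> T" "card Q = q" and q: "nprime q" "\<not> q ^ Suc 1 dvd card T"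
  obtains c k where "c = card ((\<lambda>g. cj g Q) ` T)" "[c = 1] (mod q)" "card (T \<inter> nrm Q) = q * k" "c * (q * k) = card T"
proof -
  have Qc: "Q \<subseteq> carrier G" using Q(1) by (simp add: subgroup.subset)
  have "[card ((\<lambda>g. cj g Q) ` T) = 1] (mod q)" using sylow_count[OF T Q(1,2) _ q(1), of 1] Q(3) q(2) by simp
  moreover have "q dvd card (T \<inter> nrm Q)"
    using card_dvd[OF Q(1) nrm_dvd(1)[OF T Qc]] Q self_subset_nrm[OF Q(1)] by simp
  then obtain k where "card (T \<inter> nrm Q) = q * k" by blast
  ultimately show thesis using that card_conjugates[OF T Qc] by metis
qed

lemma class_one: "subgroup T G \<Longrightarrow> card (T \<inter> nrm Q) = card T \<Longrightarrow> T \<subseteq> nrm Q"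
  using finite_sub by (metis card_subset_eq inf_le1 inf_le2)

text \<open>By \<open>cs\<close>, a subgroup H of order divisible by m has 1 or m + 1 Sylow
  m-subgroups. With 1, it lies in the normalizer of that subgroup; with m + 1, it contains all those
  of G, in particular R and R', which generate G.\<close>

lemma two_sylow_subgroups:
  assumes m: "nprime m" and ord: "order G = m * k" "\<not> m dvd k"
    and cs: "\<forall>c. c dvd k \<longrightarrow> [c = 1] (mod m) \<longrightarrow> c = 1 \<or> c = Suc m"
    and R: "subgroup R G" "card R = m" and R': "subgroup R' G" "card R' = m" "R \<noteq> R'"
    and gen: "\<forall>H. subgroup H G \<longrightarrow> R \<subseteq> H \<longrightarrow> R' \<subseteq> H \<longrightarrow> H = carrier G"
  shows "card ((\<lambda>g. cj g R) ` carrier G) = Suc m" "Suc m * card (nrm R) = order G"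
    "\<And>H. subgroup H G \<Longrightarrow> m dvd card H \<Longrightarrow> card H dvd card (nrm R) \<or> H = carrier G"
proof -
  have m1: "m > 1" by (rule prime_gt_1_nat[OF m])
  have syl: "\<not> m ^ Suc 1 dvd order G" using ord m1 by simp
  have dvdk: "c dvd k" if c: "c * (m * j) = card H" and H: "subgroup H G" for c j H
  proof -
    have "c * (m * j) dvd m * k" using card_dvd_order[OF H] c ord by simp
    then have "m * (c * j) dvd m * k" by (simp add: ac_simps)
    then have "c * j dvd k" using m1 by simp
    then show ?thesis by (rule dvd_mult_left)
  qed
  have Rc: "R \<subseteq> carrier G" and R'c: "R' \<subseteq> carrier G" using R(1) R'(1) by (simp_all add: subgroup.subset)
  obtain c j where c: "c = card ((\<lambda>g. cj g R) ` carrier G)" "[c = 1] (mod m)"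
    "card (carrier G \<inter> nrm R) = m * j" "c * (m * j) = card (carrier G)"
    using class_count[OF subgroup_self R(1) Rc R(2) m] syl by (auto simp: order_def)
  have "c \<noteq> 1"
  proof
    assume "c = 1"
    then have "R' \<subseteq> nrm R" using class_one[OF subgroup_self, of R] c R'c by auto
    then have "R' \<subseteq> R"
      using sylow_contains[OF subgroup_self R(1) Rc _ m _ R'(1) R'c, of 1 1] R R' syl by (simp add: order_def)
    then show False using R R' finite_sub[OF R(1)] by (metis card_subset_eq)
  qed
  then have cm: "c = Suc m" using cs dvdk[OF c(4) subgroup_self] c(2) by blast
  then show 1: "card ((\<lambda>g. cj g R) ` carrier G) = Suc m" using c by simp
  then show "Suc m * card (nrm R) = order G" using card_conj_class[OF R(1)] by simp
  fix H assume H: "subgroup H G" "m dvd card H"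
  obtain A where A: "subgroup A G" "A \<subseteq> H" "card A = m" using cauchy_sub[OF H(1) m H(2)] by blast
  have Ac: "A \<subseteq> carrier G" using A(1) by (simp add: subgroup.subset)
  have nA: "card (nrm A) = card (nrm R)" using sylow_nrm_card[of A m 1 R] A R m syl by simp
  have "\<not> m ^ Suc 1 dvd card H" using syl card_dvd_order[OF H(1)] dvd_trans by blast
  then obtain d i where d: "d = card ((\<lambda>g. cj g A) ` H)" "[d = 1] (mod m)" "card (H \<inter> nrm A) = m * i" "d * (m * i) = card H"
    using class_count[OF H(1) A m] by blast
  have "d = 1 \<or> d = Suc m" using cs dvdk[OF d(4) H(1)] d(2) by blast
  then show "card H dvd card (nrm R) \<or> H = carrier G"
  proof
    assume "d = 1"
    then have "H \<subseteq> nrm A" using class_one[OF H(1)] d by simp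
    then show ?thesis using sub_nrm_dvd[OF A(1) H(1)] nA by simp
  next
    assume d': "d = Suc m"
    let ?E = "(\<lambda>g. cj g A) ` carrier G"
    have "card ?E * card (nrm R) = Suc m * card (nrm R)"
      using card_conj_class[OF A(1)] \<open>Suc m * card (nrm R) = order G\<close> nA by simp
    moreover have "card (nrm R) \<noteq> 0" using card_sub_pos[OF nrm_sub[OF R(1)]] by simp
    ultimately have "card ?E = Suc m" by (metis mult_cancel2)
    moreover have "(\<lambda>g. cj g A) ` H \<subseteq> ?E" using subgroup.subset[OF H(1)] by blast
    ultimately have eq: "(\<lambda>g. cj g A) ` H = ?E" using d(1) d' fin by (metis card_subset_eq finite_imageI)
    have in_H: "B \<subseteq> H" if B: "subgroup B G" "card B = m" for B
    proof -
      obtain g where g: "g \<in> carrier G" "B = cj g A" using sylow_conj_eq[of A m 1 B] A B m syl by auto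
      then have "B \<in> (\<lambda>g. cj g A) ` H" using eq g(1) by blast
      then obtain h where h: "h \<in> H" "B = cj h A" by blast
      show ?thesis unfolding h(2) cj_def using h(1) A(2) H(1)
        by (auto simp: subset_iff subgroup.m_closed subgroup.m_inv_closed)
    qed
    show ?thesis using gen H(1) in_H R R' by blast
  qed
qed

text \<open>A subgroup Q of order 3 is normal in K, so the number of its conjugates in T divides 12
  / 6 = 2 and is 1 modulo 3. Then T would normalize Q, which \<open>h\<close> excludes.\<close>

lemma no_order_6_in_12:
  assumes h: "\<And>Q. subgroup Q G \<Longrightarrow> card Q = 3 \<Longrightarrow> \<not> 12 dvd card (nrm Q)"
    and T: "subgroup T G" "card T = 12" and K: "subgroup K G" "K \<subseteq> T"
  shows "card K \<noteq> 6"
proof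
  assume k: "card K = 6"
  have three: "nprime 3" by simp
  obtain Q where Q: "subgroup Q G" "Q \<subseteq> K" "card Q = 3" using cauchy_sub[OF K(1) three] k by auto
  obtain c j where c: "c = card ((\<lambda>g. cj g Q) ` K)" "[c = 1] (mod 3)" "card (K \<inter> nrm Q) = 3 * j" "c * (3 * j) = card K"
    using class_count[OF K(1) Q three] k by auto
  have "c * j = 2" using c(4) k by simp
  then have "c dvd 2" by (metis dvd_triv_left)
  then have "c = 1 \<or> c = 2" using two_is_prime_nat prime_nat_iff by blast
  then have "c = 1" using c(2) by (auto simp: cong_def)
  then have KQ: "K \<subseteq> nrm Q" using class_one[OF K(1)] c by simp
  have QT: "Q \<subseteq> T" using Q K by blast
  obtain d i where d: "d = card ((\<lambda>g. cj g Q) ` T)" "[d = 1] (mod 3)" "card (T \<inter> nrm Q) = 3 * i" "d * (3 * i) = card T"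
    using class_count[OF T(1) Q(1) QT Q(3) three] T by auto
  have "card K dvd card (T \<inter> nrm Q)"
    using card_dvd[OF K(1) nrm_dvd(1)[OF T(1) subgroup.subset[OF Q(1)]]] K KQ by simp
  then obtain l where "3 * i = 6 * l" using d k by auto
  then have "d * l = 2" using d(4) T by simp
  then have "d dvd 2" by (metis dvd_triv_left)
  then have "d = 1 \<or> d = 2" using two_is_prime_nat prime_nat_iff by blast
  then have "d = 1" using d(2) by (auto simp: cong_def)
  then have "T \<subseteq> nrm Q" using class_one[OF T(1)] d by simp
  then show False using sub_nrm_dvd[OF Q(1) T(1)] T h[OF Q(1,3)] by simp
qed

end

text \<open>The elements a, b, w generate a copy of the alternating group of degree 4.\<close>

locale klein_extension = fin_group +
  fixes a b w
  assumes abw: "a \<in> carrier G" "b \<in> carrier G" "w \<in> carrier G"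
    and ab: "a \<otimes> a = \<one>" "b \<otimes> b = \<one>" "a \<otimes> b = b \<otimes> a" "a \<noteq> \<one>" "b \<noteq> \<one>" "a \<noteq> b"
    and w: "w \<otimes> a = b \<otimes> w" "w \<otimes> b = a \<otimes> b \<otimes> w" "w \<otimes> (w \<otimes> w) = \<one>"
begin

definition "V = {\<one>, a, b, a \<otimes> b}"
definition "Q = generate G {w}"

lemma ab_ne: "a \<otimes> b \<noteq> \<one>" "a \<otimes> b \<noteq> a" "a \<otimes> b \<noteq> b"
proof -
  show "a \<otimes> b \<noteq> \<one>"
  proof
    assume "a \<otimes> b = \<one>"
    then have "a \<otimes> b = b \<otimes> b" using ab(2) by simp
    then show False using abw ab(6) by (metis right_cancel)
  qed
  show "a \<otimes> b \<noteq> a" using abw ab(5) by simp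
  show "a \<otimes> b \<noteq> b" using abw ab(4) by simp
qed

lemma products: "a \<otimes> (a \<otimes> b) = b" "b \<otimes> (a \<otimes> b) = a" "a \<otimes> b \<otimes> a = b" "a \<otimes> b \<otimes> b = a" "a \<otimes> b \<otimes> (a \<otimes> b) = \<one>"
proof -
  show 1: "a \<otimes> (a \<otimes> b) = b" using m_assoc[OF abw(1,1,2)] ab(1) abw by simp
  have "b \<otimes> (b \<otimes> a) = a" using m_assoc[OF abw(2,2,1)] ab(2) abw by simp
  then show 2: "b \<otimes> (a \<otimes> b) = a" unfolding ab(3) .
  show 3: "a \<otimes> b \<otimes> a = b" using m_assoc[OF abw(1,2,1)] 1 unfolding ab(3)[symmetric] by simp
  show "a \<otimes> b \<otimes> b = a" using m_assoc[OF abw(1,2,2)] ab(2) abw by simp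
  show "a \<otimes> b \<otimes> (a \<otimes> b) = \<one>" using m_assoc[OF abw(1,2) m_closed[OF abw(1,2)]] 2 ab(1) by simp
qed

lemma V: "subgroup V G" "card V = 4" "V \<subseteq> carrier G"
proof -
  show c: "V \<subseteq> carrier G" using abw by (simp add: V_def)
  show "card V = 4" using ab(4-6) ab_ne by (auto simp: V_def card_insert_if)
  show "subgroup V G"
  proof (rule subgroupI[OF c])
    show "V \<noteq> {}" by (simp add: V_def)
    show "x \<otimes> y \<in> V" if "x \<in> V" "y \<in> V" for x y
      using that abw ab(1,2) products unfolding V_def
      by (elim insertE emptyE) (simp_all add: ab(3)[symmetric])
    have "x \<otimes> x = \<one>" if "x \<in> V" for x
      using that abw ab(1,2) products unfolding V_def by (elim insertE emptyE) simp_all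
    then show "inv x \<in> V" if "x \<in> V" for x using that c by (metis inv_equality subsetD)
  qed
qed

lemma in_nrm_V:
  assumes "g \<in> carrier G" "g \<otimes> a \<otimes> inv g \<in> V" "g \<otimes> b \<otimes> inv g \<in> V" shows "g \<in> nrm V"
proof (rule in_nrmI[OF V(3) assms(1)])
  fix h assume "h \<in> V"
  moreover have "g \<otimes> (a \<otimes> b) \<otimes> inv g \<in> V"
    using conj_hom[OF assms(1) abw(1,2)] assms subgroup.m_closed[OF V(1)] by simp
  moreover have "g \<otimes> \<one> \<otimes> inv g \<in> V" using assms(1) by (simp add: V_def)
  ultimately show "g \<otimes> h \<otimes> inv g \<in> V" using assms by (auto simp: V_def)
qed

lemma Q: "subgroup Q G" "card Q = 3" "w \<in> Q"
proof -
  have "w \<noteq> \<one>" using w abw ab by auto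
  moreover have "w [^] (3::nat) = \<one>" using w(3) abw by (simp add: numeral_3_eq_3 m_assoc)
  ultimately show "card Q = 3" unfolding Q_def using abw by (intro card_gen_prime) auto
  show "subgroup Q G" "w \<in> Q" unfolding Q_def using gen_subgroup abw gen_self by auto
qed

lemma w_conj: "w \<otimes> a \<otimes> inv w = b" "w \<otimes> b \<otimes> inv w = a \<otimes> b"
  using w abw by (simp_all add: m_assoc)

lemma Q_V: "Q \<subseteq> nrm V"
proof -
  have "w \<in> nrm V" using in_nrm_V[OF abw(3)] w_conj by (simp add: V_def)
  then show ?thesis unfolding Q_def using gen_subset[OF nrm_sub[OF V(1)]] by blast
qed

lemma VQ: "subgroup (V <#> Q) G" "card (V <#> Q) = 12" "V <#> Q \<subseteq> nrm V"
proof -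
  have c: "coprime (card V) (card Q)" using V Q by (simp add: coprime_iff_gcd_eq_1 gcd_nat.simps)
  show "subgroup (V <#> Q) G" "card (V <#> Q) = 12"
    using coprime_prod[OF subgroup_self V(1) Q(1) V(3) subgroup.subset[OF Q(1)] Q_V c] V Q by auto
  show "V <#> Q \<subseteq> nrm V" using prod_subset[OF nrm_sub[OF V(1)] self_subset_nrm[OF V(1)] Q_V] .
qed

text \<open>Otherwise the commutator of a and w lies in Q; but it equals a b, a nontrivial element
  of V, while V and Q meet trivially.\<close>

lemma V_not_normalizes_Q: "nrm Q \<noteq> carrier G"
proof
  assume n: "nrm Q = carrier G"
  then have "a \<otimes> w \<otimes> inv a \<in> Q" using nrm_mem Q(3) abw(1) by blast
  then have "a \<otimes> w \<otimes> inv a \<otimes> inv w \<in> Q" using Q by (simp add: subgroup.m_closed subgroup.m_inv_closed)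
  moreover have "a \<otimes> w \<otimes> inv a \<otimes> inv w = a \<otimes> b"
  proof -
    have "inv a = a" using ab abw by (simp add: inv_equality)
    then have "a \<otimes> w \<otimes> inv a \<otimes> inv w = a \<otimes> (w \<otimes> a \<otimes> inv w)" using abw by (simp add: m_assoc)
    then show ?thesis using w_conj by simp
  qed
  moreover have "V \<inter> Q = {\<one>}"
    using coprime_inter[OF V(1) Q(1)] V(2) Q(2) by (simp add: coprime_iff_gcd_eq_1 gcd_nat.simps)
  ultimately show False using ab_ne(1) by (auto simp: V_def)
qed

end

text \<open>The condition \<open>cs\<close> of \<open>two_sylow_subgroups\<close> for 60 = 5 * 12;
  the remaining candidate 11 does not divide 12.\<close>

lemma cong_mod_5: "\<forall>c::nat. c dvd 12 \<longrightarrow> [c = 1] (mod 5) \<longrightarrow> c = 1 \<or> c = Suc 5"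
proof (intro allI impI)
  fix c :: nat
  assume c: "c dvd 12" "[c = 1] (mod 5)"
  have "c < 13" using dvd_imp_le[OF c(1)] by simp
  then have "c = 1 \<or> c = 6 \<or> c = 11" using c(2) by (auto simp: cong_def) presburger
  then show "c = 1 \<or> c = Suc 5" using c(1) by auto
qed

text \<open>The same condition for 168 = 7 * 24; the candidates 15 and 22 do not divide 24.\<close>

lemma cong_mod_7: "\<forall>c::nat. c dvd 24 \<longrightarrow> [c = 1] (mod 7) \<longrightarrow> c = 1 \<or> c = Suc 7"
proof (intro allI impI)
  fix c :: nat
  assume c: "c dvd 24" "[c = 1] (mod 7)"
  have "c < 25" using dvd_imp_le[OF c(1)] by simp
  then have "c = 1 \<or> c = 8 \<or> c = 15 \<or> c = 22" using c(2) by (auto simp: cong_def) presburger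
  then show "c = 1 \<or> c = Suc 7" using c(1) by auto
qed

text \<open>By \<open>two_sylow_subgroups\<close> an order divisible by 5 divides 10 or is 60, which
  excludes 15 and 20 and makes the normalizer of R the required D. The product of V and Q is the
  required T.\<close>

lemma (in klein_extension) case60_intro:
  assumes ord: "order G = 60"
    and R: "subgroup R G" "card R = 5" and R': "subgroup R' G" "card R' = 5" "R \<noteq> R'"
    and gen: "\<forall>H. subgroup H G \<longrightarrow> R \<subseteq> H \<longrightarrow> R' \<subseteq> H \<longrightarrow> H = carrier G"
  shows "case60 G 2 3 5"
proof -
  have five: "nprime 5" and three: "nprime 3" by simp_all
  have n9: "\<not> 3 ^ Suc 1 dvd card (carrier G)" using ord by (simp add: order_def)
  have o: "order G = 5 * 12" and nd: "\<not> 5 dvd (12::nat)" using ord by simp_all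
  note two = two_sylow_subgroups[OF five o nd cong_mod_5 R R' gen]
  have nR: "card (nrm R) = 10" using two(2) ord by simp
  have H5: "card H dvd 10 \<or> card H = 60" if "subgroup H G" "5 dvd card H" for H
    using two(3)[OF that] nR ord by (auto simp: order_def)
  \<comment> \<open>Otherwise the number c of conjugates of L satisfies c k = 5 and is 1 modulo 3,
    so c = 1. Then 5 divides the order of the normalizer, which yields a subgroup of order
    15.\<close>
  have h12: "\<not> 12 dvd card (nrm L)" if L: "subgroup L G" "card L = 3" for L
  proof
    assume "12 dvd card (nrm L)"
    then obtain k where k: "card (nrm L) = 12 * k" by blast
    obtain c j where c: "[c = 1] (mod 3)" "card (carrier G \<inter> nrm L) = 3 * j" "c * (3 * j) = card (carrier G)"
      using class_count[OF subgroup_self L(1) subgroup.subset[OF L(1)] L(2) three n9] by blast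
    have e: "card (carrier G \<inter> nrm L) = card (nrm L)" using nrm_carrier by (simp add: Int_absorb1)
    then have "c * (12 * k) = 60" using c k ord by (simp add: order_def)
    then have ck: "c * k = 5" by simp
    then have "c dvd 5" by (metis dvd_triv_left)
    then have "c = 1 \<or> c = 5" using five prime_nat_iff by blast
    then have "c = 1" using c(1) by (auto simp: cong_def)
    then have "5 dvd card (nrm L)" using ck k by simp
    then obtain M where "subgroup M G" "card M = 3 * 5 ^ 1"
      using nrm_prod[OF L(1) five, of 1] L(2) by (auto simp: coprime_iff_gcd_eq_1 gcd_nat.simps)
    then show False using H5[of M] by auto
  qed
  show ?thesis
  proof (intro case60.intro fin_group_axioms case60_axioms.intro)
    show "card H \<noteq> 3 * 5" if "subgroup H G" for H using H5[OF that] by auto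
    show "card H \<noteq> 2\<^sup>2 * 5" if "subgroup H G" for H using H5[OF that] by auto
    show "card K \<noteq> 2 * 3" if "subgroup T G" "subgroup K G" "card T = 2\<^sup>2 * 3" "K \<subseteq> T" for T K
      using no_order_6_in_12[OF h12 that(1) _ that(2,4)] that(3) by simp
    show "\<exists>T. subgroup T G \<and> card T = 2\<^sup>2 * 3" using VQ by auto
    show "\<exists>D. subgroup D G \<and> card D = 2 * 5" using nrm_sub[OF R(1)] nR by auto
  qed (use ord in auto)
qed

text \<open>The extra element x has order 4 and normalizes V; together with Q it enlarges the
  normalizer of V to order 24. This normalizer serves as U, and the part of it normalizing Q serves
  as S.\<close>

lemma (in klein_extension) case168_intro:
  assumes ord: "order G = 168"
    and R: "subgroup R G" "card R = 7" and R': "subgroup R' G" "card R' = 7" "R \<noteq> R'"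
    and gen: "\<forall>H. subgroup H G \<longrightarrow> R \<subseteq> H \<longrightarrow> R' \<subseteq> H \<longrightarrow> H = carrier G"
    and x: "x \<in> carrier G" "x \<otimes> x = a" "x \<otimes> b = a \<otimes> b \<otimes> x"
  shows "case168 G 2 3 7"
proof -
  have seven: "nprime 7" and three: "nprime 3" by simp_all
  have n9: "\<not> 3 ^ Suc 1 dvd card (carrier G)" using ord by (simp add: order_def)
  have o: "order G = 7 * 24" and nd: "\<not> 7 dvd (24::nat)" using ord by simp_all
  note two = two_sylow_subgroups[OF seven o nd cong_mod_7 R R' gen]
  have nR: "card (nrm R) = 21" using two(2) ord by simp
  have N: "subgroup (nrm R) G" by (rule nrm_sub[OF R(1)])
  have s3: "\<not> 3 ^ Suc 1 dvd order G" using ord by simp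
  have H7: "card H dvd 21 \<or> H = carrier G" if "subgroup H G" "7 dvd card H" for H
    using two(3)[OF that] nR by auto
  \<comment> \<open>Otherwise Q has 1 or 7 conjugates, and 1 contradicts
    \<open>V_not_normalizes_Q\<close>. If 7, the normalizers of R and of L in it have orders 21 and
    24 with gcd 3, so L has 7 conjugates inside the normalizer of R already. By conjugation all 7
    also lie in the normalizer of another Sylow 7-subgroup K, yet the two normalizers share at most
    3 elements.\<close>
  have hQ: "\<not> 12 dvd card (nrm Q)"
  proof
    assume "12 dvd card (nrm Q)"
    then obtain k where k: "card (nrm Q) = 12 * k" by blast
    obtain c j where c: "[c = 1] (mod 3)" "card (carrier G \<inter> nrm Q) = 3 * j" "c * (3 * j) = card (carrier G)"
      using class_count[OF subgroup_self Q(1) subgroup.subset[OF Q(1)] Q(2) three n9] by blast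
    have e: "card (carrier G \<inter> nrm Q) = card (nrm Q)" using nrm_carrier by (simp add: Int_absorb1)
    then have "c * (12 * k) = 168" using c k ord by (simp add: order_def)
    then have ck: "c * k = 14" by simp
    then have cd: "c dvd 14" by (metis dvd_triv_left)
    then have "c < 15" using dvd_imp_le[of c 14] by simp
    then have "c = 1 \<or> c = 4 \<or> c = 7 \<or> c = 10 \<or> c = 13" using c(1) by (auto simp: cong_def) presburger
    then have "c = 1 \<or> c = 7" using cd by auto
    moreover have "c \<noteq> 1"
    proof
      assume "c = 1"
      then have "card (nrm Q) = order G" using ck k ord by simp
      then have "nrm Q = carrier G" using nrm_carrier fin by (metis card_subset_eq order_def)
      then show False using V_not_normalizes_Q by blast
    qed
    ultimately have n24: "card (nrm Q) = 24" using ck k by auto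
    obtain L where L: "subgroup L G" "L \<subseteq> nrm R" "card L = 3" using cauchy_sub[OF N three] nR by auto
    have nL: "card (nrm L) = 24" using sylow_nrm_card[of L 3 1 Q] L Q n24 three s3 by simp
    have Lc: "L \<subseteq> carrier G" using L(1) by (simp add: subgroup.subset)
    let ?E = "(\<lambda>g. cj g L) ` carrier G" and ?F = "(\<lambda>g. cj g L) ` nrm R"
    have cE: "card ?E = 7" using card_conj_class[OF L(1)] nL ord by simp
    have d: "card (nrm R \<inter> nrm L) dvd 21" "card (nrm R \<inter> nrm L) dvd 24"
      using nrm_dvd(2)[OF N Lc] nR card_dvd[OF nrm_dvd(1)[OF N Lc] nrm_sub[OF L(1)]] nL by auto
    then have "card (nrm R \<inter> nrm L) dvd gcd 21 24" by (rule gcd_greatest)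
    moreover have "gcd 21 24 = (3::nat)" by (simp add: gcd_nat.simps)
    ultimately have "card (nrm R \<inter> nrm L) \<le> 3" by (simp add: dvd_imp_le)
    moreover have "card ?F * card (nrm R \<inter> nrm L) = 21" using card_conjugates[OF N Lc] nR by simp
    ultimately have "7 \<le> card ?F" using mult_le_mono2[of "card (nrm R \<inter> nrm L)" 3 "card ?F"] by simp
    moreover have "?F \<subseteq> ?E" using nrm_carrier by blast
    ultimately have EF: "?F = ?E" using cE fin by (metis card_seteq finite_imageI)
    have E_sub: "M \<subseteq> nrm R" if M: "M \<in> ?E" for M
    proof -
      obtain g where g: "g \<in> nrm R" "M = cj g L" using M unfolding EF[symmetric] by blast
      show ?thesis unfolding g(2) cj_def using g(1) L(2) N
        by (auto simp: subset_iff subgroup.m_closed subgroup.m_inv_closed)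
    qed
    have Rc: "R \<subseteq> carrier G" using R(1) by (simp add: subgroup.subset)
    have "nrm R \<noteq> carrier G" using nR ord by (auto simp: order_def)
    then obtain t where t: "t \<in> carrier G" "t \<notin> nrm R" using nrm_carrier by blast
    define K where "K = cj t R"
    have K: "K \<in> (\<lambda>g. cj g R) ` carrier G" "K \<noteq> R" using t by (auto simp: K_def nrm_def)
    obtain \<rho> where \<rho>: "\<rho> \<in> R" "\<rho> \<noteq> \<one>" using nontrivial_elem[OF R(1)] R(2) by auto
    interpret P: sylow_points G R 7 \<rho> K
    proof (intro sylow_points.intro fin_group_axioms sylow_points_axioms.intro)
      show "\<not> 7 ^ Suc 1 dvd order G" using ord by simp
    qed (use R \<rho> K two(1) seven in auto)
    have I3: "card (nrm R \<inter> nrm K) \<le> 3" using P.two_point_stabilizer nR by simp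
    have I: "subgroup (nrm R \<inter> nrm K) G" using subgroups_Inter_pair N subgroup_nrm[OF P.Kc] by blast
    have "M = nrm R \<inter> nrm K" if M: "M \<in> ?E" for M
    proof -
      have Ms: "subgroup M G" "card M = 3" "M \<subseteq> carrier G" using M subgroup_cj[OF L(1)] card_cj[OF Lc] L(3) cj_carrier[OF Lc] by auto
      obtain g where g: "g \<in> carrier G" "M = cj g L" using M by blast
      have "cj (inv t) M = cj (inv t \<otimes> g) L" using cj_mult[OF Lc inv_closed[OF t(1)] g(1)] g(2) by simp
      then have "cj (inv t) M \<in> ?E" using m_closed[OF inv_closed[OF t(1)] g(1)] by blast
      then have s: "cj (inv t) M \<subseteq> nrm R" by (rule E_sub)
      have "M \<subseteq> nrm K"
      proof
        fix y assume y: "y \<in> M"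
        then have yc: "y \<in> carrier G" using Ms by blast
        have "inv t \<otimes> y \<otimes> inv (inv t) \<in> nrm R" using cj_mem[OF y] s by blast
        then have z: "cj (inv t \<otimes> y \<otimes> t) R = R" using t(1) by (simp add: nrm_def)
        have "cj y K = cj (y \<otimes> t) R" unfolding K_def using cj_mult[OF Rc yc t(1)] by simp
        also have "y \<otimes> t = t \<otimes> (inv t \<otimes> y \<otimes> t)" using yc t(1) by (simp add: m_assoc[symmetric])
        also have "cj (t \<otimes> (inv t \<otimes> y \<otimes> t)) R = K" using cj_mult[OF Rc t(1), of "inv t \<otimes> y \<otimes> t"] yc t(1) z by (simp add: K_def)
        finally show "y \<in> nrm K" using yc by (simp add: nrm_def)
      qed
      then have "M \<subseteq> nrm R \<inter> nrm K" using E_sub[OF M] by blast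
      then show ?thesis using I3 Ms(2) finite_sub[OF I] by (metis card_seteq)
    qed
    then have "?E \<subseteq> {nrm R \<inter> nrm K}" by blast
    then have "card ?E \<le> 1" using card_mono[of "{nrm R \<inter> nrm K}" ?E] by simp
    then show False using cE by simp
  qed
  have h12: "\<not> 12 dvd card (nrm L)" if L: "subgroup L G" "card L = 3" for L
    using sylow_nrm_card[of L 3 1 Q] L Q hQ three s3 by simp
  have xn: "x \<in> nrm V"
  proof (rule in_nrm_V[OF x(1)])
    have "x \<otimes> a = a \<otimes> x" using x(1) by (simp add: x(2)[symmetric] m_assoc)
    then show "x \<otimes> a \<otimes> inv x \<in> V" using x(1) abw by (simp add: m_assoc V_def)
    show "x \<otimes> b \<otimes> inv x \<in> V" using x abw by (simp add: m_assoc V_def)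
  qed
  \<comment> \<open>V and <x> give a factor 8, V and Q a factor 12, so 24 divides the order. A
    factor 7 would yield a subgroup of order 28, excluded by \<open>H7\<close>.\<close>
  have nV: "card (nrm V) = 24"
  proof -
    let ?X = "generate G {x}"
    have X: "subgroup ?X G" by (rule gen_subgroup[OF x(1)])
    have x4: "x [^] (4::nat) = \<one>"
    proof -
      have "x [^] (4::nat) = (x \<otimes> x) \<otimes> (x \<otimes> x)" using x(1) by (simp add: numeral_eq_Suc m_assoc)
      then show ?thesis using x(2) ab(1) by simp
    qed
    have "ord x dvd 2 ^ 2" using pow_eq_id[OF x(1), of 4] x4 by simp
    moreover have "\<not> ord x dvd 2" using pow_eq_id[OF x(1), of 2] x ab(4) by (simp add: numeral_2_eq_2)
    ultimately have "ord x = 4" using divides_primepow_nat[OF two_is_prime_nat, of "ord x" 2]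
      by (auto simp: le_Suc_eq numeral_2_eq_2)
    then have cX: "card ?X = 4" using generate_pow_card[OF x(1)] by simp
    have xV: "x \<notin> V"
    proof
      assume "x \<in> V"
      then have "x \<otimes> x = \<one>" using abw ab(1,2) products unfolding V_def by (elim insertE emptyE) simp_all
      then show False using x ab by simp
    qed
    have I: "subgroup (V \<inter> ?X) G" using subgroups_Inter_pair V(1) X by blast
    have "card (V \<inter> ?X) dvd 2 ^ 2" using card_dvd[OF I V(1)] V(2) by simp
    moreover have "card (V \<inter> ?X) \<noteq> 4"
    proof
      assume "card (V \<inter> ?X) = 4"
      then have "V \<inter> ?X = ?X" using cX finite_sub[OF X] by (metis card_subset_eq inf_le2)
      then show False using xV gen_self[of x] by blast
    qed
    ultimately have "card (V \<inter> ?X) = 1 \<or> card (V \<inter> ?X) = 2"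
      using divides_primepow_nat[OF two_is_prime_nat, of "card (V \<inter> ?X)" 2] by (auto simp: le_Suc_eq numeral_2_eq_2)
    moreover have "card (V <#> ?X) * card (V \<inter> ?X) = 16" using card_prod[OF V(1) X] V(2) cX by simp
    ultimately have "8 dvd card (V <#> ?X)" by auto
    moreover have Xn: "?X \<subseteq> nrm V" using gen_subset[OF nrm_sub[OF V(1)] xn] .
    moreover have VX: "subgroup (V <#> ?X) G" by (rule subgroup_prod[OF V(1) X Xn])
    moreover have "V <#> ?X \<subseteq> nrm V" using prod_subset[OF nrm_sub[OF V(1)] self_subset_nrm[OF V(1)] Xn] .
    ultimately have d8: "8 dvd card (nrm V)" using sub_nrm_dvd[OF V(1) VX] dvd_trans by blast
    have d3: "12 dvd card (nrm V)" using sub_nrm_dvd[OF V(1) VQ(1,3)] VQ(2) by simp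
    have d24: "24 dvd card (nrm V)" using d8 d3 by presburger
    then obtain k where k: "card (nrm V) = 24 * k" by blast
    have "card (nrm V) dvd 168" using card_dvd_order[OF nrm_sub[OF V(1)]] ord by simp
    then have "k dvd 7" using k by simp
    then have "k = 1 \<or> k = 7" using seven prime_nat_iff by blast
    moreover have "k \<noteq> 7"
    proof
      assume "k = 7"
      then have "7 dvd card (nrm V)" using k by simp
      then obtain M where M: "subgroup M G" "card M = 4 * 7 ^ 1"
        using nrm_prod[OF V(1) seven, of 1] V(2) by (auto simp: coprime_iff_gcd_eq_1 gcd_nat.simps)
      then have "card M dvd 21 \<or> M = carrier G" using H7[OF M(1)] by simp
      then show False using M(2) ord by (auto simp: order_def)
    qed
    ultimately show ?thesis using k by simp
  qed
  let ?U = "nrm V"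
  have U: "subgroup ?U G" by (rule nrm_sub[OF V(1)])
  have nU9: "\<not> 3 ^ Suc 1 dvd card ?U" using nV by simp
  \<comment> \<open>Q has 1 or 4 conjugates in \<open>?U\<close>, and 1 is excluded by
    \<open>hQ\<close>; so its normalizer in \<open>?U\<close> has order 24 / 4 = 6.\<close>
  obtain c j where c: "[c = 1] (mod 3)" "card (?U \<inter> nrm Q) = 3 * j" "c * (3 * j) = card ?U"
    using class_count[OF U Q(1) Q_V Q(2) three nU9] by blast
  have cj8: "c * j = 8" using c nV by simp
  then have "c dvd 8" by (metis dvd_triv_left)
  then have "c < 9" using dvd_imp_le[of c 8] by simp
  then have "c = 1 \<or> c = 4 \<or> c = 7" using c(1) by (auto simp: cong_def) presburger
  then have "c = 1 \<or> c = 4" using \<open>c dvd 8\<close> by auto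
  moreover have "c \<noteq> 1"
  proof
    assume "c = 1"
    then have "?U \<subseteq> nrm Q" using class_one[OF U] c by simp
    then have "24 dvd card (nrm Q)" using sub_nrm_dvd[OF Q(1) U] nV by simp
    then have "12 dvd card (nrm Q)" by presburger
    then show False using hQ by blast
  qed
  ultimately have c6: "card (?U \<inter> nrm Q) = 6" using c cj8 by auto
  have UQ: "subgroup (?U \<inter> nrm Q) G" by (rule nrm_dvd(1)[OF U subgroup.subset[OF Q(1)]])
  show ?thesis
  proof (intro case168.intro fin_group_axioms case168_axioms.intro)
    show "H = carrier G" if H: "subgroup H G" "2 dvd card H" "7 dvd card H" for H
    proof -
      have "\<not> card H dvd 21" using H(2) dvd_trans[of 2 "card H" 21] by auto
      then show ?thesis using H7[OF H(1,3)] by blast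
    qed
    show "card K \<noteq> 2 * 3" if "subgroup T G" "subgroup K G" "card T = 2\<^sup>2 * 3" "K \<subseteq> T" for T K
      using no_order_6_in_12[OF h12 that(1) _ that(2,4)] that(3) by simp
    show "\<exists>T. subgroup T G \<and> card T = 2\<^sup>2 * 3" using VQ by auto
    show "\<exists>W. subgroup W G \<and> card W = 3 * 7" using N nR by auto
    show "\<exists>S U. subgroup S G \<and> subgroup U G \<and> S \<subseteq> U \<and> card S = 2 * 3 \<and> card U = 2 ^ 3 * 3"
      using UQ U c6 nV by (intro exI[of _ "?U \<inter> nrm Q"] exI[of _ ?U]) simp
  qed (use ord in auto)
qed

section \<open>The main theorem\<close>

text \<open>As -1 = 2^2 modulo 5, the diagonal matrix with entries 2 and 3 squares to -1, and so
  does the matrix with rows (0, 1) and (-1, 0); both become involutions in the quotient. The third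
  matrix has determinant 1 and trace -1, so its cube is 1.\<close>

lemma case60_PSL2: "case60 (PSL2 (residue_ring 5)) 2 3 5"
proof -
  interpret sl2_prime 5 by unfold_locales simp_all
  interpret K: klein_extension G0 "P 0 1 4 0" "P 2 0 0 3" "P 1 2 1 3"
    by (intro klein_extension.intro P.fin_group_axioms klein_extension_axioms.intro P_in)
      (simp_all add: P_mult P_one P_eq mk_eq)
  show ?thesis
  proof (rule K.case60_intro)
    show "order G0 = 60" using order_G0 by simp
    show "\<forall>H. subgroup H G0 \<longrightarrow> unip_u \<subseteq> H \<longrightarrow> unip_l \<subseteq> H \<longrightarrow> H = carrier G0"
      using upper_lower_generate by blast
  qed (use upper_lower in simp_all)
qed

text \<open>Since -1 is no square modulo 7, a diagonal involution does not exist; the second matrix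
  has rows (s, t) and (t, -s) with s^2 + t^2 = 4 + 9 = -1. The third has trace 1, so its cube is -1.
  The matrix of \<open>P 2 2 5 2\<close> squares to the first one.\<close>

lemma case168_PSL2: "case168 (PSL2 (residue_ring 7)) 2 3 7"
proof -
  interpret sl2_prime 7 by unfold_locales simp_all
  interpret K: klein_extension G0 "P 0 1 6 0" "P 2 3 3 5" "P 0 2 3 1"
    by (intro klein_extension.intro P.fin_group_axioms klein_extension_axioms.intro P_in)
      (simp_all add: P_mult P_one P_eq mk_eq)
  show ?thesis
  proof (rule K.case168_intro)
    show "order G0 = 168" using order_G0 by simp
    show "\<forall>H. subgroup H G0 \<longrightarrow> unip_u \<subseteq> H \<longrightarrow> unip_l \<subseteq> H \<longrightarrow> H = carrier G0"
      using upper_lower_generate by blast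
    show "P 2 2 5 2 \<in> carrier G0" by (rule P_in) simp
  qed (use upper_lower in \<open>simp_all add: P_mult P_one P_eq mk_eq\<close>)
qed

theorem mainTheorem1:
  fixes G :: "('a, 'm) monoid_scheme"
    and G\<^sub>0 :: "(int \<times> int \<times> int \<times> int) set monoid"
  assumes "G\<^sub>0 \<in> {PSL2 (residue_ring 5), PSL2 (residue_ring 7)}"
    and "group G"
    and "finite (carrier G)"
    and "poset_isomorphic (iso_poset G) (iso_poset G\<^sub>0)"
  shows "G \<cong> G\<^sub>0"
proof (cases "G\<^sub>0 = PSL2 (residue_ring 5)")
  case True
  have c0: "case60 G\<^sub>0 2 3 5" using case60_PSL2 True by simp
  interpret H: case60 G\<^sub>0 2 3 5 by (rule c0)
  obtain C where "subgroup_corr G G\<^sub>0 C"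
    using poset_isomorphic_corr[OF assms(2,3) H.is_group H.fin assms(4)] by blast
  then obtain p q r where "case60 G p q r" using case60_transfer c0 by blast
  then show ?thesis
    using case60.iso_perm_60 H.iso_perm_60 H.iso_sym iso_trans by blast
next
  case False
  then have c0: "case168 G\<^sub>0 2 3 7" using case168_PSL2 assms(1) by simp
  interpret H: case168 G\<^sub>0 2 3 7 by (rule c0)
  obtain C where "subgroup_corr G G\<^sub>0 C"
    using poset_isomorphic_corr[OF assms(2,3) H.is_group H.fin assms(4)] by blast
  then obtain p q r where "case168 G p q r" using case168_transfer c0 by blast
  then show ?thesis
    using case168.iso_perm_168 H.iso_perm_168 H.iso_sym iso_trans by blast
qed

end
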